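(* If a $3$-uniform hypergraph $H$ on $n$ vertices contains no subgraph on $14$ vertices with $10$ edges, then $H$ has $o(n^2)$ edges. That is, for every $c>0$ there exists $n_0=n_0(c)$ such that for every $n\ge n_0$, every $3$-uniform hypergraph on $n$ vertices which contains no subgraph with exactly $14$ vertices and exactly $10$ edges has fewer than $cn^2$ edges.
   Context: A $3$-uniform hypergraph on $n$ vertices is a vertex set of size $n$ together with a set of $3$-element subsets of it, called edges (no repeated edges). A subgraph of a hypergraph $H$ consists of a subset of the vertices of $H$ together with a set of edges of $H$ contained in that subset (not necessarily all of them; isolated vertices are allowed). *)

theory Defs
  imports Complex_Main
begin

type_synonym 'a hypergraph = "'a set \<times> 'a set set"

abbreviation verts :: "'a hypergraph \<Rightarrow> 'a set" where
  "verts \<equiv> fst"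

abbreviation edges :: "'a hypergraph \<Rightarrow> 'a set set" where
  "edges \<equiv> snd"

definition three_uniform :: "'a hypergraph \<Rightarrow> bool" where
  "three_uniform H \<longleftrightarrow>
     finite (verts H) \<and> (\<forall>e\<in>edges H. e \<subseteq> verts H \<and> card e = 3)"

(* Neither induced nor spanning: edges of H inside verts S may be left out,
   and isolated vertices are allowed. *)
definition subhypergraph :: "'a hypergraph \<Rightarrow> 'a hypergraph \<Rightarrow> bool" where
  "subhypergraph S H \<longleftrightarrow>
     verts S \<subseteq> verts H \<and> edges S \<subseteq> edges H \<and> (\<forall>e\<in>edges S. e \<subseteq> verts S)"

end

theory Submission
  imports Defs "HOL-Library.FuncSet" "HOL-Library.Indicator_Function"
begin

text \<open>
Bounded codegrees let us pass to a linear subhypergraph \<open>L\<close> with a positive proportion of the edges.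
Triangle removal, applied to the graph of covered pairs, yields \<open>\<Omega>(n\<^sup>3)\<close> triangles: corners \<open>a, b, c\<close>
and third vertices \<open>x, y, z\<close> with \<open>bcx, acy, abz \<in> L\<close>; averaging over colourings we may assume that
they are rainbow. Four triangles on the same \<open>x, y, z\<close> contain ten edges on fourteen vertices, so
up to a constant factor \<open>x, y, z\<close> determine the triangle. Then any three coordinates of
\<open>(a, x, y, z)\<close> determine the fourth, and the removal lemma for 3-uniform simplices gives a
quadruple \<open>(a, x, y, z)\<close> whose four faces come from four different triangles. These triangles share
the edges \<open>abz\<close> and \<open>acy\<close>, and their union has ten edges on fourteen vertices.

The simplex removal lemma is proved by a two-level regularity argument: first pairs of vertices are
partitioned so that the faces are regular up to an error that is tiny even compared with the
complexity of the vertex partition that is afterwards needed to regularise the pairs.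
\<close>

section \<open>Conditional expectations and strong regularity\<close>

text \<open>Removal is used in its counting form, where trivial copies are the obstacle: an edge of
  \<open>L\<close> is already a triangle of its pair graph, and a member of \<open>Q\<close> is
  already a simplex. Regularity produces order n^3 triangles and order n^4 simplices around a single
  good copy, while at most n^2 and n^3 of these are trivial.

  In the simplex count a face indicator f is split as (f - g) + (g - s) + s, where s and g average f
  over the coarse and the fine partition of pairs. The part f - g is small only in cut norm, g - s
  only in mean square, and s is constant on each polyad. The fine partition has no bounded
  complexity, so the vertex partition regularises the coarse one alone, and g - s is handled through
  L1 errors on polyads.

  Tests are functions with values in [0, 1] instead of sets, so that the factors left over when a
  product is telescoped are again admissible tests. Faces are ordered tuples over a single vertex
  set, with a separate family for each omitted position, in place of a partite hypergraph.\<close>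

definition cexp :: "'w set \<Rightarrow> ('w \<Rightarrow> 'w \<Rightarrow> bool) \<Rightarrow> ('w \<Rightarrow> real) \<Rightarrow> 'w \<Rightarrow> real" where
  "cexp \<Omega> R f x = (\<Sum>y | y \<in> \<Omega> \<and> R x y. f y) / real (card {y \<in> \<Omega>. R x y})"

lemma cexp_cong:
  assumes "equivp R" "R x y"
  shows "cexp \<Omega> R f x = cexp \<Omega> R f y"
proof -
  have "R x = R y"
    using assms by (simp add: equivp_def)
  then show ?thesis by (simp add: cexp_def)
qed

text \<open>The averaging projection is self-adjoint: after exchanging the two sums,
  \<open>y\<close> receives \<open>g y * f y\<close> divided by the size of its class once for every
  member of that class. Preservation of the total, the density bound and Pythagoras below are
  instances with a suitable invariant \<open>g\<close>.\<close>

lemma sum_mult_cexp: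
  assumes "finite \<Omega>" "equivp R" and inv: "\<And>x y. x \<in> \<Omega> \<Longrightarrow> y \<in> \<Omega> \<Longrightarrow> R x y \<Longrightarrow> g x = g y"
  shows "(\<Sum>x\<in>\<Omega>. g x * cexp \<Omega> R f x) = (\<Sum>x\<in>\<Omega>. g x * f x)"
proof -
  let ?c = "\<lambda>x. real (card {y \<in> \<Omega>. R x y})"
  have sym: "R x y \<longleftrightarrow> R y x" for x y
    using assms(2) by (meson equivp_symp)
  have eq: "R x y \<Longrightarrow> R x = R y" for x y
    using assms(2) by (simp add: equivp_def)
  have "(\<Sum>x\<in>\<Omega>. g x * cexp \<Omega> R f x) = (\<Sum>x\<in>\<Omega>. \<Sum>y\<in>\<Omega>. if R x y then g x * f y / ?c x else 0)"
    using assms(1)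
    by (simp add: cexp_def sum.inter_filter[symmetric] sum_distrib_left sum_divide_distrib)
  also have "\<dots> = (\<Sum>y\<in>\<Omega>. \<Sum>x\<in>\<Omega>. if R x y then g x * f y / ?c x else 0)"
    by (rule sum.swap)
  also have "\<dots> = (\<Sum>y\<in>\<Omega>. \<Sum>x\<in>\<Omega>. if R y x then g y * f y / ?c y else 0)"
  proof (intro sum.cong refl)
    fix y x assume "y \<in> \<Omega>" "x \<in> \<Omega>"
    then show "(if R x y then g x * f y / ?c x else 0) = (if R y x then g y * f y / ?c y else 0)"
      using sym[of x y] eq[of x y] inv[of x y] by auto
  qed
  also have "\<dots> = (\<Sum>y\<in>\<Omega>. ?c y * (g y * f y / ?c y))"
    using assms(1) by (simp add: sum.inter_filter[symmetric])
  also have "\<dots> = (\<Sum>y\<in>\<Omega>. g y * f y)"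
  proof (intro sum.cong refl)
    fix y assume "y \<in> \<Omega>"
    then have "y \<in> {z \<in> \<Omega>. R y z}"
      using assms(2) by (simp add: equivp_reflp)
    then have "?c y > 0"
      using assms(1) by (auto simp: card_gt_0_iff)
    then show "?c y * (g y * f y / ?c y) = g y * f y" by simp
  qed
  finally show ?thesis .
qed

lemma sum_cexp:
  assumes "finite \<Omega>" "equivp R"
  shows "(\<Sum>x\<in>\<Omega>. cexp \<Omega> R f x) = (\<Sum>x\<in>\<Omega>. f x)"
  using sum_mult_cexp[OF assms, of "\<lambda>_. 1"] by simp

lemma cexp_nonneg:
  assumes "\<And>x. x \<in> \<Omega> \<Longrightarrow> 0 \<le> f x"
  shows "0 \<le> cexp \<Omega> R f x"
  unfolding cexp_def by (intro divide_nonneg_nonneg sum_nonneg) (use assms in auto)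

lemma cexp_le_1:
  assumes "\<And>x. x \<in> \<Omega> \<Longrightarrow> f x \<le> 1"
  shows "cexp \<Omega> R f x \<le> 1"
proof -
  have "(\<Sum>y | y \<in> \<Omega> \<and> R x y. f y) \<le> (\<Sum>y | y \<in> \<Omega> \<and> R x y. 1)"
    by (intro sum_mono) (use assms in auto)
  then show ?thesis
    by (auto simp: cexp_def divide_le_eq_1 of_nat_less_0_iff)
qed

lemma cexp_markov:
  assumes "finite \<Omega>" "equivp R" "\<And>x. x \<in> \<Omega> \<Longrightarrow> 0 \<le> f x"
  shows "k * real (card {x \<in> \<Omega>. cexp \<Omega> R f x > k}) \<le> (\<Sum>x\<in>\<Omega>. f x)"
proof -
  have "k * real (card {x \<in> \<Omega>. cexp \<Omega> R f x > k}) = (\<Sum>x | x \<in> \<Omega> \<and> cexp \<Omega> R f x > k. k)"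
    by simp
  also have "\<dots> \<le> (\<Sum>x | x \<in> \<Omega> \<and> cexp \<Omega> R f x > k. cexp \<Omega> R f x)"
    by (intro sum_mono) auto
  also have "\<dots> \<le> (\<Sum>x\<in>\<Omega>. cexp \<Omega> R f x)"
    by (intro sum_mono2 cexp_nonneg) (use assms in auto)
  finally show ?thesis using sum_cexp[OF assms(1,2)] by simp
qed

text \<open>The points whose class has density below \<open>d\<close> in \<open>A\<close> form a
  union of classes, so the points of \<open>A\<close> among them can be counted with the density in
  place of the indicator.\<close>

lemma cexp_small:
  assumes "finite \<Omega>" "equivp R" "A \<subseteq> \<Omega>" "0 \<le> d"
  shows "real (card {x \<in> A. cexp \<Omega> R (indicator A) x < d}) \<le> d * real (card \<Omega>)"
proof -
  let ?s = "cexp \<Omega> R (indicator A)"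
  let ?g = "\<lambda>x. of_bool (?s x < d) :: real"
  have fA: "finite A" using assms finite_subset by blast
  have "real (card {x \<in> A. ?s x < d}) = (\<Sum>x\<in>\<Omega>. ?g x * indicator A x)"
  proof -
    have "(\<Sum>x\<in>\<Omega>. ?g x * indicator A x) = (\<Sum>x\<in>\<Omega>. if x \<in> {x\<in>A. ?s x < d} then 1 else 0)"
      by (intro sum.cong) (auto simp: indicator_def)
    also have "\<dots> = real (card {x \<in> A. ?s x < d})"
    proof -
      have "{x \<in> \<Omega>. x \<in> A \<and> ?s x < d} = {x \<in> A. ?s x < d}" using assms(3) by auto
      then show ?thesis using assms(1) by (simp add: sum.inter_filter[symmetric])
    qed
    finally show ?thesis by simp
  qed
  also have "\<dots> = (\<Sum>x\<in>\<Omega>. ?g x * ?s x)"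
    by (rule sum_mult_cexp[OF assms(1,2), symmetric]) (simp add: cexp_cong[OF assms(2)])
  also have "\<dots> \<le> (\<Sum>x\<in>\<Omega>. d)"
    by (intro sum_mono) (use assms(4) in auto)
  finally show ?thesis by (simp add: mult.commute)
qed

text \<open>\<open>cexp \<Omega> R f\<close> is constant on the classes of both relations, so its
  products with \<open>cexp \<Omega> R' f\<close> and with itself have the same sum as its product
  with \<open>f\<close>. The cross term is therefore the coarse square.\<close>

lemma cexp_pythagoras:
  assumes "finite \<Omega>" "equivp R" "equivp R'" "\<And>x y. R' x y \<Longrightarrow> R x y"
  shows "(\<Sum>x\<in>\<Omega>. (cexp \<Omega> R' f x - cexp \<Omega> R f x)\<^sup>2)
    = (\<Sum>x\<in>\<Omega>. (cexp \<Omega> R' f x)\<^sup>2) - (\<Sum>x\<in>\<Omega>. (cexp \<Omega> R f x)\<^sup>2)"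
proof -
  have "(\<Sum>x\<in>\<Omega>. cexp \<Omega> R f x * cexp \<Omega> R' f x) = (\<Sum>x\<in>\<Omega>. cexp \<Omega> R f x * f x)"
    by (rule sum_mult_cexp[OF assms(1,3)]) (rule cexp_cong[OF assms(2,4)])
  also have "\<dots> = (\<Sum>x\<in>\<Omega>. cexp \<Omega> R f x * cexp \<Omega> R f x)"
    by (rule sum_mult_cexp[OF assms(1,2), symmetric]) (rule cexp_cong[OF assms(2)])
  finally have *: "(\<Sum>x\<in>\<Omega>. cexp \<Omega> R f x * cexp \<Omega> R' f x) = (\<Sum>x\<in>\<Omega>. (cexp \<Omega> R f x)\<^sup>2)"
    by (simp add: power2_eq_square)
  have "(\<Sum>x\<in>\<Omega>. (cexp \<Omega> R' f x - cexp \<Omega> R f x)\<^sup>2)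
     = (\<Sum>x\<in>\<Omega>. (cexp \<Omega> R' f x)\<^sup>2 + (cexp \<Omega> R f x)\<^sup>2 - 2 * (cexp \<Omega> R f x * cexp \<Omega> R' f x))"
    by (intro sum.cong) (auto simp: power2_eq_square algebra_simps)
  then show ?thesis
    by (simp add: sum.distrib sum_subtractf sum_distrib_left[symmetric] *)
qed

text \<open>Cauchy-Schwarz against the constant 1, obtained by expanding the double sum of squared
  differences.\<close>

lemma sum_squared_le: "(\<Sum>x\<in>A. g x)\<^sup>2 \<le> real (card A) * (\<Sum>x\<in>A. (g x :: real)\<^sup>2)"
proof -
  have "0 \<le> (\<Sum>x\<in>A. \<Sum>y\<in>A. (g x - g y)\<^sup>2)" by (intro sum_nonneg) auto
  also have "\<dots> = (\<Sum>x\<in>A. \<Sum>y\<in>A. (g x)\<^sup>2 + (g y)\<^sup>2 - 2 * (g x * g y))"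
    by (intro sum.cong refl) (simp add: power2_eq_square algebra_simps)
  also have "\<dots> = 2 * (real (card A) * (\<Sum>x\<in>A. (g x)\<^sup>2)) - 2 * (\<Sum>x\<in>A. g x)\<^sup>2"
    by (simp add: sum.distrib sum_subtractf sum_distrib_left[symmetric] sum_distrib_right[symmetric] power2_eq_square)
  finally show ?thesis by simp
qed

text \<open>Partitions are given by families of base relations: \<open>x\<close> and \<open>y\<close> lie in the same cell if no
  relation in \<open>S\<close> separates them, and \<open>card S\<close> measures the complexity.\<close>
definition meet :: "('b \<Rightarrow> 'w \<Rightarrow> 'w \<Rightarrow> bool) \<Rightarrow> 'b set \<Rightarrow> 'w \<Rightarrow> 'w \<Rightarrow> bool" where
  "meet r S x y \<longleftrightarrow> (\<forall>s\<in>S. r s x y)"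

lemma equivp_meet:
  assumes "\<And>s. equivp (r s)"
  shows "equivp (meet r S)"
proof (intro equivpI reflpI sympI transpI)
  show "meet r S x x" for x
    using assms by (simp add: meet_def equivp_reflp)
  show "meet r S y x" if "meet r S x y" for x y
    using that assms unfolding meet_def by (blast intro: equivp_symp)
  show "meet r S x z" if "meet r S x y" "meet r S y z" for x y z
    using that assms unfolding meet_def by (blast intro: equivp_transp)
qed

lemma meet_mono: "S \<subseteq> S' \<Longrightarrow> meet r S' x y \<Longrightarrow> meet r S x y"
  by (auto simp: meet_def)

definition energy :: "'w set \<Rightarrow> 'j set \<Rightarrow> ('j \<Rightarrow> 'w \<Rightarrow> real) \<Rightarrow> ('w \<Rightarrow> 'w \<Rightarrow> bool) \<Rightarrow> real" where
  "energy \<Omega> J f R = (\<Sum>j\<in>J. \<Sum>x\<in>\<Omega>. (cexp \<Omega> R (f j) x)\<^sup>2)"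

lemma energy_diff:
  assumes "finite \<Omega>" "equivp R" "equivp R'" "\<And>x y. R' x y \<Longrightarrow> R x y"
  shows "energy \<Omega> J f R' - energy \<Omega> J f R
    = (\<Sum>j\<in>J. \<Sum>x\<in>\<Omega>. (cexp \<Omega> R' (f j) x - cexp \<Omega> R (f j) x)\<^sup>2)"
  using cexp_pythagoras[OF assms] by (simp add: energy_def sum_subtractf)

lemma energy_le:
  assumes "\<And>j x. j \<in> J \<Longrightarrow> x \<in> \<Omega> \<Longrightarrow> 0 \<le> f j x \<and> f j x \<le> 1"
  shows "energy \<Omega> J f R \<le> real (card J) * real (card \<Omega>)"
proof -
  have "energy \<Omega> J f R \<le> (\<Sum>j\<in>J. \<Sum>x\<in>\<Omega>. 1)"
    unfolding energy_def
    by (intro sum_mono) (use assms cexp_nonneg cexp_le_1 in \<open>meson power_le_one\<close>)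
  then show ?thesis by simp
qed

text \<open>The test sets \<open>T\<close> are unions of cells of a partition of complexity at most 3; this covers
  rectangles in \<open>V \<times> V\<close> and the triangle sets of three graphs in \<open>V \<times> V \<times> V\<close>.\<close>
definition uniform :: "'w set \<Rightarrow> 'j set \<Rightarrow> ('j \<Rightarrow> 'w \<Rightarrow> real) \<Rightarrow> ('b \<Rightarrow> 'w \<Rightarrow> 'w \<Rightarrow> bool) \<Rightarrow> 'b set \<Rightarrow> real \<Rightarrow> bool" where
  "uniform \<Omega> J f r S t \<longleftrightarrow> (\<forall>j\<in>J. \<forall>B T. finite B \<longrightarrow> card B \<le> 3 \<longrightarrow> T \<subseteq> \<Omega>
      \<longrightarrow> (\<forall>x\<in>T. \<forall>y\<in>\<Omega>. meet r B x y \<longrightarrow> y \<in> T)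
      \<longrightarrow> \<bar>\<Sum>x\<in>T. f j x - cexp \<Omega> (meet r S) (f j) x\<bar> \<le> t * real (card \<Omega>))"

text \<open>Once the at most three relations witnessing the failure are added, \<open>T\<close> is a
  union of cells and averaging no longer changes the sum of \<open>f j\<close> over it. The
  discrepancy is then carried by the difference of the two averages; Cauchy-Schwarz turns it into a
  mean square, and Pythagoras into an energy gain.\<close>

lemma energy_increment:
  fixes r :: "'b \<Rightarrow> 'w \<Rightarrow> 'w \<Rightarrow> bool"
  assumes fin: "finite \<Omega>" "finite J" and eq: "\<And>s. equivp (r s)" and t: "t > 0" and \<Omega>: "\<Omega> \<noteq> {}"
    and S: "finite S" and nu: "\<not> uniform \<Omega> J f r S t"
  obtains S' where "finite S'" "S \<subseteq> S'" "card S' \<le> card S + 3"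
    "energy \<Omega> J f (meet r S') \<ge> energy \<Omega> J f (meet r S) + t\<^sup>2 * real (card \<Omega>)"
proof -
  from nu obtain j B T where jB: "j \<in> J" "finite B" "card B \<le> 3" "T \<subseteq> \<Omega>"
    and inv: "\<And>x y. x \<in> T \<Longrightarrow> y \<in> \<Omega> \<Longrightarrow> meet r B x y \<Longrightarrow> y \<in> T"
    and big: "\<bar>\<Sum>x\<in>T. f j x - cexp \<Omega> (meet r S) (f j) x\<bar> > t * real (card \<Omega>)"
    unfolding uniform_def by (auto simp: not_le)
  let ?S = "S \<union> B" and ?N = "real (card \<Omega>)"
  let ?d = "\<lambda>i x. cexp \<Omega> (meet r ?S) (f i) x - cexp \<Omega> (meet r S) (f i) x"
  have N: "?N > 0" using fin \<Omega> by (simp add: card_gt_0_iff)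
  have E: "equivp (meet r A)" for A using equivp_meet[of r] eq by blast
  have sym: "meet r A x y \<Longrightarrow> meet r A y x" for A x y using E equivp_symp by metis
  have TO: "(\<Sum>x\<in>T. g x) = (\<Sum>x\<in>\<Omega>. indicator T x * g x)" for g :: "'w \<Rightarrow> real"
    using fin jB by (simp add: sum.inter_restrict[symmetric] indicator_def Int_absorb1 if_distrib[of "\<lambda>a. a * _"] cong: if_cong)
  have "(\<Sum>x\<in>T. f j x) = (\<Sum>x\<in>T. cexp \<Omega> (meet r ?S) (f j) x)"
    unfolding TO
  proof (rule sum_mult_cexp[symmetric, OF fin(1) E])
    fix x y assume "x \<in> \<Omega>" "y \<in> \<Omega>" "meet r ?S x y"
    then have *: "meet r B x y" by (intro meet_mono[of B ?S]) auto
    then have "meet r B y x" by (rule sym)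
    then show "indicator T x = (indicator T y :: real)"
      using * inv[of x y] inv[of y x] \<open>x \<in> \<Omega>\<close> \<open>y \<in> \<Omega>\<close> by (auto simp: indicator_def)
  qed
  then have "(\<Sum>x\<in>T. f j x - cexp \<Omega> (meet r S) (f j) x) = (\<Sum>x\<in>T. ?d j x)"
    by (simp add: sum_subtractf)
  then have "t * ?N \<le> \<bar>\<Sum>x\<in>T. ?d j x\<bar>" using big by simp
  then have "(t * ?N)\<^sup>2 \<le> (\<Sum>x\<in>T. ?d j x)\<^sup>2"
    using t N by (metis abs_le_square_iff abs_of_pos mult_pos_pos)
  also have "\<dots> \<le> real (card T) * (\<Sum>x\<in>T. (?d j x)\<^sup>2)" by (rule sum_squared_le)
  also have "\<dots> \<le> ?N * (\<Sum>x\<in>\<Omega>. (?d j x)\<^sup>2)"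
    using jB fin by (intro mult_mono sum_mono2 sum_nonneg) (auto intro: card_mono)
  finally have "t\<^sup>2 * ?N \<le> (\<Sum>x\<in>\<Omega>. (?d j x)\<^sup>2)"
    using N by (simp add: power2_eq_square mult.assoc mult.left_commute)
  also have "\<dots> \<le> (\<Sum>i\<in>J. \<Sum>x\<in>\<Omega>. (?d i x)\<^sup>2)"
    by (rule member_le_sum) (use jB fin in \<open>auto intro: sum_nonneg\<close>)
  also have "\<dots> = energy \<Omega> J f (meet r ?S) - energy \<Omega> J f (meet r S)"
    by (rule energy_diff[symmetric]) (use fin E meet_mono[of S ?S] in auto)
  finally have "energy \<Omega> J f (meet r ?S) \<ge> energy \<Omega> J f (meet r S) + t\<^sup>2 * ?N" by simp
  moreover have "card ?S \<le> card S + 3" using card_Un_le[of S B] jB by linarith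
  ultimately show ?thesis using that[of ?S] S jB by auto
qed

lemma uniform_refinement:
  fixes r :: "'b \<Rightarrow> 'w \<Rightarrow> 'w \<Rightarrow> bool"
  assumes "finite \<Omega>" "finite J" and eq: "\<And>s. equivp (r s)" and t: "t > 0" and "\<Omega> \<noteq> {}"
    and f: "\<And>j x. j \<in> J \<Longrightarrow> x \<in> \<Omega> \<Longrightarrow> 0 \<le> f j x \<and> f j x \<le> 1"
    and "finite S" and "real k * t\<^sup>2 \<ge> real (card J)"
  obtains S' where "finite S'" "S \<subseteq> S'" "card S' \<le> card S + 3 * (k + 1)" "uniform \<Omega> J f r S' t"
proof -
  let ?N = "real (card \<Omega>)"
  have N: "?N > 0" using assms by (simp add: card_gt_0_iff)
  \<comment> \<open>\<open>l\<close> counts the increments of size \<open>t\<^sup>2 * ?N\<close>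
    still possible below the maximal energy \<open>card J * ?N\<close>; at \<open>l = 0\<close> the
    assumed lower bound already exceeds that maximum.\<close>
  have "\<exists>S'. finite S' \<and> S \<subseteq> S' \<and> card S' \<le> card S + 3 * l \<and> uniform \<Omega> J f r S' t"
    if "finite S" "energy \<Omega> J f (meet r S) > real (card J) * ?N - real l * t\<^sup>2 * ?N" for l S
    using that
  proof (induction l arbitrary: S)
    case 0
    then show ?case using energy_le[of J \<Omega> f "meet r S"] f by auto
  next
    case (Suc l)
    show ?case
    proof (cases "uniform \<Omega> J f r S t")
      case True
      then show ?thesis using Suc by auto
    next
      case False
      obtain S1 where S1: "finite S1" "S \<subseteq> S1" "card S1 \<le> card S + 3"
        "energy \<Omega> J f (meet r S1) \<ge> energy \<Omega> J f (meet r S) + t\<^sup>2 * ?N"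
        using energy_increment[OF assms(1-5) Suc.prems(1) False] by blast
      then have "energy \<Omega> J f (meet r S1) > real (card J) * ?N - real l * t\<^sup>2 * ?N"
        using Suc.prems(2) by (simp add: algebra_simps)
      then obtain S2 where "finite S2" "S1 \<subseteq> S2" "card S2 \<le> card S1 + 3 * l" "uniform \<Omega> J f r S2 t"
        using Suc.IH S1 by blast
      then show ?thesis using S1 by (intro exI[of _ S2]) auto
    qed
  qed
  \<comment> \<open>The \<open>+ 1\<close> makes the budget inequality strict, since
    \<open>k\<close> increments may only just reach the maximum.\<close>
  moreover have "energy \<Omega> J f (meet r S) > real (card J) * ?N - real (k + 1) * t\<^sup>2 * ?N"
  proof -
    have "real (card J) * ?N \<le> real k * t\<^sup>2 * ?N" using assms N by (intro mult_right_mono) auto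
    moreover have "t\<^sup>2 * ?N > 0" using t N by auto
    moreover have "energy \<Omega> J f (meet r S) \<ge> 0" unfolding energy_def by (intro sum_nonneg) auto
    ultimately show ?thesis by (simp add: algebra_simps)
  qed
  ultimately show ?thesis using that assms(7) by blast
qed

definition bounded_system :: "nat \<Rightarrow> 'w set \<Rightarrow> 'j set \<Rightarrow> ('j \<Rightarrow> 'w \<Rightarrow> real) \<Rightarrow> ('b \<Rightarrow> 'w \<Rightarrow> 'w \<Rightarrow> bool) \<Rightarrow> bool" where
  "bounded_system K \<Omega> J f r \<longleftrightarrow> finite \<Omega> \<and> \<Omega> \<noteq> {} \<and> finite J \<and> card J \<le> K \<and> (\<forall>s. equivp (r s)) \<and>
     (\<forall>j x. j \<in> J \<longrightarrow> x \<in> \<Omega> \<longrightarrow> 0 \<le> f j x \<and> f j x \<le> 1)"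

text \<open>The uniformity required of the second partition may depend arbitrarily on the complexity of the first one.\<close>
definition regularizable :: "(nat \<Rightarrow> real) \<Rightarrow> real \<Rightarrow> nat \<Rightarrow> 'w set \<Rightarrow> 'j set \<Rightarrow> ('j \<Rightarrow> 'w \<Rightarrow> real) \<Rightarrow> ('b \<Rightarrow> 'w \<Rightarrow> 'w \<Rightarrow> bool) \<Rightarrow> bool" where
  "regularizable t d M \<Omega> J f r \<longleftrightarrow>
     (\<exists>S S'. finite S' \<and> S \<subseteq> S' \<and> card S \<le> M \<and> uniform \<Omega> J f r S' (t (card S)) \<and>
       (\<Sum>j\<in>J. \<Sum>x\<in>\<Omega>. (cexp \<Omega> (meet r S') (f j) x - cexp \<Omega> (meet r S) (f j) x)\<^sup>2) \<le> d * real (card \<Omega>))"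

text \<open>Each round passes from \<open>S\<close> to a refinement that is uniform at the tolerance
  dictated by \<open>card S\<close>. If the energy gap between the two exceeds
  \<open>d * card \<Omega>\<close>, the refinement becomes the next \<open>S\<close>. The energy
  never exceeds \<open>K * card \<Omega>\<close>, so about \<open>K / d\<close> rounds
  suffice.\<close>

lemma strong_regularity:
  fixes t :: "nat \<Rightarrow> real" and d :: real and K :: nat
  assumes t: "\<And>m. t m > 0" and d: "d > 0"
  shows "\<exists>M. \<forall>(\<Omega> :: 'w set) (J :: 'j set) f (r :: 'b \<Rightarrow> 'w \<Rightarrow> 'w \<Rightarrow> bool).
     bounded_system K \<Omega> J f r \<longrightarrow> regularizable t d M \<Omega> J f r"
proof -
  define k where "k m = nat \<lceil>real K / (t m)\<^sup>2\<rceil>" for m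
  have k: "real (k m) * (t m)\<^sup>2 \<ge> real K" for m
  proof -
    have "real (k m) \<ge> real K / (t m)\<^sup>2" unfolding k_def by linarith
    then show ?thesis using t[of m] by (simp add: field_simps)
  qed
  let ?ok = "\<lambda>(\<Omega> :: 'w set) (J :: 'j set) f (r :: 'b \<Rightarrow> 'w \<Rightarrow> 'w \<Rightarrow> bool).
     finite \<Omega> \<and> \<Omega> \<noteq> {} \<and> finite J \<and> card J \<le> K \<and> (\<forall>s. equivp (r s)) \<and>
     (\<forall>j x. j \<in> J \<longrightarrow> x \<in> \<Omega> \<longrightarrow> 0 \<le> f j x \<and> f j x \<le> 1)"
  let ?concl = "\<lambda>(\<Omega> :: 'w set) (J :: 'j set) f (r :: 'b \<Rightarrow> 'w \<Rightarrow> 'w \<Rightarrow> bool) M.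
     \<exists>S S'. finite S' \<and> S \<subseteq> S' \<and> card S \<le> M \<and> uniform \<Omega> J f r S' (t (card S)) \<and>
       (\<Sum>j\<in>J. \<Sum>x\<in>\<Omega>. (cexp \<Omega> (meet r S') (f j) x - cexp \<Omega> (meet r S) (f j) x)\<^sup>2) \<le> d * real (card \<Omega>)"
  \<comment> \<open>\<open>M\<close> is quantified before the system, so it depends only on
    \<open>l\<close> and the starting size \<open>M0\<close>; the latter stays arbitrary because
    each round starts from a larger partition.\<close>
  have "\<exists>M. \<forall>\<Omega> J f r S. ?ok \<Omega> J f r \<longrightarrow> finite S \<longrightarrow> card S \<le> M0 \<longrightarrow>
      energy \<Omega> J f (meet r S) > real K * real (card \<Omega>) - real l * d * real (card \<Omega>) \<longrightarrow> ?concl \<Omega> J f r M" for l M0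
  proof (induction l arbitrary: M0)
    case 0
    have "\<not> energy \<Omega> J f (meet r S) > real K * real (card \<Omega>)" if "?ok \<Omega> J f r" for \<Omega> J f r and S :: "'b set"
    proof -
      have "energy \<Omega> J f (meet r S) \<le> real (card J) * real (card \<Omega>)"
        using that by (intro energy_le) auto
      also have "\<dots> \<le> real K * real (card \<Omega>)"
        using that by (intro mult_right_mono) auto
      finally show ?thesis by simp
    qed
    then show ?case by auto
  next
    case (Suc l)
    \<comment> \<open>The sum over all sizes up to \<open>M0\<close> dominates the increase for
      whichever \<open>card S\<close> occurs.\<close>
    define M1 where "M1 = M0 + (\<Sum>m\<le>M0. 3 * (k m + 1))"
    obtain M where M: "\<And>\<Omega> J f r S. ?ok \<Omega> J f r \<Longrightarrow> finite S \<Longrightarrow> card S \<le> M1 \<Longrightarrow>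
        energy \<Omega> J f (meet r S) > real K * real (card \<Omega>) - real l * d * real (card \<Omega>) \<Longrightarrow> ?concl \<Omega> J f r M"
      using Suc.IH[of M1] by blast
    have step: "?concl \<Omega> J f r (max M M0)"
      if ok: "?ok \<Omega> J f r" and S: "finite S" "card S \<le> M0"
      and e: "energy \<Omega> J f (meet r S) > real K * real (card \<Omega>) - real (Suc l) * d * real (card \<Omega>)" for \<Omega> J f r S
    proof -
      have eq: "\<And>s. equivp (r s)" using ok by blast
      have E: "equivp (meet r A)" for A using equivp_meet[of r] eq by blast
      have "real (k (card S)) * (t (card S))\<^sup>2 \<ge> real (card J)"
        using k[of "card S"] ok by (meson of_nat_mono order_trans)
      then obtain S' where S': "finite S'" "S \<subseteq> S'" "card S' \<le> card S + 3 * (k (card S) + 1)"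
          "uniform \<Omega> J f r S' (t (card S))"
        using uniform_refinement[of \<Omega> J r "t (card S)" f S "k (card S)"] ok S t by blast
      have "3 * (k (card S) + 1) \<le> (\<Sum>m\<le>M0. 3 * (k m + 1))"
        by (rule member_le_sum) (use S in auto)
      then have cS': "card S' \<le> M1" using S S' unfolding M1_def by linarith
      let ?gap = "(\<Sum>j\<in>J. \<Sum>x\<in>\<Omega>. (cexp \<Omega> (meet r S') (f j) x - cexp \<Omega> (meet r S) (f j) x)\<^sup>2)"
      have gap: "energy \<Omega> J f (meet r S') - energy \<Omega> J f (meet r S) = ?gap"
        by (rule energy_diff) (use ok E meet_mono[OF S'(2), of r] in auto)
      show ?thesis
      proof (cases "?gap \<le> d * real (card \<Omega>)")
        case True
        then show ?thesis using S S' by (intro exI[of _ S] exI[of _ S']) auto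
      next
        case False
        then have "energy \<Omega> J f (meet r S') > real K * real (card \<Omega>) - real l * d * real (card \<Omega>)"
          using e gap by (simp add: algebra_simps)
        then have "?concl \<Omega> J f r M" using M[OF ok S'(1) cS'] by blast
        then show ?thesis by (meson max.coboundedI1)
      qed
    qed
    show ?case
    proof (rule exI, intro allI impI)
      fix \<Omega> J f r S
      assume "?ok \<Omega> J f r" "finite S" "card S \<le> M0"
        "energy \<Omega> J f (meet r S) > real K * real (card \<Omega>) - real (Suc l) * d * real (card \<Omega>)"
      then show "?concl \<Omega> J f r (max M M0)" by (rule step)
    qed
  qed
  from this[of 0 "nat \<lceil>real K / d\<rceil> + 1"] obtain M where M: "\<And>\<Omega> J f r S. ?ok \<Omega> J f r \<Longrightarrow> finite S \<Longrightarrow> card S \<le> 0 \<Longrightarrow>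
        energy \<Omega> J f (meet r S) > real K * real (card \<Omega>) - real (nat \<lceil>real K / d\<rceil> + 1) * d * real (card \<Omega>) \<Longrightarrow> ?concl \<Omega> J f r M"
    by (elim exE) blast
  have fin: "?concl \<Omega> J f r M" if ok: "?ok \<Omega> J f r" for \<Omega> J f r
  proof (rule M[OF ok, of "{}"])
    have N: "real (card \<Omega>) > 0" using ok by (simp add: card_gt_0_iff)
    have "real (nat \<lceil>real K / d\<rceil> + 1) > real K / d" by linarith
    then have "real (nat \<lceil>real K / d\<rceil> + 1) * d > real K" using d by (simp add: field_simps)
    then have "real (nat \<lceil>real K / d\<rceil> + 1) * d * real (card \<Omega>) > real K * real (card \<Omega>)"
      using N by simp
    moreover have "energy \<Omega> J f (meet r {}) \<ge> 0" unfolding energy_def by (intro sum_nonneg) auto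
    ultimately show "energy \<Omega> J f (meet r {}) > real K * real (card \<Omega>) - real (nat \<lceil>real K / d\<rceil> + 1) * d * real (card \<Omega>)"
      by linarith
  qed auto
  show ?thesis
    unfolding bounded_system_def regularizable_def by (rule exI[of _ M], intro allI impI) (rule fin)
qed

section \<open>Regularity for pairs\<close>

text \<open>A linear functional on the cube of weights is largest at a vertex, here at the indicator
  of the positive coefficients.\<close>

lemma sum_weight_le:
  fixes c g :: "'x \<Rightarrow> real"
  assumes "finite X" "\<And>A. A \<subseteq> X \<Longrightarrow> (\<Sum>x\<in>A. c x) \<le> C"
    and g: "\<And>x. x \<in> X \<Longrightarrow> 0 \<le> g x \<and> g x \<le> 1"
  shows "(\<Sum>x\<in>X. c x * g x) \<le> C"
proof -
  have "(\<Sum>x\<in>X. c x * g x) \<le> (\<Sum>x\<in>X. if c x > 0 then c x else 0)"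
  proof (intro sum_mono)
    fix x assume "x \<in> X"
    then show "c x * g x \<le> (if c x > 0 then c x else 0)"
      using g[of x] by (auto simp: mult_left_le mult_nonpos_nonneg not_less)
  qed
  also have "\<dots> = (\<Sum>x | x \<in> X \<and> c x > 0. c x)" using assms(1) by (simp add: sum.inter_filter)
  also have "\<dots> \<le> C" by (rule assms(2)) auto
  finally show ?thesis .
qed

text \<open>Bilinearity allows extreme points to be taken one variable at a time, first in
  \<open>y\<close> for a fixed set of \<open>x\<close>, then in \<open>x\<close>.\<close>

lemma sum_weight2_le:
  fixes c :: "'x \<Rightarrow> 'y \<Rightarrow> real"
  assumes "finite X" "finite Y"
    and C: "\<And>A B. A \<subseteq> X \<Longrightarrow> B \<subseteq> Y \<Longrightarrow> (\<Sum>x\<in>A. \<Sum>y\<in>B. c x y) \<le> C"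
    and g: "\<And>x. x \<in> X \<Longrightarrow> 0 \<le> g x \<and> g x \<le> 1"
    and h: "\<And>y. y \<in> Y \<Longrightarrow> 0 \<le> h y \<and> h y \<le> 1"
  shows "(\<Sum>x\<in>X. \<Sum>y\<in>Y. c x y * g x * h y) \<le> C"
proof -
  have "(\<Sum>x\<in>A. \<Sum>y\<in>Y. c x y * h y) \<le> C" if "A \<subseteq> X" for A
  proof -
    have "(\<Sum>y\<in>Y. (\<Sum>x\<in>A. c x y) * h y) \<le> C"
    proof (rule sum_weight_le[OF assms(2) _ h])
      fix B assume "B \<subseteq> Y"
      then show "(\<Sum>y\<in>B. \<Sum>x\<in>A. c x y) \<le> C" using C[OF that, of B] by (subst sum.swap)
    qed
    then show ?thesis by (subst sum.swap) (simp add: sum_distrib_right)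
  qed
  then have "(\<Sum>x\<in>X. (\<Sum>y\<in>Y. c x y * h y) * g x) \<le> C"
    by (intro sum_weight_le[OF assms(1) _ g]) auto
  then show ?thesis by (simp add: sum_distrib_right mult.assoc mult.commute[of "h _"])
qed

lemma sum_weight2_abs_le:
  fixes c :: "'x \<Rightarrow> 'y \<Rightarrow> real"
  assumes "finite X" "finite Y"
    and C: "\<And>A B. A \<subseteq> X \<Longrightarrow> B \<subseteq> Y \<Longrightarrow> \<bar>\<Sum>x\<in>A. \<Sum>y\<in>B. c x y\<bar> \<le> C"
    and g: "\<And>x. x \<in> X \<Longrightarrow> 0 \<le> g x \<and> g x \<le> 1"
    and h: "\<And>y. y \<in> Y \<Longrightarrow> 0 \<le> h y \<and> h y \<le> 1"
  shows "\<bar>\<Sum>x\<in>X. \<Sum>y\<in>Y. c x y * g x * h y\<bar> \<le> C"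
proof -
  have "(\<Sum>x\<in>A. \<Sum>y\<in>B. c x y) \<le> C" "(\<Sum>x\<in>A. \<Sum>y\<in>B. - c x y) \<le> C" if "A \<subseteq> X" "B \<subseteq> Y" for A B
    using C[OF that] by (auto simp: sum_negf)
  then have "(\<Sum>x\<in>X. \<Sum>y\<in>Y. c x y * g x * h y) \<le> C" "(\<Sum>x\<in>X. \<Sum>y\<in>Y. - c x y * g x * h y) \<le> C"
    by (intro sum_weight2_le[OF assms(1,2) _ g h]; simp)+
  then show ?thesis by (simp add: sum_negf abs_le_iff)
qed

section \<open>Partitions generated by vertex sets, and regular pairs\<close>

definition same :: "'v set \<Rightarrow> 'v \<Rightarrow> 'v \<Rightarrow> bool" where
  "same s x y \<longleftrightarrow> (x \<in> s \<longleftrightarrow> y \<in> s)"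

lemma equivp_same: "equivp (same s)"
  by (intro equivpI reflpI sympI transpI) (auto simp: same_def)

lemma equivp_meet_same: "equivp (meet same S)"
  by (intro equivp_meet equivp_same)

lemma meet_same_iff: "meet same S x y \<longleftrightarrow> {s\<in>S. x \<in> s} = {s\<in>S. y \<in> s}"
  by (auto simp: meet_def same_def)

definition same_pair :: "'v set \<Rightarrow> 'v \<times> 'v \<Rightarrow> 'v \<times> 'v \<Rightarrow> bool" where
  "same_pair s p q \<longleftrightarrow> same s (fst p) (fst q) \<and> same s (snd p) (snd q)"

lemma equivp_same_pair: "equivp (same_pair s)"
  by (intro equivpI reflpI sympI transpI) (auto simp: same_pair_def same_def)

lemma meet_same_pair: "meet same_pair S p q \<longleftrightarrow> meet same S (fst p) (fst q) \<and> meet same S (snd p) (snd q)"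
  by (auto simp: meet_def same_pair_def)

text \<open>Cut-norm regularity: the deviation from density \<open>p\<close> is measured against the
  whole rectangle. Weights instead of subsets admit as tests all factors in [0, 1] that depend on
  one vertex.\<close>

definition regular :: "real \<Rightarrow> real \<Rightarrow> 'v set \<Rightarrow> 'v set \<Rightarrow> ('v \<Rightarrow> 'v \<Rightarrow> real) \<Rightarrow> bool" where
  "regular \<eta> p X Y w \<longleftrightarrow> (\<forall>g h. (\<forall>x\<in>X. 0 \<le> g x \<and> g x \<le> 1) \<longrightarrow> (\<forall>y\<in>Y. 0 \<le> h y \<and> h y \<le> 1) \<longrightarrow>
      \<bar>\<Sum>x\<in>X. \<Sum>y\<in>Y. (w x y - p) * g x * h y\<bar> \<le> \<eta> * real (card X) * real (card Y))"

text \<open>Stated for points, not for classes: it concerns the \<open>E\<close>-classes of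
  \<open>x\<close> and \<open>y\<close> and the \<open>S\<close>-cell that contains
  \<open>(x, y)\<close>. Exceptional cells are thus counted by the points of
  \<open>V \<times> V\<close> in them, and a pair that survives lies itself in a dense regular
  cell.\<close>

definition good_pair :: "'v set \<Rightarrow> ('v \<times> 'v) set set \<Rightarrow> ('v \<Rightarrow> 'v \<Rightarrow> bool) \<Rightarrow> real \<Rightarrow> real \<Rightarrow> real \<Rightarrow> 'v \<Rightarrow> 'v \<Rightarrow> bool" where
  "good_pair V S E \<mu> \<eta> p0 x y \<longleftrightarrow>
     \<mu> * real (card V) \<le> real (card {x'\<in>V. E x x'}) \<and> \<mu> * real (card V) \<le> real (card {y'\<in>V. E y y'}) \<and>
     (\<exists>p. p0 \<le> p \<and> p \<le> 1 \<and>
       regular \<eta> p {x'\<in>V. E x x'} {y'\<in>V. E y y'} (\<lambda>x' y'. of_bool (meet same S (x, y) (x', y'))))"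

text \<open>The trace of \<open>A\<close> at a vertex determines its class, so there are at most
  \<open>2 ^ card A\<close> classes, and each small one contributes at most \<open>c\<close>
  vertices.\<close>

lemma card_small_classes:
  assumes "finite V" "finite A" "0 \<le> c"
  shows "real (card {x\<in>V. real (card {x'\<in>V. meet same A x x'}) < c}) \<le> 2 ^ card A * c"
proof -
  define sig where "sig x = {s\<in>A. x \<in> s}" for x
  define B where "B = {x\<in>V. real (card {x'\<in>V. meet same A x x'}) < c}"
  define P where "P I = {x\<in>B. sig x = I}" for I
  have iff: "meet same A x x' \<longleftrightarrow> sig x = sig x'" for x x' by (simp add: meet_same_iff sig_def)
  have fB: "finite B" using assms by (simp add: B_def)
  have sub: "B \<subseteq> (\<Union>I\<in>Pow A. P I)"
  proof
    fix x assume "x \<in> B"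
    then show "x \<in> (\<Union>I\<in>Pow A. P I)" by (intro UN_I[of "sig x"]) (auto simp: sig_def P_def)
  qed
  have "card B \<le> card (\<Union>I\<in>Pow A. P I)"
    using sub assms fB by (intro card_mono) (auto simp: P_def)
  also have "\<dots> \<le> (\<Sum>I\<in>Pow A. card (P I))"
    using assms by (intro card_UN_le) simp
  finally have "real (card B) \<le> (\<Sum>I\<in>Pow A. real (card (P I)))"
    by (metis of_nat_le_iff of_nat_sum)
  also have "\<dots> \<le> (\<Sum>I\<in>Pow A. c)"
  proof (intro sum_mono)
    fix I
    show "real (card (P I)) \<le> c"
    proof (cases "P I = {}")
      case True
      then show ?thesis using assms by simp
    next
      case False
      then obtain x where x: "x \<in> B" "sig x = I" by (auto simp: P_def)
      have "card (P I) \<le> card {x'\<in>V. meet same A x x'}"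
        unfolding iff using assms x(2) by (intro card_mono) (auto simp: P_def B_def)
      then show ?thesis using x(1) by (simp add: B_def)
    qed
  qed
  also have "\<dots> = 2 ^ card A * c" using assms by (simp add: card_Pow)
  finally show ?thesis by (simp add: B_def)
qed

lemma sum_abs_le_sqrt:
  fixes g :: "'w \<Rightarrow> real"
  assumes "(\<Sum>x\<in>\<Omega>. (g x)\<^sup>2) \<le> q\<^sup>2 * real (card \<Omega>)" "0 \<le> q"
  shows "(\<Sum>x\<in>\<Omega>. \<bar>g x\<bar>) \<le> q * real (card \<Omega>)"
proof (rule power2_le_imp_le)
  have "(\<Sum>x\<in>\<Omega>. \<bar>g x\<bar>)\<^sup>2 \<le> real (card \<Omega>) * (\<Sum>x\<in>\<Omega>. \<bar>g x\<bar>\<^sup>2)" by (rule sum_squared_le)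
  also have "\<dots> \<le> real (card \<Omega>) * (q\<^sup>2 * real (card \<Omega>))"
    using assms by (intro mult_left_mono) auto
  finally show "(\<Sum>x\<in>\<Omega>. \<bar>g x\<bar>)\<^sup>2 \<le> (q * real (card \<Omega>))\<^sup>2"
    by (simp add: power2_eq_square ac_simps)
qed (use assms in auto)

text \<open>The deviation splits into \<open>f\<close> minus its fine average and the fine minus the
  coarse average, the latter being constant on \<open>X \<times> Y\<close>. The first part has small
  cut norm by uniformity, with \<open>t\<close> calibrated to the size of the rectangle; the second
  is small in L1 on this very rectangle by hypothesis \<open>e\<close>. Each part uses half of
  \<eta>.\<close>

lemma regular_if_uniform:
  fixes V :: "'v set" and f :: "'v \<times> 'v \<Rightarrow> real"
  assumes V: "finite V" and S: "A \<subseteq> A'"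
    and uni: "uniform (V \<times> V) J F same_pair A' t" and f: "j \<in> J" "f = F j"
    and xy: "x \<in> V" "y \<in> V"
    and X: "X = {x'\<in>V. meet same A x x'}" and Y: "Y = {y'\<in>V. meet same A y y'}"
    and t: "t * real (card (V \<times> V)) \<le> \<eta> / 2 * real (card X) * real (card Y)"
    and e: "cexp (V \<times> V) (meet same_pair A)
        (\<lambda>q. \<bar>cexp (V \<times> V) (meet same_pair A') f q - cexp (V \<times> V) (meet same_pair A) f q\<bar>) (x, y) \<le> \<eta> / 2"
    and w: "\<And>x' y'. x' \<in> X \<Longrightarrow> y' \<in> Y \<Longrightarrow> w x' y' = f (x', y')"
  shows "regular \<eta> (cexp (V \<times> V) (meet same_pair A) f (x, y)) X Y w"
  unfolding regular_def
proof (intro allI impI)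
  fix g h :: "'v \<Rightarrow> real"
  assume "\<forall>x\<in>X. 0 \<le> g x \<and> g x \<le> 1" and "\<forall>y\<in>Y. 0 \<le> h y \<and> h y \<le> 1"
  then have g: "\<And>x. x \<in> X \<Longrightarrow> 0 \<le> g x \<and> g x \<le> 1" and h: "\<And>y. y \<in> Y \<Longrightarrow> 0 \<le> h y \<and> h y \<le> 1" by auto
  let ?\<Omega> = "V \<times> V"
  let ?s = "cexp ?\<Omega> (meet same_pair A) f" and ?s' = "cexp ?\<Omega> (meet same_pair A') f"
  let ?u = "\<lambda>x y. f (x, y) - ?s' (x, y)" and ?e = "\<lambda>x y. ?s' (x, y) - ?s (x, y)"
  have eqv: "equivp (meet same_pair A)" by (intro equivp_meet equivp_same_pair)
  have fin: "finite X" "finite Y" using V X Y by auto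
  have XY: "{q \<in> ?\<Omega>. meet same_pair A (x, y) q} = X \<times> Y"
    using X Y by (auto simp: meet_same_pair)
  have s: "?s (x', y') = ?s (x, y)" if "x' \<in> X" "y' \<in> Y" for x' y'
    using that XY by (intro cexp_cong[OF eqv, symmetric]) auto
  have cpos: "real (card (X \<times> Y)) > 0"
  proof -
    have "(x, y) \<in> X \<times> Y" using X Y xy equivp_meet_same equivp_reflp by fastforce
    then show ?thesis using fin by (metis card_gt_0_iff empty_iff finite_cartesian_product of_nat_0_less_iff)
  qed
  have "(\<Sum>x'\<in>X. \<Sum>y'\<in>Y. \<bar>?e x' y'\<bar>) = (\<Sum>q\<in>X \<times> Y. \<bar>?s' q - ?s q\<bar>)"
    by (simp add: sum.cartesian_product case_prod_unfold)
  also have "\<dots> \<le> \<eta> / 2 * real (card (X \<times> Y))"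
    using e cpos unfolding cexp_def[of _ _ "\<lambda>q. \<bar>?s' q - ?s q\<bar>"] XY by (simp add: field_simps)
  finally have E: "(\<Sum>x'\<in>X. \<Sum>y'\<in>Y. \<bar>?e x' y'\<bar>) \<le> \<eta> / 2 * real (card X) * real (card Y)"
    by (simp add: card_cartesian_product)
  have "\<bar>\<Sum>x'\<in>X. \<Sum>y'\<in>Y. ?e x' y' * g x' * h y'\<bar> \<le> (\<Sum>x'\<in>X. \<Sum>y'\<in>Y. \<bar>?e x' y'\<bar>)"
  proof (intro order_trans[OF sum_abs] sum_mono order_trans[OF sum_abs])
    fix x' y' assume "x' \<in> X" "y' \<in> Y"
    then have "\<bar>g x' * h y'\<bar> \<le> 1" using g[of x'] h[of y'] by (simp add: abs_mult mult_le_one)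
    then show "\<bar>?e x' y' * g x' * h y'\<bar> \<le> \<bar>?e x' y'\<bar>"
      by (simp add: abs_mult mult.assoc mult_left_le)
  qed
  moreover have "\<bar>\<Sum>x'\<in>X. \<Sum>y'\<in>Y. ?u x' y' * g x' * h y'\<bar> \<le> t * real (card ?\<Omega>)"
  proof (rule sum_weight2_abs_le[OF fin _ g h])
    fix P Q assume PQ: "P \<subseteq> X" "Q \<subseteq> Y"
    \<comment> \<open>A subrectangle is a union of cells of the partition generated by its two
      sides.\<close>
    have "\<bar>\<Sum>q\<in>P \<times> Q. F j q - cexp ?\<Omega> (meet same_pair A') (F j) q\<bar> \<le> t * real (card ?\<Omega>)"
    proof (rule uni[unfolded uniform_def, rule_format, OF f(1), of "{P, Q}"])
      show "card {P, Q} \<le> 3" by (simp add: card_insert_if)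
      show "P \<times> Q \<subseteq> ?\<Omega>" using PQ X Y by auto
    qed (auto simp: meet_def same_pair_def same_def)
    then show "\<bar>\<Sum>x\<in>P. \<Sum>y\<in>Q. ?u x y\<bar> \<le> t * real (card ?\<Omega>)"
      by (simp add: f sum.cartesian_product case_prod_unfold)
  qed
  moreover have "(\<Sum>x'\<in>X. \<Sum>y'\<in>Y. (w x' y' - ?s (x, y)) * g x' * h y')
      = (\<Sum>x'\<in>X. \<Sum>y'\<in>Y. ?u x' y' * g x' * h y') + (\<Sum>x'\<in>X. \<Sum>y'\<in>Y. ?e x' y' * g x' * h y')"
    unfolding sum.distrib[symmetric] by (intro sum.cong refl) (simp add: w s algebra_simps)
  ultimately show "\<bar>\<Sum>x'\<in>X. \<Sum>y'\<in>Y. (w x' y' - ?s (x, y)) * g x' * h y'\<bar> \<le> \<eta> * real (card X) * real (card Y)"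
    using E t by linarith
qed

text \<open>The indicators of the cells of \<open>S\<close>, at most \<open>2 ^ m\<close> of them,
  are the functions to be regularised. The coarse partition supplies \<open>E\<close> while the fine
  one only certifies regularity, so \<mu> depends on the bound for the coarse one alone.\<close>

lemma pair_regularity:
  fixes m :: nat and \<epsilon> \<eta> :: real
  assumes \<epsilon>: "\<epsilon> > 0" and \<eta>: "\<eta> > 0"
  shows "\<exists>\<mu>>0. \<forall>(V :: 'v set) S. finite V \<longrightarrow> V \<noteq> {} \<longrightarrow> finite S \<longrightarrow> card S \<le> m \<longrightarrow>
     (\<exists>E. equivp E \<and> real (card {q \<in> V \<times> V. \<not> good_pair V S E \<mu> \<eta> (\<epsilon> / (4 * 2 ^ m)) (fst q) (snd q)})
        \<le> \<epsilon> * (real (card V))\<^sup>2)"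
proof -
  \<comment> \<open>Budget: small classes cost \<epsilon> / 8 in each coordinate; sparse and
    irregular cells cost \<epsilon> / 4 each when summed over \<open>2 ^ m\<close> cells. The
    mean-square tolerance is \<open>q\<^sup>2\<close>, which Cauchy-Schwarz and Markov at level
    \<eta> / 2 turn into a fraction \<open>2 * q / \<eta>\<close> of bad pairs per cell.\<close>
  define q where "q = \<epsilon> * \<eta> / (8 * 2 ^ m)"
  define \<nu> where "\<nu> l = \<epsilon> / (8 * 2 ^ l)" for l :: nat
  \<comment> \<open>Matches the smallest rectangle that survives: two classes of relative size at
    least \<open>\<nu> l\<close> when the partition comes from \<open>l\<close> sets.\<close>
  define t where "t l = \<eta> / 2 * (\<nu> l)\<^sup>2" for l
  define p0 where "p0 = \<epsilon> / (4 * 2 ^ m)"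
  have q: "q > 0" using \<epsilon> \<eta> by (simp add: q_def)
  have \<nu>: "\<nu> l > 0" for l using \<epsilon> by (simp add: \<nu>_def)
  have t: "t l > 0" for l using \<eta> \<nu>[of l] by (simp add: t_def)
  have p0: "p0 > 0" using \<epsilon> by (simp add: p0_def)
  obtain M where M: "\<And>(\<Omega> :: ('v \<times> 'v) set) (J :: ('v \<times> 'v) set set set) f (r :: 'v set \<Rightarrow> _).
     bounded_system (2 ^ m) \<Omega> J f r \<Longrightarrow> regularizable t (q\<^sup>2) M \<Omega> J f r"
    using strong_regularity[of t "q\<^sup>2" "2 ^ m", OF t zero_less_power[OF q]] by blast
  show ?thesis
  proof (intro exI[of _ "\<nu> M"] conjI allI impI)
    fix V :: "'v set" and S :: "('v \<times> 'v) set set"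
    assume V: "finite V" "V \<noteq> {}" and S: "finite S" "card S \<le> m"
    let ?\<Omega> = "V \<times> V" and ?J = "Pow S" and ?n = "real (card V)"
    define D where "D I = {\<omega>\<in>?\<Omega>. {s\<in>S. \<omega> \<in> s} = I}" for I
    define f where "f I = (indicator (D I) :: _ \<Rightarrow> real)" for I
    have fin: "finite ?\<Omega>" "?\<Omega> \<noteq> {}" "finite ?J" using V S by auto
    have J: "card ?J \<le> 2 ^ m" using S by (simp add: card_Pow power_increasing)
    have c\<Omega>: "real (card ?\<Omega>) = ?n\<^sup>2" by (simp add: card_cartesian_product power2_eq_square)
    have "bounded_system (2 ^ m) ?\<Omega> ?J f same_pair"
      unfolding bounded_system_def using fin J equivp_same_pair by (auto simp: f_def indicator_def)
    from M[OF this] obtain A A' where A: "finite A'" "A \<subseteq> A'" "card A \<le> M" "uniform ?\<Omega> ?J f same_pair A' (t (card A))"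
      and gap: "(\<Sum>j\<in>?J. \<Sum>x\<in>?\<Omega>. (cexp ?\<Omega> (meet same_pair A') (f j) x - cexp ?\<Omega> (meet same_pair A) (f j) x)\<^sup>2)
         \<le> q\<^sup>2 * real (card ?\<Omega>)"
      unfolding regularizable_def by blast
    have fA: "finite A" using A finite_subset by blast
    have eqv: "equivp (meet same_pair B)" for B :: "'v set set" by (intro equivp_meet equivp_same_pair)
    define s where "s I = cexp ?\<Omega> (meet same_pair A) (f I)" for I
    define e where "e I x = \<bar>cexp ?\<Omega> (meet same_pair A') (f I) x - s I x\<bar>" for I x
    define cl where "cl x = {x'\<in>V. meet same A x x'}" for x
    define B1 where "B1 = {x\<in>V. real (card (cl x)) < \<nu> (card A) * ?n}"
    define B2 where "B2 I = {\<omega>\<in>D I. s I \<omega> < p0}" for I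
    define B3 where "B3 I = {\<omega>\<in>?\<Omega>. cexp ?\<Omega> (meet same_pair A) (e I) \<omega> > \<eta> / 2}" for I
    have b1: "real (card B1) \<le> \<epsilon> / 8 * ?n"
    proof -
      have "real (card B1) \<le> 2 ^ card A * (\<nu> (card A) * ?n)"
        unfolding B1_def cl_def using \<nu>[of "card A"] by (intro card_small_classes V fA) auto
      then show ?thesis by (simp add: \<nu>_def)
    qed
    have b2: "real (card (B2 I)) \<le> p0 * ?n\<^sup>2" for I
      unfolding B2_def s_def f_def c\<Omega>[symmetric]
      by (rule cexp_small) (use fin eqv p0 in \<open>auto simp: D_def\<close>)
    have b3: "real (card (B3 I)) \<le> 2 * q / \<eta> * ?n\<^sup>2" if "I \<in> ?J" for I
    proof -
      have "(\<Sum>x\<in>?\<Omega>. (cexp ?\<Omega> (meet same_pair A') (f I) x - s I x)\<^sup>2)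
         \<le> (\<Sum>j\<in>?J. \<Sum>x\<in>?\<Omega>. (cexp ?\<Omega> (meet same_pair A') (f j) x - s j x)\<^sup>2)"
        by (rule member_le_sum) (use that fin in \<open>auto intro: sum_nonneg\<close>)
      then have "(\<Sum>x\<in>?\<Omega>. e I x) \<le> q * real (card ?\<Omega>)"
        unfolding e_def using gap q by (intro sum_abs_le_sqrt) (auto simp: s_def)
      moreover have "\<eta> / 2 * real (card (B3 I)) \<le> (\<Sum>x\<in>?\<Omega>. e I x)"
        unfolding B3_def by (rule cexp_markov[OF fin(1) eqv]) (simp add: e_def)
      ultimately have "\<eta> / 2 * real (card (B3 I)) \<le> q * ?n\<^sup>2" using c\<Omega> by simp
      then show ?thesis using \<eta> by (simp add: field_simps)
    qed
    have finB: "finite (B2 I)" "finite (B3 I)" "finite B1" for I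
      using fin V by (auto simp: B1_def B2_def B3_def D_def)
    have good: "good_pair V S (meet same A) (\<nu> M) \<eta> p0 x y"
      if xy: "x \<in> V" "y \<in> V" and nb: "x \<notin> B1" "y \<notin> B1" "\<And>I. I \<in> ?J \<Longrightarrow> (x, y) \<notin> B2 I \<union> B3 I" for x y
    proof -
      define I where "I = {s\<in>S. (x, y) \<in> s}"
      have I: "I \<in> ?J" by (auto simp: I_def)
      have xyD: "(x, y) \<in> D I" using xy by (auto simp: D_def I_def)
      have cx: "real (card (cl x)) \<ge> \<nu> (card A) * ?n" and cy: "real (card (cl y)) \<ge> \<nu> (card A) * ?n"
        using nb xy by (auto simp: B1_def)
      have "\<nu> M \<le> \<nu> (card A)"
        using \<epsilon> A(3) unfolding \<nu>_def by (intro divide_left_mono mult_left_mono power_increasing) auto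
      then have "\<nu> M * ?n \<le> \<nu> (card A) * ?n" by (intro mult_right_mono) auto
      then have size: "\<nu> M * ?n \<le> real (card (cl x))" "\<nu> M * ?n \<le> real (card (cl y))"
        using cx cy by auto
      have "regular \<eta> (cexp ?\<Omega> (meet same_pair A) (f I) (x, y)) (cl x) (cl y)
           (\<lambda>x' y'. of_bool (meet same S (x, y) (x', y')))"
      proof (rule regular_if_uniform[OF V(1) A(2,4) I refl xy])
        have "(\<nu> (card A) * ?n) * (\<nu> (card A) * ?n) \<le> real (card (cl x)) * real (card (cl y))"
          by (rule mult_mono) (use cx cy \<nu>[of "card A"] in auto)
        then have "\<eta> / 2 * ((\<nu> (card A) * ?n) * (\<nu> (card A) * ?n)) \<le> \<eta> / 2 * (real (card (cl x)) * real (card (cl y)))"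
          using \<eta> by (intro mult_left_mono) auto
        then show "t (card A) * real (card ?\<Omega>) \<le> \<eta> / 2 * real (card (cl x)) * real (card (cl y))"
          unfolding c\<Omega> t_def by (simp add: power2_eq_square ac_simps)
        show "cexp ?\<Omega> (meet same_pair A) (\<lambda>q. \<bar>cexp ?\<Omega> (meet same_pair A') (f I) q - cexp ?\<Omega> (meet same_pair A) (f I) q\<bar>) (x, y) \<le> \<eta> / 2"
          using nb(3)[OF I] xy by (auto simp: B3_def e_def[abs_def] s_def)
        show "of_bool (meet same S (x, y) (x', y')) = f I (x', y')" if "x' \<in> cl x" "y' \<in> cl y" for x' y'
          using that by (auto simp: f_def D_def I_def meet_same_iff cl_def indicator_def)
      qed (auto simp: cl_def)
      moreover have "p0 \<le> s I (x, y)" using nb(3)[OF I] xyD by (auto simp: B2_def)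
      moreover have "s I (x, y) \<le> 1" unfolding s_def by (intro cexp_le_1) (auto simp: f_def indicator_def)
      ultimately show ?thesis unfolding good_pair_def using size by (auto simp: s_def cl_def)
    qed
    let ?bad = "{q \<in> ?\<Omega>. \<not> good_pair V S (meet same A) (\<nu> M) \<eta> p0 (fst q) (snd q)}"
    let ?U2 = "\<Union>I\<in>?J. B2 I" and ?U3 = "\<Union>I\<in>?J. B3 I"
    have "?bad \<subseteq> (B1 \<times> V \<union> V \<times> B1) \<union> (?U2 \<union> ?U3)"
      using good by fastforce
    then have "card ?bad \<le> card ((B1 \<times> V \<union> V \<times> B1) \<union> (?U2 \<union> ?U3))"
      using V fin finB by (intro card_mono) auto
    also have "\<dots> \<le> (card (B1 \<times> V) + card (V \<times> B1)) + (card ?U2 + card ?U3)"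
      by (meson add_mono card_Un_le order_trans)
    also have "\<dots> \<le> (card (B1 \<times> V) + card (V \<times> B1)) + ((\<Sum>I\<in>?J. card (B2 I)) + (\<Sum>I\<in>?J. card (B3 I)))"
      by (intro add_mono card_UN_le order_refl fin)
    finally have "real (card ?bad) \<le> 2 * (real (card B1) * ?n) + ((\<Sum>I\<in>?J. real (card (B2 I))) + (\<Sum>I\<in>?J. real (card (B3 I))))"
      by (simp add: card_cartesian_product of_nat_le_iff[symmetric, where 'a=real] del: of_nat_le_iff)
    also have "\<dots> \<le> 2 * (\<epsilon> / 8 * ?n * ?n) + ((\<Sum>I\<in>?J. p0 * ?n\<^sup>2) + (\<Sum>I\<in>?J. 2 * q / \<eta> * ?n\<^sup>2))"
      by (intro add_mono mult_left_mono mult_right_mono sum_mono b1 b2 b3) auto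
    also have "\<dots> \<le> \<epsilon> / 4 * ?n\<^sup>2 + (2 ^ m * (p0 * ?n\<^sup>2) + 2 ^ m * (2 * q / \<eta> * ?n\<^sup>2))"
    proof -
      have "real (card ?J) \<le> 2 ^ m" using J by (metis of_nat_le_iff of_nat_numeral of_nat_power)
      moreover have "0 \<le> p0 * ?n\<^sup>2" "0 \<le> 2 * q / \<eta> * ?n\<^sup>2" using p0 q \<eta> by auto
      ultimately show ?thesis unfolding sum_constant
        by (intro add_mono mult_right_mono) (auto simp: power2_eq_square)
    qed
    also have "\<dots> = (3 * \<epsilon> / 4) * ?n\<^sup>2"
      using \<eta> by (simp add: p0_def q_def field_simps)
    also have "\<dots> \<le> \<epsilon> * ?n\<^sup>2" using \<epsilon> by (intro mult_right_mono) auto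
    finally show "\<exists>E. equivp E \<and> real (card {q \<in> ?\<Omega>. \<not> good_pair V S E (\<nu> M) \<eta> (\<epsilon> / (4 * 2 ^ m)) (fst q) (snd q)}) \<le> \<epsilon> * ?n\<^sup>2"
      unfolding p0_def using equivp_meet_same by blast
  qed (rule \<nu>)
qed

section \<open>Counting in quasirandom pairs\<close>

definition quasirandom :: "real \<Rightarrow> real \<Rightarrow> 'v set \<Rightarrow> 'v set \<Rightarrow> ('v \<Rightarrow> 'v \<Rightarrow> real) \<Rightarrow> bool" where
  "quasirandom \<eta> p X Y w \<longleftrightarrow> finite X \<and> finite Y \<and> 0 \<le> p \<and> p \<le> 1 \<and>
     (\<forall>x\<in>X. \<forall>y\<in>Y. 0 \<le> w x y \<and> w x y \<le> 1) \<and> regular \<eta> p X Y w"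

lemma quasirandomD:
  assumes "quasirandom \<eta> p X Y w"
  shows "finite X" "finite Y" "0 \<le> p" "p \<le> 1" "x \<in> X \<Longrightarrow> y \<in> Y \<Longrightarrow> 0 \<le> w x y" "x \<in> X \<Longrightarrow> y \<in> Y \<Longrightarrow> w x y \<le> 1"
  using assms by (auto simp: quasirandom_def)

lemma quasirandom_bilinear:
  assumes "quasirandom \<eta> p X Y w" "\<And>x. x \<in> X \<Longrightarrow> 0 \<le> g x \<and> g x \<le> 1" "\<And>y. y \<in> Y \<Longrightarrow> 0 \<le> h y \<and> h y \<le> 1"
  shows "\<bar>\<Sum>x\<in>X. \<Sum>y\<in>Y. (w x y - p) * g x * h y\<bar> \<le> \<eta> * real (card X) * real (card Y)"
  using assms unfolding quasirandom_def regular_def by blast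

lemma quasirandom_flip:
  assumes "quasirandom \<eta> p X Y w"
  shows "quasirandom \<eta> p Y X (\<lambda>y x. w x y)"
proof -
  have "regular \<eta> p Y X (\<lambda>y x. w x y)"
    unfolding regular_def
  proof (intro allI impI)
    fix g h :: "'a \<Rightarrow> real"
    assume "\<forall>x\<in>Y. 0 \<le> g x \<and> g x \<le> 1" "\<forall>y\<in>X. 0 \<le> h y \<and> h y \<le> 1"
    then have "\<bar>\<Sum>x\<in>X. \<Sum>y\<in>Y. (w x y - p) * h x * g y\<bar> \<le> \<eta> * real (card X) * real (card Y)"
      by (intro quasirandom_bilinear[OF assms]) auto
    moreover have "(\<Sum>x\<in>X. \<Sum>y\<in>Y. (w x y - p) * h x * g y) = (\<Sum>y\<in>Y. \<Sum>x\<in>X. (w x y - p) * g y * h x)"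
      by (subst sum.swap) (simp add: ac_simps)
    ultimately show "\<bar>\<Sum>y\<in>Y. \<Sum>x\<in>X. (w x y - p) * g y * h x\<bar> \<le> \<eta> * real (card Y) * real (card X)"
      by (simp add: ac_simps)
  qed
  then show ?thesis using assms by (auto simp: quasirandom_def)
qed

text \<open>Testing separately on the vertices with nonnegative and with negative deviation costs
  the factor 2.\<close>

lemma quasirandom_L1:
  assumes q: "quasirandom \<eta> p X Y w" and h: "\<And>y. y \<in> Y \<Longrightarrow> 0 \<le> h y \<and> h y \<le> 1"
  shows "(\<Sum>x\<in>X. \<bar>\<Sum>y\<in>Y. (w x y - p) * h y\<bar>) \<le> 2 * \<eta> * real (card X) * real (card Y)"
proof -
  define D where "D x = (\<Sum>y\<in>Y. (w x y - p) * h y)" for x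
  have *: "\<bar>\<Sum>x\<in>X. D x * g x\<bar> \<le> \<eta> * real (card X) * real (card Y)"
    if "\<And>x. x \<in> X \<Longrightarrow> 0 \<le> g x \<and> g x \<le> 1" for g
  proof -
    have "(\<Sum>x\<in>X. D x * g x) = (\<Sum>x\<in>X. \<Sum>y\<in>Y. (w x y - p) * g x * h y)"
      by (simp add: D_def sum_distrib_left sum_distrib_right ac_simps)
    then show ?thesis using quasirandom_bilinear[OF q, of g h] that h by simp
  qed
  have "(\<Sum>x\<in>X. \<bar>D x\<bar>) = (\<Sum>x\<in>X. D x * of_bool (D x \<ge> 0)) - (\<Sum>x\<in>X. D x * of_bool (D x < 0))"
    unfolding sum_subtractf[symmetric] by (intro sum.cong) auto
  also have "\<dots> \<le> 2 * (\<eta> * real (card X) * real (card Y))"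
    using *[of "\<lambda>x. of_bool (D x \<ge> 0)"] *[of "\<lambda>x. of_bool (D x < 0)"] by (simp add: abs_le_iff)
  finally show ?thesis by (simp add: D_def)
qed

text \<open>The factors are replaced by their densities one after the other. While \<open>w1\<close>
  is replaced, \<open>w2 x2\<close> is a legitimate weight on \<open>Z\<close> for each fixed
  \<open>x2\<close>, so every replacement costs one L1 bound.\<close>

lemma codegree2:
  assumes q1: "quasirandom \<eta> p1 X1 Z w1" and q2: "quasirandom \<eta> p2 X2 Z w2"
  shows "(\<Sum>x1\<in>X1. \<Sum>x2\<in>X2. \<bar>(\<Sum>z\<in>Z. w1 x1 z * w2 x2 z) - p1 * p2 * real (card Z)\<bar>)
     \<le> 4 * \<eta> * real (card X1) * real (card X2) * real (card Z)"
proof -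
  note b = quasirandomD[OF q1] quasirandomD[OF q2]
  have "(\<Sum>x1\<in>X1. \<Sum>x2\<in>X2. \<bar>(\<Sum>z\<in>Z. w1 x1 z * w2 x2 z) - p1 * p2 * real (card Z)\<bar>)
    \<le> (\<Sum>x1\<in>X1. \<Sum>x2\<in>X2. \<bar>\<Sum>z\<in>Z. (w1 x1 z - p1) * w2 x2 z\<bar> + \<bar>\<Sum>z\<in>Z. (w2 x2 z - p2) * 1\<bar>)"
  proof (intro sum_mono)
    fix x1 x2 assume "x1 \<in> X1" "x2 \<in> X2"
    have "(\<Sum>z\<in>Z. w1 x1 z * w2 x2 z) - p1 * p2 * real (card Z)
       = (\<Sum>z\<in>Z. (w1 x1 z - p1) * w2 x2 z) + p1 * (\<Sum>z\<in>Z. (w2 x2 z - p2) * 1)"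
      by (simp add: sum_distrib_left sum.distrib sum_subtractf algebra_simps)
    moreover have "\<bar>p1 * (\<Sum>z\<in>Z. (w2 x2 z - p2) * 1)\<bar> \<le> \<bar>\<Sum>z\<in>Z. (w2 x2 z - p2) * 1\<bar>"
      using b by (simp add: abs_mult mult_left_le_one_le)
    ultimately show "\<bar>(\<Sum>z\<in>Z. w1 x1 z * w2 x2 z) - p1 * p2 * real (card Z)\<bar>
      \<le> \<bar>\<Sum>z\<in>Z. (w1 x1 z - p1) * w2 x2 z\<bar> + \<bar>\<Sum>z\<in>Z. (w2 x2 z - p2) * 1\<bar>" by linarith
  qed
  also have "\<dots> = (\<Sum>x2\<in>X2. \<Sum>x1\<in>X1. \<bar>\<Sum>z\<in>Z. (w1 x1 z - p1) * w2 x2 z\<bar>)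
       + (\<Sum>x1\<in>X1. \<Sum>x2\<in>X2. \<bar>\<Sum>z\<in>Z. (w2 x2 z - p2) * 1\<bar>)"
    by (simp add: sum.distrib sum.swap[of _ X1 X2])
  also have "\<dots> \<le> (\<Sum>x2\<in>X2. 2 * \<eta> * real (card X1) * real (card Z)) + (\<Sum>x1\<in>X1. 2 * \<eta> * real (card X2) * real (card Z))"
    by (intro add_mono sum_mono quasirandom_L1 q1 q2) (use b in auto)
  also have "\<dots> = 4 * \<eta> * real (card X1) * real (card X2) * real (card Z)" by simp
  finally show ?thesis .
qed

text \<open>In each of the three replacements the factors not yet replaced form a single weight on
  \<open>Z\<close>, so three L1 bounds add up to 6 \<eta>.\<close>

lemma codegree3:
  assumes q1: "quasirandom \<eta> p1 X1 Z w1" and q2: "quasirandom \<eta> p2 X2 Z w2" and q3: "quasirandom \<eta> p3 X3 Z w3"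
  shows "(\<Sum>x1\<in>X1. \<Sum>x2\<in>X2. \<Sum>x3\<in>X3. \<bar>(\<Sum>z\<in>Z. w1 x1 z * w2 x2 z * w3 x3 z) - p1 * p2 * p3 * real (card Z)\<bar>)
     \<le> 6 * \<eta> * real (card X1) * real (card X2) * real (card X3) * real (card Z)"
proof -
  note b = quasirandomD[OF q1] quasirandomD[OF q2] quasirandomD[OF q3]
  let ?a = "\<lambda>x1 x2 x3. \<bar>\<Sum>z\<in>Z. (w1 x1 z - p1) * (w2 x2 z * w3 x3 z)\<bar>"
  let ?b = "\<lambda>x2 x3. \<bar>\<Sum>z\<in>Z. (w2 x2 z - p2) * w3 x3 z\<bar>"
  let ?c = "\<lambda>x3. \<bar>\<Sum>z\<in>Z. (w3 x3 z - p3) * 1\<bar>"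
  have "(\<Sum>x1\<in>X1. \<Sum>x2\<in>X2. \<Sum>x3\<in>X3. \<bar>(\<Sum>z\<in>Z. w1 x1 z * w2 x2 z * w3 x3 z) - p1 * p2 * p3 * real (card Z)\<bar>)
    \<le> (\<Sum>x1\<in>X1. \<Sum>x2\<in>X2. \<Sum>x3\<in>X3. ?a x1 x2 x3 + ?b x2 x3 + ?c x3)"
  proof (intro sum_mono)
    fix x1 x2 x3 assume "x1 \<in> X1" "x2 \<in> X2" "x3 \<in> X3"
    have "(\<Sum>z\<in>Z. w1 x1 z * w2 x2 z * w3 x3 z) - p1 * p2 * p3 * real (card Z)
       = (\<Sum>z\<in>Z. (w1 x1 z - p1) * (w2 x2 z * w3 x3 z)) + p1 * (\<Sum>z\<in>Z. (w2 x2 z - p2) * w3 x3 z)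
         + (p1 * p2) * (\<Sum>z\<in>Z. (w3 x3 z - p3) * 1)"
      by (simp add: sum_distrib_left sum.distrib sum_subtractf algebra_simps)
    moreover have "\<bar>p1 * (\<Sum>z\<in>Z. (w2 x2 z - p2) * w3 x3 z)\<bar> \<le> ?b x2 x3"
      using b by (simp add: abs_mult mult_left_le_one_le)
    moreover have "\<bar>(p1 * p2) * (\<Sum>z\<in>Z. (w3 x3 z - p3) * 1)\<bar> \<le> ?c x3"
      using b by (simp add: abs_mult mult_left_le_one_le mult_le_one)
    ultimately show "\<bar>(\<Sum>z\<in>Z. w1 x1 z * w2 x2 z * w3 x3 z) - p1 * p2 * p3 * real (card Z)\<bar>
      \<le> ?a x1 x2 x3 + ?b x2 x3 + ?c x3" by linarith
  qed
  also have "\<dots> = (\<Sum>x2\<in>X2. \<Sum>x3\<in>X3. \<Sum>x1\<in>X1. ?a x1 x2 x3) + (\<Sum>x1\<in>X1. \<Sum>x3\<in>X3. \<Sum>x2\<in>X2. ?b x2 x3)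
       + (\<Sum>x1\<in>X1. \<Sum>x2\<in>X2. \<Sum>x3\<in>X3. ?c x3)"
  proof -
    have "(\<Sum>x1\<in>X1. \<Sum>x2\<in>X2. \<Sum>x3\<in>X3. ?a x1 x2 x3) = (\<Sum>x2\<in>X2. \<Sum>x1\<in>X1. \<Sum>x3\<in>X3. ?a x1 x2 x3)"
      by (rule sum.swap)
    also have "\<dots> = (\<Sum>x2\<in>X2. \<Sum>x3\<in>X3. \<Sum>x1\<in>X1. ?a x1 x2 x3)"
      by (intro sum.cong refl sum.swap)
    finally have 1: "(\<Sum>x1\<in>X1. \<Sum>x2\<in>X2. \<Sum>x3\<in>X3. ?a x1 x2 x3) = (\<Sum>x2\<in>X2. \<Sum>x3\<in>X3. \<Sum>x1\<in>X1. ?a x1 x2 x3)" .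
    have 2: "(\<Sum>x1\<in>X1. \<Sum>x2\<in>X2. \<Sum>x3\<in>X3. ?b x2 x3) = (\<Sum>x1\<in>X1. \<Sum>x3\<in>X3. \<Sum>x2\<in>X2. ?b x2 x3)"
      by (intro sum.cong refl sum.swap)
    show ?thesis unfolding sum.distrib 1 2 by simp
  qed
  also have "\<dots> \<le> (\<Sum>x2\<in>X2. \<Sum>x3\<in>X3. 2 * \<eta> * real (card X1) * real (card Z))
      + (\<Sum>x1\<in>X1. \<Sum>x3\<in>X3. 2 * \<eta> * real (card X2) * real (card Z))
      + (\<Sum>x1\<in>X1. \<Sum>x2\<in>X2. 2 * \<eta> * real (card X3) * real (card Z))"
    by (intro add_mono sum_mono quasirandom_L1 q1 q2 q3) (use b in \<open>auto intro: mult_le_one\<close>)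
  also have "\<dots> = 6 * \<eta> * real (card X1) * real (card X2) * real (card X3) * real (card Z)" by simp
  finally show ?thesis .
qed

text \<open>The codegrees of pairs in \<open>X1 \<times> X2\<close> account for 4 \<eta>, the
  density of \<open>w12\<close> itself for the remaining \<eta>.\<close>

lemma triangle_count:
  assumes q12: "quasirandom \<eta> p12 X1 X2 w12" and q13: "quasirandom \<eta> p13 X1 X3 w13" and q23: "quasirandom \<eta> p23 X2 X3 w23"
    and "0 \<le> \<eta>"
  shows "\<bar>(\<Sum>x1\<in>X1. \<Sum>x2\<in>X2. \<Sum>x3\<in>X3. w12 x1 x2 * w13 x1 x3 * w23 x2 x3)
      - p12 * p13 * p23 * real (card X1) * real (card X2) * real (card X3)\<bar>
     \<le> 5 * \<eta> * real (card X1) * real (card X2) * real (card X3)"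
proof -
  note b = quasirandomD[OF q12] quasirandomD[OF q13] quasirandomD[OF q23]
  let ?D = "\<lambda>x1 x2. (\<Sum>x3\<in>X3. w13 x1 x3 * w23 x2 x3) - p13 * p23 * real (card X3)"
  let ?A = "\<Sum>x1\<in>X1. \<Sum>x2\<in>X2. w12 x1 x2 * ?D x1 x2"
  let ?B = "\<Sum>x1\<in>X1. \<Sum>x2\<in>X2. (w12 x1 x2 - p12) * 1 * 1"
  have "(\<Sum>x1\<in>X1. \<Sum>x2\<in>X2. \<Sum>x3\<in>X3. w12 x1 x2 * w13 x1 x3 * w23 x2 x3)
      - p12 * p13 * p23 * real (card X1) * real (card X2) * real (card X3) = ?A + p13 * p23 * real (card X3) * ?B"
    by (simp add: sum_distrib_left sum.distrib sum_subtractf algebra_simps)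
  moreover have "\<bar>?A\<bar> \<le> 4 * \<eta> * real (card X1) * real (card X2) * real (card X3)"
  proof (rule order_trans[OF _ codegree2[OF q13 q23]], intro order_trans[OF sum_abs] sum_mono order_trans[OF sum_abs])
    fix x1 x2 assume "x1 \<in> X1" "x2 \<in> X2"
    then show "\<bar>w12 x1 x2 * ?D x1 x2\<bar> \<le> \<bar>?D x1 x2\<bar>"
      using b by (simp add: abs_mult mult_left_le_one_le)
  qed
  moreover have "\<bar>p13 * p23 * real (card X3) * ?B\<bar> \<le> \<eta> * real (card X1) * real (card X2) * real (card X3)"
  proof -
    have "\<bar>p13 * p23 * real (card X3) * ?B\<bar> = (p13 * p23) * (real (card X3) * \<bar>?B\<bar>)"
      using b by (simp add: abs_mult)
    also have "\<dots> \<le> 1 * (real (card X3) * (\<eta> * real (card X1) * real (card X2)))"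
      using b quasirandom_bilinear[OF q12, of "\<lambda>_. 1" "\<lambda>_. 1"] assms(4)
      by (intro mult_mono mult_le_one) auto
    finally show ?thesis by (simp add: ac_simps)
  qed
  ultimately show ?thesis by linarith
qed

text \<open>In L1 the triples have the expected number of common neighbours in \<open>Z\<close>, so
  every weighting of the triples extends to \<open>Z\<close> proportionally.\<close>

lemma extension_count:
  assumes q1: "quasirandom \<eta> p1 X1 Z w1" and q2: "quasirandom \<eta> p2 X2 Z w2" and q3: "quasirandom \<eta> p3 X3 Z w3"
    and \<theta>: "\<And>x1 x2 x3. x1 \<in> X1 \<Longrightarrow> x2 \<in> X2 \<Longrightarrow> x3 \<in> X3 \<Longrightarrow> 0 \<le> \<theta> x1 x2 x3 \<and> \<theta> x1 x2 x3 \<le> 1"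
  shows "\<bar>(\<Sum>x1\<in>X1. \<Sum>x2\<in>X2. \<Sum>x3\<in>X3. \<Sum>z\<in>Z. \<theta> x1 x2 x3 * (w1 x1 z * w2 x2 z * w3 x3 z))
       - p1 * p2 * p3 * real (card Z) * (\<Sum>x1\<in>X1. \<Sum>x2\<in>X2. \<Sum>x3\<in>X3. \<theta> x1 x2 x3)\<bar>
     \<le> 6 * \<eta> * real (card X1) * real (card X2) * real (card X3) * real (card Z)"
proof -
  let ?D = "\<lambda>x1 x2 x3. (\<Sum>z\<in>Z. w1 x1 z * w2 x2 z * w3 x3 z) - p1 * p2 * p3 * real (card Z)"
  have "(\<Sum>x1\<in>X1. \<Sum>x2\<in>X2. \<Sum>x3\<in>X3. \<Sum>z\<in>Z. \<theta> x1 x2 x3 * (w1 x1 z * w2 x2 z * w3 x3 z))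
       - p1 * p2 * p3 * real (card Z) * (\<Sum>x1\<in>X1. \<Sum>x2\<in>X2. \<Sum>x3\<in>X3. \<theta> x1 x2 x3)
    = (\<Sum>x1\<in>X1. \<Sum>x2\<in>X2. \<Sum>x3\<in>X3. \<theta> x1 x2 x3 * ?D x1 x2 x3)"
    by (simp add: sum_distrib_left sum_subtractf algebra_simps)
  moreover have "\<bar>\<dots>\<bar> \<le> (\<Sum>x1\<in>X1. \<Sum>x2\<in>X2. \<Sum>x3\<in>X3. \<bar>?D x1 x2 x3\<bar>)"
  proof (intro order_trans[OF sum_abs] sum_mono order_trans[OF sum_abs])
    fix x1 x2 x3 assume "x1 \<in> X1" "x2 \<in> X2" "x3 \<in> X3"
    then show "\<bar>\<theta> x1 x2 x3 * ?D x1 x2 x3\<bar> \<le> \<bar>?D x1 x2 x3\<bar>"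
      using \<theta> by (simp add: abs_mult mult_left_le_one_le)
  qed
  moreover note codegree3[OF q1 q2 q3]
  ultimately show ?thesis by linarith
qed

text \<open>Triangle counting on the first three parts contributes 5 \<eta>, the extension to the
  fourth part 6 \<eta>.\<close>

lemma simplex_count_lower:
  assumes q12: "quasirandom \<eta> p12 X1 X2 w12" and q13: "quasirandom \<eta> p13 X1 X3 w13" and q23: "quasirandom \<eta> p23 X2 X3 w23"
    and q14: "quasirandom \<eta> p14 X1 X4 w14" and q24: "quasirandom \<eta> p24 X2 X4 w24" and q34: "quasirandom \<eta> p34 X3 X4 w34"
    and \<eta>: "0 \<le> \<eta>"
  shows "(p12 * p13 * p23 * p14 * p24 * p34 - 11 * \<eta>) * (real (card X1) * real (card X2) * real (card X3) * real (card X4))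
    \<le> (\<Sum>x1\<in>X1. \<Sum>x2\<in>X2. \<Sum>x3\<in>X3. \<Sum>x4\<in>X4. w12 x1 x2 * w13 x1 x3 * w23 x2 x3 * (w14 x1 x4 * w24 x2 x4 * w34 x3 x4))"
proof -
  note b = quasirandomD[OF q12] quasirandomD[OF q13] quasirandomD[OF q23]
  note c = quasirandomD(3,4)[OF q14] quasirandomD(3,4)[OF q24] quasirandomD(3,4)[OF q34]
  let ?T = "\<Sum>x1\<in>X1. \<Sum>x2\<in>X2. \<Sum>x3\<in>X3. w12 x1 x2 * w13 x1 x3 * w23 x2 x3"
  let ?n3 = "real (card X1) * real (card X2) * real (card X3)" and ?n4 = "real (card X4)"
  let ?P = "p14 * p24 * p34"
  have P: "0 \<le> ?P" "?P \<le> 1" using c by (auto intro!: mult_le_one)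
  have "p12 * p13 * p23 * ?n3 - 5 * \<eta> * ?n3 \<le> ?T"
    using triangle_count[OF q12 q13 q23 \<eta>] by (simp add: abs_le_iff algebra_simps)
  then have "?P * ?n4 * (p12 * p13 * p23 * ?n3 - 5 * \<eta> * ?n3) \<le> ?P * ?n4 * ?T"
    using P by (intro mult_left_mono) auto
  moreover have "?P * (5 * \<eta> * ?n3 * ?n4) \<le> 1 * (5 * \<eta> * ?n3 * ?n4)"
    using P \<eta> by (intro mult_right_mono) auto
  moreover have "?P * ?n4 * ?T - 6 * \<eta> * ?n3 * ?n4 \<le>
     (\<Sum>x1\<in>X1. \<Sum>x2\<in>X2. \<Sum>x3\<in>X3. \<Sum>x4\<in>X4. w12 x1 x2 * w13 x1 x3 * w23 x2 x3 * (w14 x1 x4 * w24 x2 x4 * w34 x3 x4))"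
    using extension_count[OF q14 q24 q34, of "\<lambda>x1 x2 x3. w12 x1 x2 * w13 x1 x3 * w23 x2 x3"] b
    by (auto simp: abs_le_iff mult_le_one algebra_simps)
  ultimately show ?thesis by (simp add: algebra_simps)
qed

text \<open>A face error is known only relative to the triangles on the same three parts. By the
  extension count the fourth vertex multiplies weighted and unweighted triangles by the same factor,
  so the relative error \<kappa> survives among simplices.\<close>

lemma simplex_face_error:
  assumes q12: "quasirandom \<eta> p12 X1 X2 w12" and q13: "quasirandom \<eta> p13 X1 X3 w13" and q23: "quasirandom \<eta> p23 X2 X3 w23"
    and q14: "quasirandom \<eta> p14 X1 X4 w14" and q24: "quasirandom \<eta> p24 X2 X4 w24" and q34: "quasirandom \<eta> p34 X3 X4 w34"
    and \<eta>: "0 \<le> \<eta>" and \<kappa>: "0 \<le> \<kappa>" "\<kappa> \<le> 1"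
    and e: "\<And>x1 x2 x3. x1 \<in> X1 \<Longrightarrow> x2 \<in> X2 \<Longrightarrow> x3 \<in> X3 \<Longrightarrow> 0 \<le> e x1 x2 x3 \<and> e x1 x2 x3 \<le> 1"
    and small: "(\<Sum>x1\<in>X1. \<Sum>x2\<in>X2. \<Sum>x3\<in>X3. w12 x1 x2 * w13 x1 x3 * w23 x2 x3 * e x1 x2 x3)
      \<le> \<kappa> * (\<Sum>x1\<in>X1. \<Sum>x2\<in>X2. \<Sum>x3\<in>X3. w12 x1 x2 * w13 x1 x3 * w23 x2 x3)"
  shows "(\<Sum>x1\<in>X1. \<Sum>x2\<in>X2. \<Sum>x3\<in>X3. \<Sum>x4\<in>X4.
       w12 x1 x2 * w13 x1 x3 * w23 x2 x3 * e x1 x2 x3 * (w14 x1 x4 * w24 x2 x4 * w34 x3 x4))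
    \<le> (\<kappa> * (p12 * p13 * p23 * p14 * p24 * p34) + 11 * \<eta>) * (real (card X1) * real (card X2) * real (card X3) * real (card X4))"
proof -
  note b = quasirandomD[OF q12] quasirandomD[OF q13] quasirandomD[OF q23]
  note c = quasirandomD(3,4)[OF q14] quasirandomD(3,4)[OF q24] quasirandomD(3,4)[OF q34]
  let ?T = "\<Sum>x1\<in>X1. \<Sum>x2\<in>X2. \<Sum>x3\<in>X3. w12 x1 x2 * w13 x1 x3 * w23 x2 x3"
  let ?E = "\<Sum>x1\<in>X1. \<Sum>x2\<in>X2. \<Sum>x3\<in>X3. w12 x1 x2 * w13 x1 x3 * w23 x2 x3 * e x1 x2 x3"
  let ?n3 = "real (card X1) * real (card X2) * real (card X3)" and ?n4 = "real (card X4)"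
  let ?P = "p14 * p24 * p34"
  have P: "0 \<le> ?P" "?P \<le> 1" using c by (auto intro!: mult_le_one)
  have "?T \<le> p12 * p13 * p23 * ?n3 + 5 * \<eta> * ?n3"
    using triangle_count[OF q12 q13 q23 \<eta>] by (simp add: abs_le_iff algebra_simps)
  then have "\<kappa> * ?T \<le> \<kappa> * (p12 * p13 * p23 * ?n3 + 5 * \<eta> * ?n3)"
    using \<kappa> by (intro mult_left_mono) auto
  with small have "?E \<le> \<kappa> * (p12 * p13 * p23 * ?n3 + 5 * \<eta> * ?n3)" by linarith
  then have "?P * ?n4 * ?E \<le> ?P * ?n4 * (\<kappa> * (p12 * p13 * p23 * ?n3 + 5 * \<eta> * ?n3))"
    using P by (intro mult_left_mono) auto
  moreover have "(?P * \<kappa>) * (5 * \<eta> * ?n3 * ?n4) \<le> 1 * (5 * \<eta> * ?n3 * ?n4)"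
    using P \<eta> mult_le_one[OF P(2) \<kappa>] by (intro mult_right_mono) auto
  moreover have "(\<Sum>x1\<in>X1. \<Sum>x2\<in>X2. \<Sum>x3\<in>X3. \<Sum>x4\<in>X4.
       w12 x1 x2 * w13 x1 x3 * w23 x2 x3 * e x1 x2 x3 * (w14 x1 x4 * w24 x2 x4 * w34 x3 x4)) \<le> ?P * ?n4 * ?E + 6 * \<eta> * ?n3 * ?n4"
    using extension_count[OF q14 q24 q34, of "\<lambda>x1 x2 x3. w12 x1 x2 * w13 x1 x3 * w23 x2 x3 * e x1 x2 x3"] b e
    by (auto simp: abs_le_iff mult_le_one algebra_simps)
  ultimately show ?thesis by (simp add: algebra_simps)
qed

section \<open>Counting simplices with weights on the faces\<close>

lemma prod4_ge:
  fixes d :: real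
  assumes "0 \<le> d" and s: "d \<le> s1" "d \<le> s2" "d \<le> s3" "d \<le> s4" "s1 \<le> 1" "s2 \<le> 1" "s3 \<le> 1" "s4 \<le> 1"
    and g: "0 \<le> g1" "0 \<le> g2" "0 \<le> g3" "0 \<le> g4" "g1 \<le> 1" "g2 \<le> 1" "g3 \<le> 1" "g4 \<le> 1"
  shows "d ^ 4 - (\<bar>g1 - s1\<bar> + \<bar>g2 - s2\<bar> + \<bar>g3 - s3\<bar> + \<bar>g4 - s4\<bar>) \<le> g1 * g2 * g3 * g4"
proof -
  have m: "\<bar>a * b * c * x\<bar> \<le> \<bar>x\<bar>" if "0 \<le> a" "a \<le> 1" "0 \<le> b" "b \<le> 1" "0 \<le> c" "c \<le> 1" for a b c x :: real
  proof -
    have "a * b * c \<le> 1" "0 \<le> a * b * c" using that by (auto intro!: mult_le_one)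
    then show ?thesis by (simp add: abs_mult mult_left_le_one_le)
  qed
  have "d ^ 4 \<le> s1 * s2 * s3 * s4"
    using assms by (simp add: power4_eq_xxxx mult_mono)
  moreover have "g1 * g2 * g3 * g4 - s1 * s2 * s3 * s4
    = s2 * s3 * s4 * (g1 - s1) + g1 * s3 * s4 * (g2 - s2) + g1 * g2 * s4 * (g3 - s3) + g1 * g2 * g3 * (g4 - s4)"
    by (simp add: algebra_simps)
  moreover have "\<bar>s2 * s3 * s4 * (g1 - s1)\<bar> \<le> \<bar>g1 - s1\<bar>" "\<bar>g1 * s3 * s4 * (g2 - s2)\<bar> \<le> \<bar>g2 - s2\<bar>"
    "\<bar>g1 * g2 * s4 * (g3 - s3)\<bar> \<le> \<bar>g3 - s3\<bar>" "\<bar>g1 * g2 * g3 * (g4 - s4)\<bar> \<le> \<bar>g4 - s4\<bar>"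
    by (intro m; use assms in linarith)+
  ultimately show ?thesis by linarith
qed

text \<open>These reorderings place the vertex opposite a given face innermost, which is where
  \<open>simplex_face_error\<close> expects the apex.\<close>

lemma sum4_apex_last:
  fixes h :: "'a \<Rightarrow> 'b \<Rightarrow> 'c \<Rightarrow> 'd \<Rightarrow> real"
  shows sum4_124: "(\<Sum>x1\<in>A. \<Sum>x2\<in>B. \<Sum>x4\<in>D. \<Sum>x3\<in>C. h x1 x2 x3 x4) = (\<Sum>x1\<in>A. \<Sum>x2\<in>B. \<Sum>x3\<in>C. \<Sum>x4\<in>D. h x1 x2 x3 x4)"
    and sum4_134: "(\<Sum>x1\<in>A. \<Sum>x3\<in>C. \<Sum>x4\<in>D. \<Sum>x2\<in>B. h x1 x2 x3 x4) = (\<Sum>x1\<in>A. \<Sum>x2\<in>B. \<Sum>x3\<in>C. \<Sum>x4\<in>D. h x1 x2 x3 x4)"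
    and sum4_234: "(\<Sum>x2\<in>B. \<Sum>x3\<in>C. \<Sum>x4\<in>D. \<Sum>x1\<in>A. h x1 x2 x3 x4) = (\<Sum>x1\<in>A. \<Sum>x2\<in>B. \<Sum>x3\<in>C. \<Sum>x4\<in>D. h x1 x2 x3 x4)"
proof -
  show "(\<Sum>x1\<in>A. \<Sum>x2\<in>B. \<Sum>x4\<in>D. \<Sum>x3\<in>C. h x1 x2 x3 x4) = (\<Sum>x1\<in>A. \<Sum>x2\<in>B. \<Sum>x3\<in>C. \<Sum>x4\<in>D. h x1 x2 x3 x4)"
    by (intro sum.cong refl sum.swap)
  have "(\<Sum>x3\<in>C. \<Sum>x4\<in>D. \<Sum>x2\<in>B. f x2 x3 x4) = (\<Sum>x2\<in>B. \<Sum>x3\<in>C. \<Sum>x4\<in>D. f x2 x3 x4)"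
    for f :: "'e \<Rightarrow> 'c \<Rightarrow> 'd \<Rightarrow> real" and B
  proof -
    have "(\<Sum>x3\<in>C. \<Sum>x4\<in>D. \<Sum>x2\<in>B. f x2 x3 x4) = (\<Sum>x3\<in>C. \<Sum>x2\<in>B. \<Sum>x4\<in>D. f x2 x3 x4)"
      by (intro sum.cong refl sum.swap)
    also have "\<dots> = (\<Sum>x2\<in>B. \<Sum>x3\<in>C. \<Sum>x4\<in>D. f x2 x3 x4)" by (rule sum.swap)
    finally show ?thesis .
  qed
  note rot = this
  show "(\<Sum>x1\<in>A. \<Sum>x3\<in>C. \<Sum>x4\<in>D. \<Sum>x2\<in>B. h x1 x2 x3 x4) = (\<Sum>x1\<in>A. \<Sum>x2\<in>B. \<Sum>x3\<in>C. \<Sum>x4\<in>D. h x1 x2 x3 x4)"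
    by (intro sum.cong refl rot)
  have "(\<Sum>x2\<in>B. \<Sum>x3\<in>C. \<Sum>x4\<in>D. \<Sum>x1\<in>A. h x1 x2 x3 x4) = (\<Sum>x2\<in>B. \<Sum>x1\<in>A. \<Sum>x3\<in>C. \<Sum>x4\<in>D. h x1 x2 x3 x4)"
    by (intro sum.cong refl rot)
  also have "\<dots> = (\<Sum>x1\<in>A. \<Sum>x2\<in>B. \<Sum>x3\<in>C. \<Sum>x4\<in>D. h x1 x2 x3 x4)" by (rule sum.swap)
  finally show "(\<Sum>x2\<in>B. \<Sum>x3\<in>C. \<Sum>x4\<in>D. \<Sum>x1\<in>A. h x1 x2 x3 x4) = (\<Sum>x1\<in>A. \<Sum>x2\<in>B. \<Sum>x3\<in>C. \<Sum>x4\<in>D. h x1 x2 x3 x4)" .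
qed

text \<open>On [0, 1] a product of four factors is 1-Lipschitz in each of them, so replacing
  \<open>g\<close> by the constants \<open>s\<close> loses at most the sum of the four deviations.
  Each deviation is controlled as a face error, while the constants leave at least
  \<open>d ^ 4\<close> times the plain simplex count. The constant 55 is 11 from the main term and
  11 from each of the four faces.\<close>

lemma simplex_count:
  fixes g123 g124 g134 g234 :: "'v \<Rightarrow> 'v \<Rightarrow> 'v \<Rightarrow> real"
  assumes q12: "quasirandom \<eta> p12 X1 X2 w12" and q13: "quasirandom \<eta> p13 X1 X3 w13" and q23: "quasirandom \<eta> p23 X2 X3 w23"
    and q14: "quasirandom \<eta> p14 X1 X4 w14" and q24: "quasirandom \<eta> p24 X2 X4 w24" and q34: "quasirandom \<eta> p34 X3 X4 w34"
    and \<eta>: "0 \<le> \<eta>" and d: "0 \<le> d" "d \<le> 1" and \<kappa>: "0 \<le> \<kappa>" "4 * \<kappa> \<le> d ^ 4"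
    and p0: "0 \<le> p0" "p0 \<le> p12" "p0 \<le> p13" "p0 \<le> p23" "p0 \<le> p14" "p0 \<le> p24" "p0 \<le> p34"
    and s: "d \<le> s123" "s123 \<le> 1" "d \<le> s124" "s124 \<le> 1" "d \<le> s134" "s134 \<le> 1" "d \<le> s234" "s234 \<le> 1"
    and g: "\<And>x y z. 0 \<le> g123 x y z \<and> g123 x y z \<le> 1" "\<And>x y z. 0 \<le> g124 x y z \<and> g124 x y z \<le> 1"
      "\<And>x y z. 0 \<le> g134 x y z \<and> g134 x y z \<le> 1" "\<And>x y z. 0 \<le> g234 x y z \<and> g234 x y z \<le> 1"
    and e123: "(\<Sum>x\<in>X1. \<Sum>y\<in>X2. \<Sum>z\<in>X3. w12 x y * w13 x z * w23 y z * \<bar>g123 x y z - s123\<bar>)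
      \<le> \<kappa> * (\<Sum>x\<in>X1. \<Sum>y\<in>X2. \<Sum>z\<in>X3. w12 x y * w13 x z * w23 y z)"
    and e124: "(\<Sum>x\<in>X1. \<Sum>y\<in>X2. \<Sum>z\<in>X4. w12 x y * w14 x z * w24 y z * \<bar>g124 x y z - s124\<bar>)
      \<le> \<kappa> * (\<Sum>x\<in>X1. \<Sum>y\<in>X2. \<Sum>z\<in>X4. w12 x y * w14 x z * w24 y z)"
    and e134: "(\<Sum>x\<in>X1. \<Sum>y\<in>X3. \<Sum>z\<in>X4. w13 x y * w14 x z * w34 y z * \<bar>g134 x y z - s134\<bar>)
      \<le> \<kappa> * (\<Sum>x\<in>X1. \<Sum>y\<in>X3. \<Sum>z\<in>X4. w13 x y * w14 x z * w34 y z)"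
    and e234: "(\<Sum>x\<in>X2. \<Sum>y\<in>X3. \<Sum>z\<in>X4. w23 x y * w24 x z * w34 y z * \<bar>g234 x y z - s234\<bar>)
      \<le> \<kappa> * (\<Sum>x\<in>X2. \<Sum>y\<in>X3. \<Sum>z\<in>X4. w23 x y * w24 x z * w34 y z)"
  shows "((d ^ 4 - 4 * \<kappa>) * p0 ^ 6 - 55 * \<eta>) * (real (card X1) * real (card X2) * real (card X3) * real (card X4))
    \<le> (\<Sum>x1\<in>X1. \<Sum>x2\<in>X2. \<Sum>x3\<in>X3. \<Sum>x4\<in>X4.
         w12 x1 x2 * w13 x1 x3 * w23 x2 x3 * (w14 x1 x4 * w24 x2 x4 * w34 x3 x4) *
         (g123 x1 x2 x3 * g124 x1 x2 x4 * g134 x1 x3 x4 * g234 x2 x3 x4))"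
proof -
  note b = quasirandomD[OF q12] quasirandomD[OF q13] quasirandomD[OF q23]
    quasirandomD[OF q14] quasirandomD[OF q24] quasirandomD[OF q34]
  let ?W = "\<lambda>x1 x2 x3 x4. w12 x1 x2 * w13 x1 x3 * w23 x2 x3 * (w14 x1 x4 * w24 x2 x4 * w34 x3 x4)"
  let ?P = "p12 * p13 * p23 * p14 * p24 * p34"
  let ?n = "real (card X1) * real (card X2) * real (card X3) * real (card X4)"
  let ?S = "\<lambda>h. \<Sum>x1\<in>X1. \<Sum>x2\<in>X2. \<Sum>x3\<in>X3. \<Sum>x4\<in>X4. h x1 x2 x3 x4 :: real"
  let ?e123 = "\<lambda>x1 x2 x3 x4. \<bar>g123 x1 x2 x3 - s123\<bar>" and ?e124 = "\<lambda>x1 x2 x3 x4. \<bar>g124 x1 x2 x4 - s124\<bar>"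
  let ?e134 = "\<lambda>x1 x2 x3 x4. \<bar>g134 x1 x3 x4 - s134\<bar>" and ?e234 = "\<lambda>x1 x2 x3 x4. \<bar>g234 x2 x3 x4 - s234\<bar>"
  have \<kappa>1: "\<kappa> \<le> 1" using \<kappa> d power_le_one[of d 4] by simp
  have a: "0 \<le> \<bar>u - v\<bar> \<and> \<bar>u - v\<bar> \<le> 1" if "0 \<le> u \<and> u \<le> 1" "d \<le> v" "v \<le> 1" for u v :: real
    using that d by linarith
  have S123: "?S (\<lambda>x1 x2 x3 x4. ?W x1 x2 x3 x4 * ?e123 x1 x2 x3 x4) \<le> (\<kappa> * ?P + 11 * \<eta>) * ?n"
  proof -
    have "?S (\<lambda>x1 x2 x3 x4. ?W x1 x2 x3 x4 * ?e123 x1 x2 x3 x4) = (\<Sum>x1\<in>X1. \<Sum>x2\<in>X2. \<Sum>x3\<in>X3. \<Sum>x4\<in>X4.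
        w12 x1 x2 * w13 x1 x3 * w23 x2 x3 * \<bar>g123 x1 x2 x3 - s123\<bar> * (w14 x1 x4 * w24 x2 x4 * w34 x3 x4))"
      by (intro sum.cong refl) (simp only: mult_ac)
    also have "\<dots> \<le> (\<kappa> * (p12 * p13 * p23 * p14 * p24 * p34) + 11 * \<eta>) * (real (card X1) * real (card X2) * real (card X3) * real (card X4))"
      by (rule simplex_face_error[OF q12 q13 q23 q14 q24 q34 \<eta> \<kappa>(1) \<kappa>1 _ e123])
        (rule a[OF g(1) s(1,2)])
    finally show ?thesis by (simp only: mult_ac)
  qed
  have S124: "?S (\<lambda>x1 x2 x3 x4. ?W x1 x2 x3 x4 * ?e124 x1 x2 x3 x4) \<le> (\<kappa> * ?P + 11 * \<eta>) * ?n"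
  proof -
    have "?S (\<lambda>x1 x2 x3 x4. ?W x1 x2 x3 x4 * ?e124 x1 x2 x3 x4) = (\<Sum>x1\<in>X1. \<Sum>x2\<in>X2. \<Sum>x4\<in>X4. \<Sum>x3\<in>X3.
        w12 x1 x2 * w14 x1 x4 * w24 x2 x4 * \<bar>g124 x1 x2 x4 - s124\<bar> * (w13 x1 x3 * w23 x2 x3 * w34 x3 x4))"
      by (rule trans[OF sum4_124[symmetric]], intro sum.cong refl) (simp only: mult_ac)
    also have "\<dots> \<le> (\<kappa> * (p12 * p14 * p24 * p13 * p23 * p34) + 11 * \<eta>) * (real (card X1) * real (card X2) * real (card X4) * real (card X3))"
      by (rule simplex_face_error[OF q12 q14 q24 q13 q23 quasirandom_flip[OF q34] \<eta> \<kappa>(1) \<kappa>1 _ e124])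
        (rule a[OF g(2) s(3,4)])
    finally show ?thesis by (simp only: mult_ac)
  qed
  have S134: "?S (\<lambda>x1 x2 x3 x4. ?W x1 x2 x3 x4 * ?e134 x1 x2 x3 x4) \<le> (\<kappa> * ?P + 11 * \<eta>) * ?n"
  proof -
    have "?S (\<lambda>x1 x2 x3 x4. ?W x1 x2 x3 x4 * ?e134 x1 x2 x3 x4) = (\<Sum>x1\<in>X1. \<Sum>x3\<in>X3. \<Sum>x4\<in>X4. \<Sum>x2\<in>X2.
        w13 x1 x3 * w14 x1 x4 * w34 x3 x4 * \<bar>g134 x1 x3 x4 - s134\<bar> * (w12 x1 x2 * w23 x2 x3 * w24 x2 x4))"
      by (rule trans[OF sum4_134[symmetric]], intro sum.cong refl) (simp only: mult_ac)
    also have "\<dots> \<le> (\<kappa> * (p13 * p14 * p34 * p12 * p23 * p24) + 11 * \<eta>) * (real (card X1) * real (card X3) * real (card X4) * real (card X2))"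
      by (rule simplex_face_error[OF q13 q14 q34 q12 quasirandom_flip[OF q23] quasirandom_flip[OF q24] \<eta> \<kappa>(1) \<kappa>1 _ e134])
        (rule a[OF g(3) s(5,6)])
    finally show ?thesis by (simp only: mult_ac)
  qed
  have S234: "?S (\<lambda>x1 x2 x3 x4. ?W x1 x2 x3 x4 * ?e234 x1 x2 x3 x4) \<le> (\<kappa> * ?P + 11 * \<eta>) * ?n"
  proof -
    have "?S (\<lambda>x1 x2 x3 x4. ?W x1 x2 x3 x4 * ?e234 x1 x2 x3 x4) = (\<Sum>x2\<in>X2. \<Sum>x3\<in>X3. \<Sum>x4\<in>X4. \<Sum>x1\<in>X1.
        w23 x2 x3 * w24 x2 x4 * w34 x3 x4 * \<bar>g234 x2 x3 x4 - s234\<bar> * (w12 x1 x2 * w13 x1 x3 * w14 x1 x4))"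
      by (rule trans[OF sum4_234[symmetric]], intro sum.cong refl) (simp only: mult_ac)
    also have "\<dots> \<le> (\<kappa> * (p23 * p24 * p34 * p12 * p13 * p14) + 11 * \<eta>) * (real (card X2) * real (card X3) * real (card X4) * real (card X1))"
      by (rule simplex_face_error[OF q23 q24 q34 quasirandom_flip[OF q12] quasirandom_flip[OF q13] quasirandom_flip[OF q14] \<eta> \<kappa>(1) \<kappa>1 _ e234])
        (rule a[OF g(4) s(7,8)])
    finally show ?thesis by (simp only: mult_ac)
  qed
  have "d ^ 4 * ((?P - 11 * \<eta>) * ?n) \<le> d ^ 4 * ?S ?W"
    by (intro mult_left_mono simplex_count_lower[OF q12 q13 q23 q14 q24 q34 \<eta>]) (use d in auto)
  moreover have "?S (\<lambda>x1 x2 x3 x4. ?W x1 x2 x3 x4 * (d ^ 4 - (?e123 x1 x2 x3 x4 + ?e124 x1 x2 x3 x4 + ?e134 x1 x2 x3 x4 + ?e234 x1 x2 x3 x4)))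
    \<le> ?S (\<lambda>x1 x2 x3 x4. ?W x1 x2 x3 x4 * (g123 x1 x2 x3 * g124 x1 x2 x4 * g134 x1 x3 x4 * g234 x2 x3 x4))"
  proof (intro sum_mono mult_left_mono prod4_ge)
    fix x1 x2 x3 x4 assume "x1 \<in> X1" "x2 \<in> X2" "x3 \<in> X3" "x4 \<in> X4"
    then show "0 \<le> ?W x1 x2 x3 x4" using b by (intro mult_nonneg_nonneg)
  qed (use d s g in auto)
  moreover have "?S (\<lambda>x1 x2 x3 x4. ?W x1 x2 x3 x4 * (d ^ 4 - (?e123 x1 x2 x3 x4 + ?e124 x1 x2 x3 x4 + ?e134 x1 x2 x3 x4 + ?e234 x1 x2 x3 x4)))
    = d ^ 4 * ?S ?W - (?S (\<lambda>x1 x2 x3 x4. ?W x1 x2 x3 x4 * ?e123 x1 x2 x3 x4) + ?S (\<lambda>x1 x2 x3 x4. ?W x1 x2 x3 x4 * ?e124 x1 x2 x3 x4)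
        + ?S (\<lambda>x1 x2 x3 x4. ?W x1 x2 x3 x4 * ?e134 x1 x2 x3 x4) + ?S (\<lambda>x1 x2 x3 x4. ?W x1 x2 x3 x4 * ?e234 x1 x2 x3 x4))"
    unfolding sum_distrib_left sum_subtractf[symmetric] sum.distrib[symmetric]
    by (intro sum.cong refl) (simp only: ring_distribs mult.commute[of "d ^ 4"])
  moreover have "((d ^ 4 - 4 * \<kappa>) * p0 ^ 6 - 55 * \<eta>) * ?n \<le> d ^ 4 * ((?P - 11 * \<eta>) * ?n) - 4 * ((\<kappa> * ?P + 11 * \<eta>) * ?n)"
  proof -
    have "p0 ^ 6 \<le> ?P"
    proof -
      have "p0 ^ 6 = p0 * p0 * p0 * p0 * p0 * p0" by (simp add: eval_nat_numeral)
      also have "\<dots> \<le> ?P" using p0 b by (intro mult_mono) auto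
      finally show ?thesis .
    qed
    \<comment> \<open>\<open>4 * \<kappa> \<le> d ^ 4\<close> keeps the combined coefficient
      nonnegative, so the product of densities may be bounded from below although it also occurs in
      the error terms.\<close>
    then have "(d ^ 4 - 4 * \<kappa>) * p0 ^ 6 \<le> (d ^ 4 - 4 * \<kappa>) * ?P" using \<kappa> by (intro mult_left_mono) auto
    moreover have "d ^ 4 * (11 * \<eta>) \<le> 1 * (11 * \<eta>)" using d \<eta> by (intro mult_right_mono power_le_one) auto
    ultimately have "(d ^ 4 - 4 * \<kappa>) * p0 ^ 6 - 55 * \<eta> \<le> d ^ 4 * (?P - 11 * \<eta>) - 4 * (\<kappa> * ?P + 11 * \<eta>)"
      by (simp add: algebra_simps)
    then have "((d ^ 4 - 4 * \<kappa>) * p0 ^ 6 - 55 * \<eta>) * ?n \<le> (d ^ 4 * (?P - 11 * \<eta>) - 4 * (\<kappa> * ?P + 11 * \<eta>)) * ?n"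
      by (rule mult_right_mono) auto
    then show ?thesis by (simp only: left_diff_distrib mult.assoc)
  qed
  ultimately show ?thesis using S123 S124 S134 S234 by linarith
qed

text \<open>The sum is linear in each of the three pair weights, so they can be pushed one at a time
  to 0/1 values, that is, to edge sets. Each stage collects the coefficients belonging to one pair
  and applies the extreme point bound on \<open>V \<times> V\<close>.\<close>

lemma sum_weight3_le:
  fixes u :: "'v \<Rightarrow> 'v \<Rightarrow> 'v \<Rightarrow> real"
  assumes V: "finite V"
    and C: "\<And>A B D. (\<Sum>x\<in>V. \<Sum>y\<in>V. \<Sum>z\<in>V. u x y z * of_bool ((x, y) \<in> A) * of_bool ((x, z) \<in> B) * of_bool ((y, z) \<in> D)) \<le> C"
    and a: "\<And>x y. 0 \<le> a x y \<and> a x y \<le> 1" and b: "\<And>x y. 0 \<le> b x y \<and> b x y \<le> 1" and c: "\<And>x y. 0 \<le> c x y \<and> c x y \<le> 1"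
  shows "(\<Sum>x\<in>V. \<Sum>y\<in>V. \<Sum>z\<in>V. u x y z * a x y * b x z * c y z) \<le> C"
proof -
  let ?\<Phi> = "\<lambda>a b c. \<Sum>x\<in>V. \<Sum>y\<in>V. \<Sum>z\<in>V. u x y z * a x y * b x z * c y z"
  let ?i = "\<lambda>A x y. of_bool ((x, y) \<in> A) :: real"
  have fin: "finite (V \<times> V)" using V by simp
  have red: "(\<Sum>p\<in>A. f p) = (\<Sum>x\<in>V. \<Sum>y\<in>V. f (x, y) * ?i A x y)" if "A \<subseteq> V \<times> V" for A and f :: "'v \<times> 'v \<Rightarrow> real"
  proof -
    have "(\<Sum>x\<in>V. \<Sum>y\<in>V. f (x, y) * ?i A x y) = (\<Sum>p\<in>V \<times> V. if p \<in> A then f p else 0)"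
      by (simp add: sum.cartesian_product case_prod_unfold) (intro sum.cong refl, auto)
    also have "\<dots> = (\<Sum>p\<in>A. f p)" using that fin by (simp add: sum.inter_restrict[symmetric] Int_absorb1)
    finally show ?thesis by simp
  qed
  have pairs: "(\<Sum>p\<in>V \<times> V. f (fst p) (snd p)) = (\<Sum>x\<in>V. \<Sum>y\<in>V. f x y)" for f :: "'v \<Rightarrow> 'v \<Rightarrow> real"
    by (simp add: sum.cartesian_product case_prod_unfold)
  have 1: "?\<Phi> a (?i B) (?i D) \<le> C" for B D
  proof -
    have eq: "?\<Phi> a (?i B) (?i D) = (\<Sum>p\<in>V \<times> V. (\<Sum>z\<in>V. u (fst p) (snd p) z * ?i B (fst p) z * ?i D (snd p) z) * a (fst p) (snd p))" for a
      by (subst pairs[of "\<lambda>x y. (\<Sum>z\<in>V. u x y z * ?i B x z * ?i D y z) * a x y"]) (simp add: sum_distrib_left sum_distrib_right ac_simps)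
    show ?thesis unfolding eq
    proof (rule sum_weight_le[OF fin])
      fix A assume A: "A \<subseteq> V \<times> V"
      show "(\<Sum>p\<in>A. \<Sum>z\<in>V. u (fst p) (snd p) z * ?i B (fst p) z * ?i D (snd p) z) \<le> C"
        unfolding red[OF A] using C[of A B D] by (simp add: sum_distrib_left sum_distrib_right ac_simps)
    qed (use a in auto)
  qed
  have 2: "?\<Phi> a b (?i D) \<le> C" for D
  proof -
    have eq: "?\<Phi> a b (?i D) = (\<Sum>p\<in>V \<times> V. (\<Sum>y\<in>V. u (fst p) y (snd p) * a (fst p) y * ?i D y (snd p)) * b (fst p) (snd p))"
    proof -
      have "?\<Phi> a b (?i D) = (\<Sum>x\<in>V. \<Sum>z\<in>V. \<Sum>y\<in>V. u x y z * a x y * b x z * ?i D y z)"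
        by (intro sum.cong refl sum.swap)
      then show ?thesis
        by (subst pairs[of "\<lambda>x z. (\<Sum>y\<in>V. u x y z * a x y * ?i D y z) * b x z"]) (simp add: sum_distrib_left sum_distrib_right ac_simps)
    qed
    show ?thesis unfolding eq
    proof (rule sum_weight_le[OF fin])
      fix B assume B: "B \<subseteq> V \<times> V"
      have "(\<Sum>p\<in>B. \<Sum>y\<in>V. u (fst p) y (snd p) * a (fst p) y * ?i D y (snd p))
         = (\<Sum>x\<in>V. \<Sum>z\<in>V. \<Sum>y\<in>V. u x y z * a x y * ?i B x z * ?i D y z)"
        unfolding red[OF B] by (simp add: sum_distrib_left sum_distrib_right ac_simps)
      also have "\<dots> = ?\<Phi> a (?i B) (?i D)" by (intro sum.cong refl sum.swap)
      finally show "(\<Sum>p\<in>B. \<Sum>y\<in>V. u (fst p) y (snd p) * a (fst p) y * ?i D y (snd p)) \<le> C" using 1[of B D] by simp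
    qed (use b in auto)
  qed
  have "?\<Phi> a b c = (\<Sum>p\<in>V \<times> V. (\<Sum>x\<in>V. u x (fst p) (snd p) * a x (fst p) * b x (snd p)) * c (fst p) (snd p))"
  proof -
    have "?\<Phi> a b c = (\<Sum>y\<in>V. \<Sum>x\<in>V. \<Sum>z\<in>V. u x y z * a x y * b x z * c y z)" by (rule sum.swap)
    also have "\<dots> = (\<Sum>y\<in>V. \<Sum>z\<in>V. \<Sum>x\<in>V. u x y z * a x y * b x z * c y z)" by (intro sum.cong refl sum.swap)
    finally show ?thesis
      by (subst pairs[of "\<lambda>y z. (\<Sum>x\<in>V. u x y z * a x y * b x z) * c y z"]) (simp add: sum_distrib_left sum_distrib_right ac_simps)
  qed
  also have "\<dots> \<le> C"
  proof (rule sum_weight_le[OF fin])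
    fix D assume D: "D \<subseteq> V \<times> V"
    have "(\<Sum>p\<in>D. \<Sum>x\<in>V. u x (fst p) (snd p) * a x (fst p) * b x (snd p))
       = (\<Sum>y\<in>V. \<Sum>z\<in>V. \<Sum>x\<in>V. u x y z * a x y * b x z * ?i D y z)"
      unfolding red[OF D] by (simp add: sum_distrib_left sum_distrib_right ac_simps)
    also have "\<dots> = (\<Sum>y\<in>V. \<Sum>x\<in>V. \<Sum>z\<in>V. u x y z * a x y * b x z * ?i D y z)" by (intro sum.cong refl sum.swap)
    also have "\<dots> = ?\<Phi> a b (?i D)" by (rule sum.swap)
    finally show "(\<Sum>p\<in>D. \<Sum>x\<in>V. u x (fst p) (snd p) * a x (fst p) * b x (snd p)) \<le> C" using 2[of D] by simp
  qed (use c in auto)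
  finally show ?thesis .
qed

lemma sum_weight3_abs_le:
  fixes u :: "'v \<Rightarrow> 'v \<Rightarrow> 'v \<Rightarrow> real"
  assumes V: "finite V"
    and C: "\<And>A B D. \<bar>\<Sum>x\<in>V. \<Sum>y\<in>V. \<Sum>z\<in>V. u x y z * of_bool ((x, y) \<in> A) * of_bool ((x, z) \<in> B) * of_bool ((y, z) \<in> D)\<bar> \<le> C"
    and a: "\<And>x y. 0 \<le> a x y \<and> a x y \<le> 1" and b: "\<And>x y. 0 \<le> b x y \<and> b x y \<le> 1" and c: "\<And>x y. 0 \<le> c x y \<and> c x y \<le> 1"
  shows "\<bar>\<Sum>x\<in>V. \<Sum>y\<in>V. \<Sum>z\<in>V. u x y z * a x y * b x z * c y z\<bar> \<le> C"
proof -
  have "(\<Sum>x\<in>V. \<Sum>y\<in>V. \<Sum>z\<in>V. u x y z * a x y * b x z * c y z) \<le> C"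
    by (rule sum_weight3_le[OF V _ a b c]) (use C abs_le_D1 in blast)
  moreover have "(\<Sum>x\<in>V. \<Sum>y\<in>V. \<Sum>z\<in>V. - u x y z * a x y * b x z * c y z) \<le> C"
    by (rule sum_weight3_le[OF V _ a b c]) (simp add: sum_negf abs_le_D2[OF C])
  ultimately show ?thesis by (simp add: sum_negf abs_le_iff)
qed

section \<open>Triangle removal\<close>

definition cell :: "('v \<Rightarrow> 'v \<Rightarrow> bool) \<Rightarrow> ('v \<times> 'v) set set \<Rightarrow> 'v \<Rightarrow> 'v \<Rightarrow> 'v \<Rightarrow> 'v \<Rightarrow> real" where
  "cell E S x y x' y' = of_bool (E x x' \<and> E y y' \<and> meet same S (x, y) (x', y'))"

lemma cell_bounds: "0 \<le> cell E S x y x' y' \<and> cell E S x y x' y' \<le> 1"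
  by (simp add: cell_def)

lemma good_pair_quasirandom:
  assumes "finite V" "good_pair V S E \<mu> \<eta> p0 x y" "0 \<le> p0"
  obtains p where "p0 \<le> p"
    "quasirandom \<eta> p {x'\<in>V. E x x'} {y'\<in>V. E y y'} (cell E S x y)"
proof -
  let ?X = "{x'\<in>V. E x x'}" and ?Y = "{y'\<in>V. E y y'}"
  obtain p where p: "p0 \<le> p" "p \<le> 1" and r: "regular \<eta> p ?X ?Y (\<lambda>x' y'. of_bool (meet same S (x, y) (x', y')))"
    using assms unfolding good_pair_def by blast
  have "regular \<eta> p ?X ?Y (cell E S x y)"
    using r unfolding regular_def cell_def by simp
  then show ?thesis using that[of p] p assms by (auto simp: quasirandom_def cell_bounds)
qed

text \<open>In the removal lemmas a bad face therefore spoils at most one member of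
  \<open>Q\<close>.\<close>

lemma card_preimage_le:
  assumes "inj_on \<pi> Q" "finite B"
  shows "card {q\<in>Q. \<pi> q \<in> B} \<le> card B"
  by (rule card_inj_on_le[of \<pi>]) (use assms in \<open>auto simp: inj_on_def\<close>)

lemma sum3_of_bool:
  assumes "finite A" "finite B" "finite C"
  shows "(\<Sum>x\<in>A. \<Sum>y\<in>B. \<Sum>z\<in>C. of_bool ((x, y, z) \<in> T)) = real (card (A \<times> B \<times> C \<inter> T))"
proof -
  have "(\<Sum>x\<in>A. \<Sum>y\<in>B. \<Sum>z\<in>C. of_bool ((x, y, z) \<in> T) :: real) = (\<Sum>t\<in>A \<times> B \<times> C. of_bool (t \<in> T))"
    by (simp add: sum.cartesian_product case_prod_unfold)
  also have "\<dots> = real (card (A \<times> B \<times> C \<inter> T))"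
    using assms by (simp add: of_bool_def sum.If_cases)
  finally show ?thesis .
qed

lemma sum4_of_bool:
  assumes "finite A" "finite B" "finite C" "finite D"
  shows "(\<Sum>x\<in>A. \<Sum>y\<in>B. \<Sum>z\<in>C. \<Sum>w\<in>D. of_bool ((x, y, z, w) \<in> T)) = real (card (A \<times> B \<times> C \<times> D \<inter> T))"
proof -
  have "(\<Sum>x\<in>A. \<Sum>y\<in>B. \<Sum>z\<in>C. \<Sum>w\<in>D. of_bool ((x, y, z, w) \<in> T) :: real) = (\<Sum>t\<in>A \<times> B \<times> C \<times> D. of_bool (t \<in> T))"
    by (simp add: sum.cartesian_product case_prod_unfold)
  also have "\<dots> = real (card (A \<times> B \<times> C \<times> D \<inter> T))"
    using assms by (simp add: of_bool_def sum.If_cases)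
  finally show ?thesis .
qed

text \<open>At most three quarters of \<open>Q\<close> project to a bad pair. Any other member lies
  in three dense regular cells contained in \<open>P\<close>, and these alone already span a
  positive proportion of all triples as triangles.\<close>

lemma triangle_removal:
  fixes \<delta> :: real
  assumes \<delta>: "\<delta> > 0"
  shows "\<exists>\<epsilon>>0. \<forall>(V :: 'v set) P Q. finite V \<longrightarrow> V \<noteq> {} \<longrightarrow> Q \<subseteq> V \<times> V \<times> V \<longrightarrow>
    (\<forall>x y z. (x, y, z) \<in> Q \<longrightarrow> (x, y) \<in> P \<and> (x, z) \<in> P \<and> (y, z) \<in> P) \<longrightarrow>
    inj_on (\<lambda>(x, y, z). (x, y)) Q \<longrightarrow> inj_on (\<lambda>(x, y, z). (x, z)) Q \<longrightarrow> inj_on (\<lambda>(x, y, z). (y, z)) Q \<longrightarrow>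
    \<delta> * real (card V) ^ 2 \<le> real (card Q) \<longrightarrow>
    \<epsilon> * real (card V) ^ 3 \<le> real (card {(x, y, z). x \<in> V \<and> y \<in> V \<and> z \<in> V \<and> (x, y) \<in> P \<and> (x, z) \<in> P \<and> (y, z) \<in> P})"
proof -
  define p0 where "p0 = (\<delta> / 4) / (4 * 2 ^ 1)"
  \<comment> \<open>Makes the error 5 \<eta> of the triangle count half of
    \<open>p0 ^ 3\<close>.\<close>
  define \<eta> where "\<eta> = p0 ^ 3 / 10"
  have p0: "p0 > 0" and \<eta>: "\<eta> > 0" using \<delta> by (auto simp: p0_def \<eta>_def)
  obtain \<mu> where \<mu>: "\<mu> > 0" and reg: "\<forall>(V :: 'v set) S. finite V \<longrightarrow> V \<noteq> {} \<longrightarrow> finite S \<longrightarrow> card S \<le> 1 \<longrightarrow>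
     (\<exists>E. equivp E \<and> real (card {q \<in> V \<times> V. \<not> good_pair V S E \<mu> \<eta> p0 (fst q) (snd q)}) \<le> \<delta> / 4 * (real (card V))\<^sup>2)"
    using pair_regularity[where 'v = 'v and \<epsilon> = "\<delta> / 4" and \<eta> = \<eta> and m = 1, folded p0_def] \<delta> \<eta> by auto
  show ?thesis
  proof (intro exI[of _ "p0 ^ 3 * \<mu> ^ 3 / 2"] conjI allI impI)
    show "p0 ^ 3 * \<mu> ^ 3 / 2 > 0" using p0 \<mu> by simp
    fix V :: "'v set" and P Q
    assume V: "finite V" "V \<noteq> {}" and Q: "Q \<subseteq> V \<times> V \<times> V"
      and QP: "\<forall>x y z. (x, y, z) \<in> Q \<longrightarrow> (x, y) \<in> P \<and> (x, z) \<in> P \<and> (y, z) \<in> P"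
      and inj: "inj_on (\<lambda>(x, y, z). (x, y)) Q" "inj_on (\<lambda>(x, y, z). (x, z)) Q" "inj_on (\<lambda>(x, y, z). (y, z)) Q"
      and large: "\<delta> * real (card V) ^ 2 \<le> real (card Q)"
    obtain E where E: "equivp E"
      and few: "real (card {q \<in> V \<times> V. \<not> good_pair V {P} E \<mu> \<eta> p0 (fst q) (snd q)}) \<le> \<delta> / 4 * (real (card V))\<^sup>2"
      using reg[rule_format, OF V, of "{P}"] by auto
    let ?B = "{q \<in> V \<times> V. \<not> good_pair V {P} E \<mu> \<eta> p0 (fst q) (snd q)}"
    have N: "real (card V) > 0" using V by (simp add: card_gt_0_iff)
    have fin: "finite ?B" "finite Q" using V Q finite_subset[OF Q] by auto
    have "\<exists>x y z. (x, y, z) \<in> Q \<and> (x, y) \<notin> ?B \<and> (x, z) \<notin> ?B \<and> (y, z) \<notin> ?B"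
    proof (rule ccontr)
      assume "\<not> ?thesis"
      then have "Q \<subseteq> {q\<in>Q. (\<lambda>(x, y, z). (x, y)) q \<in> ?B} \<union> ({q\<in>Q. (\<lambda>(x, y, z). (x, z)) q \<in> ?B} \<union> {q\<in>Q. (\<lambda>(x, y, z). (y, z)) q \<in> ?B})"
        by fastforce
      then have "card Q \<le> card ({q\<in>Q. (\<lambda>(x, y, z). (x, y)) q \<in> ?B} \<union> ({q\<in>Q. (\<lambda>(x, y, z). (x, z)) q \<in> ?B} \<union> {q\<in>Q. (\<lambda>(x, y, z). (y, z)) q \<in> ?B}))"
        using fin by (intro card_mono) auto
      also have "\<dots> \<le> card ?B + (card ?B + card ?B)"
        by (intro order_trans[OF card_Un_le] add_mono card_preimage_le inj fin)
      finally have "real (card Q) \<le> 3 * (\<delta> / 4 * (real (card V))\<^sup>2)" using few by simp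
      moreover have "\<delta> * (real (card V))\<^sup>2 > 0" using \<delta> N by simp
      ultimately show False using large by simp
    qed
    then obtain x y z where q: "(x, y, z) \<in> Q" and nb: "(x, y) \<notin> ?B" "(x, z) \<notin> ?B" "(y, z) \<notin> ?B" by blast
    have xyz: "x \<in> V" "y \<in> V" "z \<in> V" using q Q by auto
    then have good: "good_pair V {P} E \<mu> \<eta> p0 x y" "good_pair V {P} E \<mu> \<eta> p0 x z" "good_pair V {P} E \<mu> \<eta> p0 y z"
      using nb by auto
    let ?c = "\<lambda>x. {x'\<in>V. E x x'}" and ?w = "cell E {P}"
    obtain p12 where p12: "p0 \<le> p12" "quasirandom \<eta> p12 (?c x) (?c y) (?w x y)"
      using good_pair_quasirandom[OF V(1) good(1)] p0 by auto
    obtain p13 where p13: "p0 \<le> p13" "quasirandom \<eta> p13 (?c x) (?c z) (?w x z)"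
      using good_pair_quasirandom[OF V(1) good(2)] p0 by auto
    obtain p23 where p23: "p0 \<le> p23" "quasirandom \<eta> p23 (?c y) (?c z) (?w y z)"
      using good_pair_quasirandom[OF V(1) good(3)] p0 by auto
    let ?n = "real (card (?c x)) * real (card (?c y)) * real (card (?c z))"
    let ?T = "{(x, y, z). x \<in> V \<and> y \<in> V \<and> z \<in> V \<and> (x, y) \<in> P \<and> (x, z) \<in> P \<and> (y, z) \<in> P}"
    have "\<mu> * real (card V) * (\<mu> * real (card V)) * (\<mu> * real (card V)) \<le> ?n"
      using good \<mu> unfolding good_pair_def by (intro mult_mono) auto
    then have n: "\<mu> ^ 3 * real (card V) ^ 3 \<le> ?n" by (simp add: power3_eq_cube ac_simps)
    have "p0 * p0 * p0 \<le> p12 * p13 * p23" using p0 p12 p13 p23 by (intro mult_mono) auto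
    then have p: "p0 ^ 3 / 2 \<le> p12 * p13 * p23 - 5 * \<eta>" by (simp add: \<eta>_def power3_eq_cube)
    moreover have "0 < p0 ^ 3 / 2" using p0 by simp
    ultimately have p': "0 \<le> p12 * p13 * p23 - 5 * \<eta>" by linarith
    have "p0 ^ 3 / 2 * (\<mu> ^ 3 * real (card V) ^ 3) \<le> (p12 * p13 * p23 - 5 * \<eta>) * ?n"
      by (rule mult_mono[OF p n p']) (use \<mu> in simp)
    also have "\<dots> \<le> (\<Sum>x'\<in>?c x. \<Sum>y'\<in>?c y. \<Sum>z'\<in>?c z. ?w x y x' y' * ?w x z x' z' * ?w y z y' z')"
      using triangle_count[OF p12(2) p13(2) p23(2)] \<eta> by (simp add: abs_le_iff algebra_simps)
    \<comment> \<open>Since \<open>(x, y)\<close> itself belongs to \<open>P\<close>, its cell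
      consists of members of \<open>P\<close>; likewise for the other two pairs.\<close>
    also have "\<dots> \<le> (\<Sum>x'\<in>?c x. \<Sum>y'\<in>?c y. \<Sum>z'\<in>?c z. of_bool ((x', y', z') \<in> ?T))"
      using q QP by (intro sum_mono) (auto simp: cell_def meet_def same_def)
    also have "\<dots> = real (card (?c x \<times> ?c y \<times> ?c z \<inter> ?T))"
      by (rule sum3_of_bool) (use V in auto)
    also have "\<dots> \<le> real (card ?T)"
    proof -
      have "finite ?T" by (rule finite_subset[of _ "V \<times> V \<times> V"]) (use V in auto)
      then show ?thesis by (intro of_nat_mono card_mono) auto
    qed
    finally show "p0 ^ 3 * \<mu> ^ 3 / 2 * real (card V) ^ 3 \<le> real (card ?T)" by simp
  qed
qed

section \<open>Cut norm of functions of three vertices\<close>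

definition cut_small :: "'v set \<Rightarrow> real \<Rightarrow> ('v \<Rightarrow> 'v \<Rightarrow> 'v \<Rightarrow> real) \<Rightarrow> bool" where
  "cut_small V C u \<longleftrightarrow> (\<forall>a b c. (\<forall>x y. 0 \<le> a x y \<and> a x y \<le> 1) \<longrightarrow> (\<forall>x y. 0 \<le> b x y \<and> b x y \<le> 1) \<longrightarrow> (\<forall>x y. 0 \<le> c x y \<and> c x y \<le> 1) \<longrightarrow>
     \<bar>\<Sum>x\<in>V. \<Sum>y\<in>V. \<Sum>z\<in>V. u x y z * a x y * b x z * c y z\<bar> \<le> C)"

text \<open>For each fixed \<open>w\<close> the three factors are admissible pair weights, so the
  cut norm bound applies slice by slice.\<close>

lemma cut_small_slices:
  assumes "cut_small V C u"
    and "\<And>w x y. 0 \<le> a w x y \<and> a w x y \<le> 1" "\<And>w x y. 0 \<le> b w x y \<and> b w x y \<le> 1" "\<And>w x y. 0 \<le> c w x y \<and> c w x y \<le> 1"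
  shows "\<bar>\<Sum>w\<in>V. \<Sum>x\<in>V. \<Sum>y\<in>V. \<Sum>z\<in>V. u x y z * a w x y * b w x z * c w y z\<bar> \<le> C * real (card V)"
proof -
  have "\<bar>\<Sum>w\<in>V. \<Sum>x\<in>V. \<Sum>y\<in>V. \<Sum>z\<in>V. u x y z * a w x y * b w x z * c w y z\<bar> \<le> (\<Sum>w\<in>V. C)"
  proof (rule order_trans[OF sum_abs], rule sum_mono)
    show "\<bar>\<Sum>x\<in>V. \<Sum>y\<in>V. \<Sum>z\<in>V. u x y z * a w x y * b w x z * c w y z\<bar> \<le> C" for w
      using assms(1)[unfolded cut_small_def, rule_format, of "a w" "b w" "c w"] assms(2-4) by blast
  qed
  then show ?thesis by (simp add: mult.commute)
qed

lemma sum3_last_out: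
  "(\<Sum>x\<in>A. \<Sum>y\<in>B. \<Sum>z\<in>C. h x y z) = (\<Sum>z\<in>C. \<Sum>x\<in>A. \<Sum>y\<in>B. (h x y z :: real))"
proof -
  have "(\<Sum>x\<in>A. \<Sum>y\<in>B. \<Sum>z\<in>C. h x y z) = (\<Sum>x\<in>A. \<Sum>z\<in>C. \<Sum>y\<in>B. h x y z)"
    by (intro sum.cong refl sum.swap)
  also have "\<dots> = (\<Sum>z\<in>C. \<Sum>x\<in>A. \<Sum>y\<in>B. h x y z)" by (rule sum.swap)
  finally show ?thesis .
qed

lemma sum4_last_out:
  "(\<Sum>x\<in>A. \<Sum>y\<in>B. \<Sum>z\<in>C. \<Sum>w\<in>D. h x y z w) = (\<Sum>w\<in>D. \<Sum>x\<in>A. \<Sum>y\<in>B. \<Sum>z\<in>C. (h x y z w :: real))"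
proof -
  have "(\<Sum>x\<in>A. \<Sum>y\<in>B. \<Sum>z\<in>C. \<Sum>w\<in>D. h x y z w) = (\<Sum>x\<in>A. \<Sum>w\<in>D. \<Sum>y\<in>B. \<Sum>z\<in>C. h x y z w)"
    by (intro sum.cong refl sum3_last_out)
  also have "\<dots> = (\<Sum>w\<in>D. \<Sum>x\<in>A. \<Sum>y\<in>B. \<Sum>z\<in>C. h x y z w)" by (rule sum.swap)
  finally show ?thesis .
qed

lemma prod4_diff:
  fixes a b c d a' b' c' d' :: real
  shows "a * b * c * d - a' * b' * c' * d'
    = (a - a') * b * c * d + a' * (b - b') * c * d + a' * b' * (c - c') * d + a' * b' * c' * (d - d')"
  by (simp add: algebra_simps)

text \<open>Faces are exchanged one at a time. With the vertex opposite the current face held fixed,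
  every other face and every pair weight involves at most two of the three remaining vertices, so
  all of them merge into three pair weights. The telescoping mixes \<open>f\<close> and
  \<open>g\<close>, both with values in [0, 1].\<close>

lemma replace_faces:
  fixes w12 w13 w14 w23 w24 w34 :: "'v \<Rightarrow> 'v \<Rightarrow> real" and f123 f124 f134 f234 g123 g124 g134 g234 :: "'v \<Rightarrow> 'v \<Rightarrow> 'v \<Rightarrow> real"
  assumes w: "\<And>x y. 0 \<le> w12 x y \<and> w12 x y \<le> 1" "\<And>x y. 0 \<le> w13 x y \<and> w13 x y \<le> 1" "\<And>x y. 0 \<le> w14 x y \<and> w14 x y \<le> 1"
      "\<And>x y. 0 \<le> w23 x y \<and> w23 x y \<le> 1" "\<And>x y. 0 \<le> w24 x y \<and> w24 x y \<le> 1" "\<And>x y. 0 \<le> w34 x y \<and> w34 x y \<le> 1"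
    and f: "\<And>x y z. 0 \<le> f124 x y z \<and> f124 x y z \<le> 1" "\<And>x y z. 0 \<le> f134 x y z \<and> f134 x y z \<le> 1" "\<And>x y z. 0 \<le> f234 x y z \<and> f234 x y z \<le> 1"
    and g: "\<And>x y z. 0 \<le> g123 x y z \<and> g123 x y z \<le> 1" "\<And>x y z. 0 \<le> g124 x y z \<and> g124 x y z \<le> 1" "\<And>x y z. 0 \<le> g134 x y z \<and> g134 x y z \<le> 1"
    and u: "cut_small V C (\<lambda>x y z. f123 x y z - g123 x y z)" "cut_small V C (\<lambda>x y z. f124 x y z - g124 x y z)"
      "cut_small V C (\<lambda>x y z. f134 x y z - g134 x y z)" "cut_small V C (\<lambda>x y z. f234 x y z - g234 x y z)"
  shows "(\<Sum>x1\<in>V. \<Sum>x2\<in>V. \<Sum>x3\<in>V. \<Sum>x4\<in>V.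
         w12 x1 x2 * w13 x1 x3 * w23 x2 x3 * (w14 x1 x4 * w24 x2 x4 * w34 x3 x4) *
         (g123 x1 x2 x3 * g124 x1 x2 x4 * g134 x1 x3 x4 * g234 x2 x3 x4)) - 4 * C * real (card V)
    \<le> (\<Sum>x1\<in>V. \<Sum>x2\<in>V. \<Sum>x3\<in>V. \<Sum>x4\<in>V.
         w12 x1 x2 * w13 x1 x3 * w23 x2 x3 * (w14 x1 x4 * w24 x2 x4 * w34 x3 x4) *
         (f123 x1 x2 x3 * f124 x1 x2 x4 * f134 x1 x3 x4 * f234 x2 x3 x4))"
proof -
  let ?W = "\<lambda>x1 x2 x3 x4. w12 x1 x2 * w13 x1 x3 * w23 x2 x3 * (w14 x1 x4 * w24 x2 x4 * w34 x3 x4)"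
  let ?S = "\<lambda>h. \<Sum>x1\<in>V. \<Sum>x2\<in>V. \<Sum>x3\<in>V. \<Sum>x4\<in>V. h x1 x2 x3 x4 :: real"
  have m: "0 \<le> a * b \<and> a * b \<le> 1" if "0 \<le> a \<and> a \<le> 1" "0 \<le> b \<and> b \<le> 1" for a b :: real
    using that by (simp add: mult_le_one)
  have 1: "\<bar>?S (\<lambda>x1 x2 x3 x4. ?W x1 x2 x3 x4 * ((f123 x1 x2 x3 - g123 x1 x2 x3) * f124 x1 x2 x4 * f134 x1 x3 x4 * f234 x2 x3 x4))\<bar> \<le> C * real (card V)"
  proof -
    have "?S (\<lambda>x1 x2 x3 x4. ?W x1 x2 x3 x4 * ((f123 x1 x2 x3 - g123 x1 x2 x3) * f124 x1 x2 x4 * f134 x1 x3 x4 * f234 x2 x3 x4))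
      = (\<Sum>x4\<in>V. \<Sum>x1\<in>V. \<Sum>x2\<in>V. \<Sum>x3\<in>V. (f123 x1 x2 x3 - g123 x1 x2 x3) * (w12 x1 x2 * w14 x1 x4 * w24 x2 x4 * f124 x1 x2 x4)
         * (w13 x1 x3 * w34 x3 x4 * f134 x1 x3 x4) * (w23 x2 x3 * f234 x2 x3 x4))"
      by (rule trans[OF sum4_last_out], intro sum.cong refl) (simp only: mult_ac)
    also have "\<bar>\<dots>\<bar> \<le> C * real (card V)"
      by (rule cut_small_slices[OF u(1)]) (intro m w f)+
    finally show ?thesis .
  qed
  have 2: "\<bar>?S (\<lambda>x1 x2 x3 x4. ?W x1 x2 x3 x4 * (g123 x1 x2 x3 * (f124 x1 x2 x4 - g124 x1 x2 x4) * f134 x1 x3 x4 * f234 x2 x3 x4))\<bar> \<le> C * real (card V)"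
  proof -
    have "?S (\<lambda>x1 x2 x3 x4. ?W x1 x2 x3 x4 * (g123 x1 x2 x3 * (f124 x1 x2 x4 - g124 x1 x2 x4) * f134 x1 x3 x4 * f234 x2 x3 x4))
      = (\<Sum>x3\<in>V. \<Sum>x1\<in>V. \<Sum>x2\<in>V. \<Sum>x4\<in>V. (f124 x1 x2 x4 - g124 x1 x2 x4) * (w12 x1 x2 * w13 x1 x3 * w23 x2 x3 * g123 x1 x2 x3)
         * (w14 x1 x4 * w34 x3 x4 * f134 x1 x3 x4) * (w24 x2 x4 * f234 x2 x3 x4))"
      by (rule trans[OF sum3_last_out], intro sum.cong refl) (simp only: mult_ac)
    also have "\<bar>\<dots>\<bar> \<le> C * real (card V)"
      by (rule cut_small_slices[OF u(2)]) (intro m w f g)+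
    finally show ?thesis .
  qed
  have 3: "\<bar>?S (\<lambda>x1 x2 x3 x4. ?W x1 x2 x3 x4 * (g123 x1 x2 x3 * g124 x1 x2 x4 * (f134 x1 x3 x4 - g134 x1 x3 x4) * f234 x2 x3 x4))\<bar> \<le> C * real (card V)"
  proof -
    have "?S (\<lambda>x1 x2 x3 x4. ?W x1 x2 x3 x4 * (g123 x1 x2 x3 * g124 x1 x2 x4 * (f134 x1 x3 x4 - g134 x1 x3 x4) * f234 x2 x3 x4))
      = (\<Sum>x2\<in>V. \<Sum>x1\<in>V. \<Sum>x3\<in>V. \<Sum>x4\<in>V. (f134 x1 x3 x4 - g134 x1 x3 x4) * (w12 x1 x2 * w13 x1 x3 * w23 x2 x3 * g123 x1 x2 x3)
         * (w14 x1 x4 * w24 x2 x4 * g124 x1 x2 x4) * (w34 x3 x4 * f234 x2 x3 x4))"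
      by (rule trans[OF sum.swap], intro sum.cong refl) (simp only: mult_ac)
    also have "\<bar>\<dots>\<bar> \<le> C * real (card V)"
      by (rule cut_small_slices[OF u(3)]) (intro m w f g)+
    finally show ?thesis .
  qed
  have 4: "\<bar>?S (\<lambda>x1 x2 x3 x4. ?W x1 x2 x3 x4 * (g123 x1 x2 x3 * g124 x1 x2 x4 * g134 x1 x3 x4 * (f234 x2 x3 x4 - g234 x2 x3 x4)))\<bar> \<le> C * real (card V)"
  proof -
    have "?S (\<lambda>x1 x2 x3 x4. ?W x1 x2 x3 x4 * (g123 x1 x2 x3 * g124 x1 x2 x4 * g134 x1 x3 x4 * (f234 x2 x3 x4 - g234 x2 x3 x4)))
      = (\<Sum>x1\<in>V. \<Sum>x2\<in>V. \<Sum>x3\<in>V. \<Sum>x4\<in>V. (f234 x2 x3 x4 - g234 x2 x3 x4) * (w12 x1 x2 * w13 x1 x3 * w23 x2 x3 * g123 x1 x2 x3)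
         * (w14 x1 x4 * w24 x2 x4 * g124 x1 x2 x4) * (w34 x3 x4 * g134 x1 x3 x4))"
      by (intro sum.cong refl) (simp only: mult_ac)
    also have "\<bar>\<dots>\<bar> \<le> C * real (card V)"
      by (rule cut_small_slices[OF u(4)]) (intro m w f g)+
    finally show ?thesis .
  qed
  have "?S (\<lambda>x1 x2 x3 x4. ?W x1 x2 x3 x4 * (f123 x1 x2 x3 * f124 x1 x2 x4 * f134 x1 x3 x4 * f234 x2 x3 x4))
      - ?S (\<lambda>x1 x2 x3 x4. ?W x1 x2 x3 x4 * (g123 x1 x2 x3 * g124 x1 x2 x4 * g134 x1 x3 x4 * g234 x2 x3 x4))
    = ?S (\<lambda>x1 x2 x3 x4. ?W x1 x2 x3 x4 * ((f123 x1 x2 x3 - g123 x1 x2 x3) * f124 x1 x2 x4 * f134 x1 x3 x4 * f234 x2 x3 x4))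
    + ?S (\<lambda>x1 x2 x3 x4. ?W x1 x2 x3 x4 * (g123 x1 x2 x3 * (f124 x1 x2 x4 - g124 x1 x2 x4) * f134 x1 x3 x4 * f234 x2 x3 x4))
    + ?S (\<lambda>x1 x2 x3 x4. ?W x1 x2 x3 x4 * (g123 x1 x2 x3 * g124 x1 x2 x4 * (f134 x1 x3 x4 - g134 x1 x3 x4) * f234 x2 x3 x4))
    + ?S (\<lambda>x1 x2 x3 x4. ?W x1 x2 x3 x4 * (g123 x1 x2 x3 * g124 x1 x2 x4 * g134 x1 x3 x4 * (f234 x2 x3 x4 - g234 x2 x3 x4)))"
    unfolding sum_subtractf[symmetric] sum.distrib[symmetric] right_diff_distrib[symmetric] distrib_left[symmetric]
    by (intro sum.cong refl arg_cong[of _ _ "(*) _"]) (rule prod4_diff)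
  then show ?thesis using 1 2 3 4 by (simp only: abs_le_iff) linarith
qed

section \<open>Simplex removal\<close>

definition same_triple :: "('v \<times> 'v) set \<Rightarrow> 'v \<times> 'v \<times> 'v \<Rightarrow> 'v \<times> 'v \<times> 'v \<Rightarrow> bool" where
  "same_triple s = (\<lambda>(x, y, z) (x', y', z'). same s (x, y) (x', y') \<and> same s (x, z) (x', z') \<and> same s (y, z) (y', z'))"

lemma equivp_same_triple: "equivp (same_triple s)"
  by (intro equivpI reflpI sympI transpI) (auto simp: same_triple_def same_def)

lemma meet_same_triple:
  "meet same_triple S (x, y, z) (x', y', z') \<longleftrightarrow>
    meet same S (x, y) (x', y') \<and> meet same S (x, z) (x', z') \<and> meet same S (y, z) (y', z')"
  by (auto simp: meet_def same_triple_def)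

text \<open>The polyad (or triad) of hypergraph regularity: three vertex classes with one cell of
  pairs between any two of them, named by a triple it contains.\<close>

definition polyad :: "('v \<Rightarrow> 'v \<Rightarrow> bool) \<Rightarrow> ('v \<times> 'v) set set \<Rightarrow> 'v \<times> 'v \<times> 'v \<Rightarrow> 'v \<times> 'v \<times> 'v \<Rightarrow> bool" where
  "polyad E S t t' \<longleftrightarrow> E (fst t) (fst t') \<and> E (fst (snd t)) (fst (snd t')) \<and> E (snd (snd t)) (snd (snd t')) \<and>
     meet same_triple S t t'"

lemma equivp_polyad:
  assumes "equivp E"
  shows "equivp (polyad E S)"
proof -
  have m: "equivp (meet same_triple S)" by (intro equivp_meet equivp_same_triple)
  show ?thesis
  proof (intro equivpI reflpI sympI transpI)
    show "polyad E S x x" for x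
      using equivp_reflp[OF assms] equivp_reflp[OF m] by (simp add: polyad_def)
    show "polyad E S y x" if "polyad E S x y" for x y
      using that equivp_symp[OF assms] equivp_symp[OF m] by (simp add: polyad_def)
    show "polyad E S x z" if xy: "polyad E S x y" and yz: "polyad E S y z" for x y z
      unfolding polyad_def
      using xy[unfolded polyad_def] yz[unfolded polyad_def] by (intro conjI) (blast intro: equivp_transp[OF assms] equivp_transp[OF m])+
  qed
qed

lemma sum3_product: "(\<Sum>x\<in>A. \<Sum>y\<in>B. \<Sum>z\<in>C. f (x, y, z)) = (\<Sum>t\<in>A \<times> B \<times> C. f t)"
  by (simp add: sum.cartesian_product split_def)

text \<open>The product of the three cell indicators is the indicator of the polyad.\<close>

lemma sum_polyad:
  fixes h :: "'v \<times> 'v \<times> 'v \<Rightarrow> real"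
  assumes V: "finite V"
  shows "(\<Sum>t | t \<in> V \<times> V \<times> V \<and> polyad E S (x, y, z) t. h t)
    = (\<Sum>x'\<in>{x'\<in>V. E x x'}. \<Sum>y'\<in>{y'\<in>V. E y y'}. \<Sum>z'\<in>{z'\<in>V. E z z'}.
        cell E S x y x' y' * cell E S x z x' z' * cell E S y z y' z' * h (x', y', z'))"
proof -
  let ?A = "{x'\<in>V. E x x'}" and ?B = "{y'\<in>V. E y y'}" and ?C = "{z'\<in>V. E z z'}"
  have "(\<Sum>x'\<in>?A. \<Sum>y'\<in>?B. \<Sum>z'\<in>?C. cell E S x y x' y' * cell E S x z x' z' * cell E S y z y' z' * h (x', y', z'))
     = (\<Sum>x'\<in>?A. \<Sum>y'\<in>?B. \<Sum>z'\<in>?C. if polyad E S (x, y, z) (x', y', z') then h (x', y', z') else 0)"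
    by (intro sum.cong refl) (auto simp: cell_def polyad_def meet_same_triple)
  also have "\<dots> = (\<Sum>t\<in>?A \<times> ?B \<times> ?C. if polyad E S (x, y, z) t then h t else 0)"
    by (rule sum3_product)
  also have "\<dots> = (\<Sum>t | t \<in> ?A \<times> ?B \<times> ?C \<and> polyad E S (x, y, z) t. h t)"
    by (rule sum.inter_filter[symmetric]) (use V in auto)
  also have "{t. t \<in> ?A \<times> ?B \<times> ?C \<and> polyad E S (x, y, z) t} = {t. t \<in> V \<times> V \<times> V \<and> polyad E S (x, y, z) t}"
    by (auto simp: polyad_def)
  finally show ?thesis by simp
qed

text \<open>Clears the denominator of an averaged deviation. The density \<open>s\<close> is
  constant on the polyad because a polyad lies inside one class of
  \<open>meet same_triple S\<close>.\<close>

lemma polyad_error: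
  assumes V: "finite V" and E: "equivp E" and t: "x \<in> V" "y \<in> V" "z \<in> V"
    and small: "cexp (V \<times> V \<times> V) (polyad E S) (\<lambda>t. \<bar>g t - s t\<bar>) (x, y, z) \<le> \<kappa>"
    and s: "\<And>t t'. meet same_triple S t t' \<Longrightarrow> s t' = s t"
  shows "(\<Sum>x'\<in>{x'\<in>V. E x x'}. \<Sum>y'\<in>{y'\<in>V. E y y'}. \<Sum>z'\<in>{z'\<in>V. E z z'}.
        cell E S x y x' y' * cell E S x z x' z' * cell E S y z y' z' * \<bar>g (x', y', z') - s (x, y, z)\<bar>)
    \<le> \<kappa> * (\<Sum>x'\<in>{x'\<in>V. E x x'}. \<Sum>y'\<in>{y'\<in>V. E y y'}. \<Sum>z'\<in>{z'\<in>V. E z z'}.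
        cell E S x y x' y' * cell E S x z x' z' * cell E S y z y' z')"
proof -
  let ?R = "{t. t \<in> V \<times> V \<times> V \<and> polyad E S (x, y, z) t}"
  have "(x, y, z) \<in> ?R" using t equivp_reflp[OF equivp_polyad[OF E]] by auto
  moreover have fin: "finite ?R" by (rule finite_subset[of _ "V \<times> V \<times> V"]) (use V in auto)
  ultimately have c: "real (card ?R) > 0" by (auto simp: card_gt_0_iff)
  have "(\<Sum>t\<in>?R. \<bar>g t - s (x, y, z)\<bar>) = (\<Sum>t\<in>?R. \<bar>g t - s t\<bar>)"
    by (intro sum.cong refl) (use s in \<open>auto simp: polyad_def\<close>)
  also have "\<dots> \<le> \<kappa> * real (card ?R)"
    using small c by (simp add: cexp_def divide_le_eq)
  also have "real (card ?R) = (\<Sum>t\<in>?R. 1)" by simp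
  finally show ?thesis
    unfolding sum_polyad[OF V, where h = "\<lambda>t. \<bar>g t - s (x, y, z)\<bar>"] sum_polyad[OF V, where h = "\<lambda>_. 1"] by simp
qed

text \<open>By multilinearity 0/1 pair weights suffice, and the triangle set of three graphs is
  saturated for the partition that these graphs generate.\<close>

lemma cut_small_if_uniform:
  fixes F :: "'j \<Rightarrow> 'v \<times> 'v \<times> 'v \<Rightarrow> real"
  assumes V: "finite V" and uni: "uniform (V \<times> V \<times> V) J F same_triple S \<tau>" and j: "j \<in> J"
  shows "cut_small V (\<tau> * real (card V) ^ 3) (\<lambda>x y z. F j (x, y, z) - cexp (V \<times> V \<times> V) (meet same_triple S) (F j) (x, y, z))"
  unfolding cut_small_def
proof (intro allI impI)
  fix a b c :: "'v \<Rightarrow> 'v \<Rightarrow> real"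
  assume abc: "\<forall>x y. 0 \<le> a x y \<and> a x y \<le> 1" "\<forall>x y. 0 \<le> b x y \<and> b x y \<le> 1" "\<forall>x y. 0 \<le> c x y \<and> c x y \<le> 1"
  let ?\<Omega> = "V \<times> V \<times> V"
  let ?u = "\<lambda>t. F j t - cexp ?\<Omega> (meet same_triple S) (F j) t"
  show "\<bar>\<Sum>x\<in>V. \<Sum>y\<in>V. \<Sum>z\<in>V. ?u (x, y, z) * a x y * b x z * c y z\<bar> \<le> \<tau> * real (card V) ^ 3"
  proof (rule sum_weight3_abs_le[OF V])
    fix A B D :: "('v \<times> 'v) set"
    let ?T = "{(x, y, z). x \<in> V \<and> y \<in> V \<and> z \<in> V \<and> (x, y) \<in> A \<and> (x, z) \<in> B \<and> (y, z) \<in> D}"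
    have "(\<Sum>x\<in>V. \<Sum>y\<in>V. \<Sum>z\<in>V. ?u (x, y, z) * of_bool ((x, y) \<in> A) * of_bool ((x, z) \<in> B) * of_bool ((y, z) \<in> D))
       = (\<Sum>x\<in>V. \<Sum>y\<in>V. \<Sum>z\<in>V. if (x, y, z) \<in> ?T then ?u (x, y, z) else 0)"
      by (intro sum.cong refl) auto
    also have "\<dots> = (\<Sum>t\<in>?\<Omega>. if t \<in> ?T then ?u t else 0)"
      by (rule sum3_product)
    also have "\<dots> = (\<Sum>t\<in>?\<Omega> \<inter> ?T. ?u t)"
      by (rule sum.inter_restrict[symmetric]) (use V in auto)
    also have "?\<Omega> \<inter> ?T = ?T" by auto
    also have "\<bar>\<Sum>t\<in>?T. ?u t\<bar> \<le> \<tau> * real (card ?\<Omega>)"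
    proof (rule uni[unfolded uniform_def, rule_format, OF j, of "{A, B, D}"])
      show "card {A, B, D} \<le> 3" by (simp add: card_insert_if)
    qed (auto simp: meet_def same_triple_def same_def)
    also have "\<dots> = \<tau> * real (card V) ^ 3" by (simp add: card_cartesian_product power3_eq_cube)
    finally show "\<bar>\<Sum>x\<in>V. \<Sum>y\<in>V. \<Sum>z\<in>V. ?u (x, y, z) * of_bool ((x, y) \<in> A) * of_bool ((x, z) \<in> B) * of_bool ((y, z) \<in> D)\<bar>
      \<le> \<tau> * real (card V) ^ 3" .
  qed (use abc in auto)
qed

lemma sum4_supported:
  fixes h :: "'v \<Rightarrow> 'v \<Rightarrow> 'v \<Rightarrow> 'v \<Rightarrow> real"
  assumes "finite V" "X1 \<subseteq> V" "X2 \<subseteq> V" "X3 \<subseteq> V" "X4 \<subseteq> V"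
    and 0: "\<And>x1 x2 x3 x4. x1 \<in> V \<Longrightarrow> x2 \<in> V \<Longrightarrow> x3 \<in> V \<Longrightarrow> x4 \<in> V \<Longrightarrow>
      x1 \<notin> X1 \<or> x2 \<notin> X2 \<or> x3 \<notin> X3 \<or> x4 \<notin> X4 \<Longrightarrow> h x1 x2 x3 x4 = 0"
  shows "(\<Sum>x1\<in>V. \<Sum>x2\<in>V. \<Sum>x3\<in>V. \<Sum>x4\<in>V. h x1 x2 x3 x4) = (\<Sum>x1\<in>X1. \<Sum>x2\<in>X2. \<Sum>x3\<in>X3. \<Sum>x4\<in>X4. h x1 x2 x3 x4)"
proof -
  have "(\<Sum>x1\<in>V. \<Sum>x2\<in>V. \<Sum>x3\<in>V. \<Sum>x4\<in>V. h x1 x2 x3 x4) = (\<Sum>(x1, x2, x3, x4)\<in>V \<times> V \<times> V \<times> V. h x1 x2 x3 x4)"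
    by (simp add: sum.cartesian_product)
  also have "\<dots> = (\<Sum>(x1, x2, x3, x4)\<in>X1 \<times> X2 \<times> X3 \<times> X4. h x1 x2 x3 x4)"
  proof (rule sum.mono_neutral_right)
    show "\<forall>t\<in>V \<times> V \<times> V \<times> V - X1 \<times> X2 \<times> X3 \<times> X4. (case t of (x1, x2, x3, x4) \<Rightarrow> h x1 x2 x3 x4) = 0"
    proof
      fix t assume t: "t \<in> V \<times> V \<times> V \<times> V - X1 \<times> X2 \<times> X3 \<times> X4"
      obtain x1 x2 x3 x4 where "t = (x1, x2, x3, x4)" by (cases t)
      then show "(case t of (x1, x2, x3, x4) \<Rightarrow> h x1 x2 x3 x4) = 0" using t 0[of x1 x2 x3 x4] by auto
    qed
  qed (use assms(1-5) in auto)
  also have "\<dots> = (\<Sum>x1\<in>X1. \<Sum>x2\<in>X2. \<Sum>x3\<in>X3. \<Sum>x4\<in>X4. h x1 x2 x3 x4)"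
    by (simp add: sum.cartesian_product)
  finally show ?thesis .
qed

text \<open>The index is the position of the omitted coordinate, and every index beyond 2 gives the
  last face. Numbering the faces lets all four be regularised as one family.\<close>

definition simplex_faces :: "('v \<times> 'v \<times> 'v \<times> 'v) set \<Rightarrow> nat \<Rightarrow> ('v \<times> 'v \<times> 'v) set" where
  "simplex_faces Q j = (if j = 0 then (\<lambda>(x, y, z, w). (y, z, w)) ` Q else if j = 1 then (\<lambda>(x, y, z, w). (x, z, w)) ` Q
     else if j = 2 then (\<lambda>(x, y, z, w). (x, y, w)) ` Q else (\<lambda>(x, y, z, w). (x, y, z)) ` Q)"

lemma card_bad_triples:
  assumes V: "finite V" and B: "real (card {q \<in> V \<times> V. \<not> P (fst q) (snd q)}) \<le> \<epsilon> * (real (card V))\<^sup>2"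
  shows "real (card {(x, y, z). x \<in> V \<and> y \<in> V \<and> z \<in> V \<and> \<not> (P x y \<and> P x z \<and> P y z)}) \<le> 3 * \<epsilon> * real (card V) ^ 3"
proof -
  let ?B = "{q \<in> V \<times> V. \<not> P (fst q) (snd q)}"
  let ?f = "\<lambda>(p, v). (fst p, snd p, v)" and ?g = "\<lambda>(p, v). (fst p, v, snd p)" and ?h = "\<lambda>(p, v). (v, fst p, snd p)"
  have fin: "finite (?B \<times> V)" using V by simp
  have "{(x, y, z). x \<in> V \<and> y \<in> V \<and> z \<in> V \<and> \<not> (P x y \<and> P x z \<and> P y z)} \<subseteq> ?f ` (?B \<times> V) \<union> (?g ` (?B \<times> V) \<union> ?h ` (?B \<times> V))"
    (is "?L \<subseteq> _")
  proof
    fix t assume "t \<in> ?L"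
    then obtain x y z where t: "t = (x, y, z)" "x \<in> V" "y \<in> V" "z \<in> V" "\<not> P x y \<or> \<not> P x z \<or> \<not> P y z" by auto
    consider "\<not> P x y" | "\<not> P x z" | "\<not> P y z" using t by blast
    then show "t \<in> ?f ` (?B \<times> V) \<union> (?g ` (?B \<times> V) \<union> ?h ` (?B \<times> V))"
    proof cases
      case 1
      then have "t \<in> ?f ` (?B \<times> V)" using t by (intro image_eqI[of _ _ "((x, y), z)"]) auto
      then show ?thesis by blast
    next
      case 2
      then have "t \<in> ?g ` (?B \<times> V)" using t by (intro image_eqI[of _ _ "((x, z), y)"]) auto
      then show ?thesis by blast
    next
      case 3
      then have "t \<in> ?h ` (?B \<times> V)" using t by (intro image_eqI[of _ _ "((y, z), x)"]) auto
      then show ?thesis by blast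
    qed
  qed
  then have "card ?L \<le> card (?f ` (?B \<times> V) \<union> (?g ` (?B \<times> V) \<union> ?h ` (?B \<times> V)))"
    using fin by (intro card_mono) auto
  also have "\<dots> \<le> card (?B \<times> V) + (card (?B \<times> V) + card (?B \<times> V))"
    by (intro order_trans[OF card_Un_le] add_mono card_image_le fin)
  finally have "card ?L \<le> 3 * (card ?B * card V)" unfolding card_cartesian_product by linarith
  then have "real (card ?L) \<le> real (3 * (card ?B * card V))" by (rule of_nat_mono)
  also have "\<dots> = 3 * (real (card ?B) * real (card V))" by simp
  also have "\<dots> \<le> 3 * (\<epsilon> * (real (card V))\<^sup>2 * real (card V))"
    using B by (intro mult_left_mono mult_right_mono) auto
  finally show ?thesis by (simp add: power2_eq_square power3_eq_cube)
qed

text \<open>Members of \<open>Q\<close> share no face in the same position, so discarding those with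
  a bad face leaves one whose faces all lie in dense, well-approximated polyads. Around it there are
  more than \<open>n ^ 3\<close> simplices for large \<open>n\<close>, whereas \<open>card Q\<close>
  is at most \<open>n ^ 3\<close>; some simplex is thus new.\<close>

lemma simplex_removal:
  fixes \<delta> :: real
  assumes \<delta>: "\<delta> > 0"
  shows "\<exists>n0. \<forall>(V :: 'v set) Q. finite V \<longrightarrow> n0 \<le> card V \<longrightarrow> Q \<subseteq> V \<times> V \<times> V \<times> V \<longrightarrow>
    inj_on (\<lambda>(x, y, z, w). (x, y, z)) Q \<longrightarrow> inj_on (\<lambda>(x, y, z, w). (x, y, w)) Q \<longrightarrow>
    inj_on (\<lambda>(x, y, z, w). (x, z, w)) Q \<longrightarrow> inj_on (\<lambda>(x, y, z, w). (y, z, w)) Q \<longrightarrow>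
    \<delta> * real (card V) ^ 3 \<le> real (card Q) \<longrightarrow>
    (\<exists>x y z w. (x, y, z, w) \<notin> Q \<and> (y, z, w) \<in> simplex_faces Q 0 \<and> (x, z, w) \<in> simplex_faces Q 1 \<and>
       (x, y, w) \<in> simplex_faces Q 2 \<and> (x, y, z) \<in> simplex_faces Q 3)"
proof -
  \<comment> \<open>Budget for one face: \<delta> / 32 for low coarse density, \<delta> / 32 for a
    deviation above \<kappa>, and 3 \<epsilon> = 3 \<delta> / 128 for a pair that is not good. Over
    four faces this is 11 \<delta> / 32, below \<delta>. With these \<kappa> and
    \<open>\<eta> m\<close> the coefficient in \<open>simplex_count\<close> becomes
    \<open>d ^ 4 * p0 m ^ 6 / 4\<close>.\<close>
  define d where "d = min (\<delta> / 32) 1"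
  define \<kappa> where "\<kappa> = d ^ 4 / 8"
  define \<epsilon> where "\<epsilon> = \<delta> / 128"
  define p0 where "p0 m = \<epsilon> / (4 * 2 ^ m)" for m :: nat
  define \<eta> where "\<eta> m = d ^ 4 * p0 m ^ 6 / 220" for m
  define q where "q = \<kappa> * \<delta> / 32"
  have d: "0 < d" "d \<le> 1" "d \<le> \<delta> / 32" using \<delta> by (auto simp: d_def)
  have \<kappa>: "0 < \<kappa>" "4 * \<kappa> \<le> d ^ 4" using d by (auto simp: \<kappa>_def)
  have \<epsilon>: "0 < \<epsilon>" using \<delta> by (simp add: \<epsilon>_def)
  have p0: "0 < p0 m" for m using \<epsilon> by (simp add: p0_def)
  have \<eta>: "0 < \<eta> m" for m using d p0[of m] by (simp add: \<eta>_def)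
  have q: "0 < q" using \<kappa> \<delta> by (simp add: q_def)
  let ?reg = "\<lambda>m \<mu>. \<forall>(V :: 'v set) S. finite V \<longrightarrow> V \<noteq> {} \<longrightarrow> finite S \<longrightarrow> card S \<le> m \<longrightarrow>
     (\<exists>E. equivp E \<and> real (card {q \<in> V \<times> V. \<not> good_pair V S E \<mu> (\<eta> m) (p0 m) (fst q) (snd q)}) \<le> \<epsilon> * (real (card V))\<^sup>2)"
  \<comment> \<open>Having \<mu> as a function of \<open>m\<close> permits the tolerance
    \<open>t\<close> to anticipate the class sizes before the pair partition \<open>S\<close> is
    known.\<close>
  have "\<forall>m. \<exists>\<mu>>0. ?reg m \<mu>"
    unfolding p0_def by (intro allI pair_regularity \<epsilon> \<eta>)
  from choice[OF this] obtain \<mu> where \<mu>_reg: "\<forall>m. 0 < \<mu> m \<and> ?reg m (\<mu> m)" by (elim exE)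
  have \<mu>: "0 < \<mu> m" for m using \<mu>_reg by (elim allE[of _ m]) (elim conjE)
  have reg: "?reg m (\<mu> m)" for m using \<mu>_reg by (elim allE[of _ m]) (elim conjE)
  \<comment> \<open>The main term of the count is at least \<open>2 * c m * n ^ 4\<close>, and
    exchanging the four faces costs \<open>4 * t m * n ^ 4\<close>; half of the main term
    remains.\<close>
  define c where "c m = d ^ 4 * p0 m ^ 6 * \<mu> m ^ 4 / 8" for m
  define t where "t m = c m / 4" for m
  have c: "0 < c m" for m using d p0[of m] \<mu>[of m] by (simp add: c_def)
  have t: "0 < t m" for m using c[of m] by (simp add: t_def)
  obtain M where M: "\<forall>(\<Omega> :: ('v \<times> 'v \<times> 'v) set) (J :: nat set) f (r :: ('v \<times> 'v) set \<Rightarrow> _).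
     bounded_system 4 \<Omega> J f r \<longrightarrow> regularizable t (q\<^sup>2) M \<Omega> J f r"
    using strong_regularity[where 'b = "('v \<times> 'v) set" and 'w = "'v \<times> 'v \<times> 'v" and 'j = nat and K = 4 and t = t and d = "q\<^sup>2", OF t zero_less_power[OF q]] by blast
  \<comment> \<open>About \<open>m\<close> only \<open>m \<le> M\<close> is known in advance; the
    sum dominates every \<open>1 / c m\<close> that can occur.\<close>
  define n0 where "n0 = Suc (nat \<lceil>\<Sum>m\<le>M. 1 / c m\<rceil>)"
  have n0: "1 < c m * real n" if "m \<le> M" "n0 \<le> n" for m n
  proof -
    have "1 / c m \<le> (\<Sum>m\<le>M. 1 / c m)"
      by (rule member_le_sum) (use that c in \<open>auto intro: less_imp_le\<close>)
    also have "\<dots> < real n0" unfolding n0_def by linarith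
    also have "\<dots> \<le> real n" using that by simp
    finally show ?thesis using c[of m] by (simp add: field_simps)
  qed
  show ?thesis
  proof (intro exI[of _ n0] allI impI)
    fix V :: "'v set" and Q
    assume V: "finite V" and n: "n0 \<le> card V" and QV: "Q \<subseteq> V \<times> V \<times> V \<times> V"
      and inj: "inj_on (\<lambda>(x, y, z, w). (x, y, z)) Q" "inj_on (\<lambda>(x, y, z, w). (x, y, w)) Q"
        "inj_on (\<lambda>(x, y, z, w). (x, z, w)) Q" "inj_on (\<lambda>(x, y, z, w). (y, z, w)) Q"
      and large: "\<delta> * real (card V) ^ 3 \<le> real (card Q)"
    let ?N = "real (card V)" and ?\<Omega> = "V \<times> V \<times> V" and ?J = "{0, 1, 2, 3} :: nat set"
    have V0: "V \<noteq> {}" using n by (auto simp: n0_def)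
    then have N: "?N > 0" using V by (simp add: card_gt_0_iff)
    have c\<Omega>: "real (card ?\<Omega>) = ?N ^ 3" by (simp add: card_cartesian_product power3_eq_cube)
    define F where "F = simplex_faces Q"
    define f where "f j = (indicator (F j) :: _ \<Rightarrow> real)" for j
    have F\<Omega>: "F j \<subseteq> ?\<Omega>" for j using QV by (auto simp: F_def simplex_faces_def)
    have finQ: "finite Q" using QV V finite_subset by blast
    have fin\<Omega>: "finite ?\<Omega>" using V by simp
    have "bounded_system 4 ?\<Omega> ?J f same_triple"
      unfolding bounded_system_def using V V0 equivp_same_triple by (auto simp: f_def indicator_def)
    from M[rule_format, OF this] obtain S S' where S: "finite S'" "S \<subseteq> S'" "card S \<le> M"
      and uni: "uniform ?\<Omega> ?J f same_triple S' (t (card S))"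
      and gap: "(\<Sum>j\<in>?J. \<Sum>x\<in>?\<Omega>. (cexp ?\<Omega> (meet same_triple S') (f j) x - cexp ?\<Omega> (meet same_triple S) (f j) x)\<^sup>2)
         \<le> q\<^sup>2 * real (card ?\<Omega>)"
      unfolding regularizable_def by blast
    define m where "m = card S"
    have mM: "m \<le> M" using S by (simp add: m_def)
    have finS: "finite S" using S finite_subset by blast
    obtain E where E: "equivp E"
      and few: "real (card {q \<in> V \<times> V. \<not> good_pair V S E (\<mu> m) (\<eta> m) (p0 m) (fst q) (snd q)}) \<le> \<epsilon> * ?N\<^sup>2"
      using reg[rule_format, OF V V0 finS, of m] by (auto simp: m_def)
    define G where "G = good_pair V S E (\<mu> m) (\<eta> m) (p0 m)"
    define s where "s j = cexp ?\<Omega> (meet same_triple S) (f j)" for j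
    define g where "g j = cexp ?\<Omega> (meet same_triple S') (f j)" for j
    define e where "e j x = \<bar>g j x - s j x\<bar>" for j x
    have f01: "0 \<le> f j x" "f j x \<le> 1" for j x by (auto simp: f_def indicator_def)
    have g01: "0 \<le> g j x \<and> g j x \<le> 1" for j x
      unfolding g_def using cexp_nonneg cexp_le_1 f01 by metis
    have s1: "s j x \<le> 1" for j x unfolding s_def using cexp_le_1 f01 by metis
    have eqS: "equivp (meet same_triple A)" for A :: "('v \<times> 'v) set set" by (intro equivp_meet equivp_same_triple)
    have s_inv: "s j t' = s j u" if "meet same_triple S u t'" for j t' u
      unfolding s_def using cexp_cong[OF eqS that] by simp
    define B1 where "B1 j = {x\<in>F j. s j x < d}" for j
    define B2 where "B2 j = {x\<in>?\<Omega>. cexp ?\<Omega> (polyad E S) (e j) x > \<kappa>}" for j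
    define B3 where "B3 = {(x, y, z). x \<in> V \<and> y \<in> V \<and> z \<in> V \<and> \<not> (G x y \<and> G x z \<and> G y z)}"
    \<comment> \<open>The three ways for a triple to be useless: its coarse density is low, fine and
      coarse density differ too much on its polyad, or one of its pairs is not good.\<close>
    define Bad where "Bad j = B1 j \<union> (B2 j \<union> B3)" for j
    have b1: "real (card (B1 j)) \<le> \<delta> / 32 * ?N ^ 3" for j
    proof -
      have "real (card (B1 j)) \<le> d * real (card ?\<Omega>)"
        unfolding B1_def s_def f_def using d by (intro cexp_small fin\<Omega> eqS F\<Omega>) auto
      also have "\<dots> \<le> \<delta> / 32 * ?N ^ 3" unfolding c\<Omega> using d by (intro mult_right_mono) auto
      finally show ?thesis .
    qed
    have b2: "real (card (B2 j)) \<le> \<delta> / 32 * ?N ^ 3" if "j \<in> ?J" for j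
    proof -
      have "(\<Sum>x\<in>?\<Omega>. (g j x - s j x)\<^sup>2) \<le> (\<Sum>j\<in>?J. \<Sum>x\<in>?\<Omega>. (g j x - s j x)\<^sup>2)"
        by (rule member_le_sum[OF that]) (auto intro: sum_nonneg)
      also have "\<dots> \<le> q\<^sup>2 * real (card ?\<Omega>)" using gap by (simp only: g_def s_def)
      finally have "(\<Sum>x\<in>?\<Omega>. e j x) \<le> q * real (card ?\<Omega>)"
        unfolding e_def using q by (intro sum_abs_le_sqrt) auto
      moreover have "\<kappa> * real (card (B2 j)) \<le> (\<Sum>x\<in>?\<Omega>. e j x)"
        unfolding B2_def by (rule cexp_markov[OF fin\<Omega> equivp_polyad[OF E]]) (simp add: e_def)
      ultimately have "\<kappa> * real (card (B2 j)) \<le> \<kappa> * (\<delta> / 32 * ?N ^ 3)" using c\<Omega> by (simp add: q_def)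
      then show ?thesis using \<kappa> by simp
    qed
    have b3: "real (card B3) \<le> 3 * \<delta> / 128 * ?N ^ 3"
      using card_bad_triples[OF V, of G \<epsilon>] few unfolding B3_def G_def by (simp add: \<epsilon>_def)
    have finBad: "finite (Bad j)" for j
    proof (rule finite_subset[OF _ fin\<Omega>])
      show "Bad j \<subseteq> ?\<Omega>" using F\<Omega>[of j] by (auto simp: Bad_def B1_def B2_def B3_def)
    qed
    have bad: "real (card (Bad j)) \<le> 11 * \<delta> / 128 * ?N ^ 3" if "j \<in> ?J" for j
    proof -
      have "card (Bad j) \<le> card (B1 j) + (card (B2 j) + card B3)"
        unfolding Bad_def by (intro order_trans[OF card_Un_le] add_mono order_refl card_Un_le)
      then have "real (card (Bad j)) \<le> real (card (B1 j)) + (real (card (B2 j)) + real (card B3))" by linarith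
      also have "\<dots> \<le> \<delta> / 32 * ?N ^ 3 + (\<delta> / 32 * ?N ^ 3 + 3 * \<delta> / 128 * ?N ^ 3)"
        by (intro add_mono b1 b2[OF that] b3)
      also have "\<dots> = 11 * \<delta> / 128 * ?N ^ 3" by (simp add: field_simps)
      finally show ?thesis .
    qed
    have "\<exists>x y z w. (x, y, z, w) \<in> Q \<and> (y, z, w) \<notin> Bad 0 \<and> (x, z, w) \<notin> Bad 1 \<and> (x, y, w) \<notin> Bad 2 \<and> (x, y, z) \<notin> Bad 3"
    proof (rule ccontr)
      assume no: "\<not> ?thesis"
      let ?Q0 = "{q\<in>Q. (\<lambda>(x, y, z, w). (y, z, w)) q \<in> Bad 0}" and ?Q1 = "{q\<in>Q. (\<lambda>(x, y, z, w). (x, z, w)) q \<in> Bad 1}"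
      let ?Q2 = "{q\<in>Q. (\<lambda>(x, y, z, w). (x, y, w)) q \<in> Bad 2}" and ?Q3 = "{q\<in>Q. (\<lambda>(x, y, z, w). (x, y, z)) q \<in> Bad 3}"
      have "Q \<subseteq> ?Q0 \<union> (?Q1 \<union> (?Q2 \<union> ?Q3))"
      proof
        fix v assume v: "v \<in> Q"
        obtain x y z w where "v = (x, y, z, w)" by (cases v)
        then show "v \<in> ?Q0 \<union> (?Q1 \<union> (?Q2 \<union> ?Q3))" using no v by auto
      qed
      then have "card Q \<le> card (?Q0 \<union> (?Q1 \<union> (?Q2 \<union> ?Q3)))" using finQ by (intro card_mono) auto
      also have "\<dots> \<le> card (Bad 0) + (card (Bad 1) + (card (Bad 2) + card (Bad 3)))"
        by (intro order_trans[OF card_Un_le] add_mono card_preimage_le inj finBad)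
      finally have "real (card Q) \<le> real (card (Bad 0)) + (real (card (Bad 1)) + (real (card (Bad 2)) + real (card (Bad 3))))"
        by linarith
      also have "\<dots> \<le> 11 * \<delta> / 128 * ?N ^ 3 + (11 * \<delta> / 128 * ?N ^ 3 + (11 * \<delta> / 128 * ?N ^ 3 + 11 * \<delta> / 128 * ?N ^ 3))"
        by (intro add_mono bad) auto
      finally have "\<delta> * ?N ^ 3 \<le> 11 / 32 * (\<delta> * ?N ^ 3)" using large by simp
      moreover have "0 < \<delta> * ?N ^ 3" using \<delta> N by simp
      ultimately show False by simp
    qed
    then obtain x1 x2 x3 x4 where x: "(x1, x2, x3, x4) \<in> Q"
      and nb: "(x2, x3, x4) \<notin> Bad 0" "(x1, x3, x4) \<notin> Bad 1" "(x1, x2, x4) \<notin> Bad 2" "(x1, x2, x3) \<notin> Bad 3" by blast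
    have xV: "x1 \<in> V" "x2 \<in> V" "x3 \<in> V" "x4 \<in> V" using x QV by auto
    have xF: "(x2, x3, x4) \<in> F 0" "(x1, x3, x4) \<in> F 1" "(x1, x2, x4) \<in> F 2" "(x1, x2, x3) \<in> F 3"
      using x by (force simp: F_def simplex_faces_def)+
    have sd: "d \<le> s 0 (x2, x3, x4)" "d \<le> s 1 (x1, x3, x4)" "d \<le> s 2 (x1, x2, x4)" "d \<le> s 3 (x1, x2, x3)"
      using nb xF by (auto simp: Bad_def B1_def not_less)
    have ek: "cexp ?\<Omega> (polyad E S) (e 0) (x2, x3, x4) \<le> \<kappa>" "cexp ?\<Omega> (polyad E S) (e 1) (x1, x3, x4) \<le> \<kappa>"
      "cexp ?\<Omega> (polyad E S) (e 2) (x1, x2, x4) \<le> \<kappa>" "cexp ?\<Omega> (polyad E S) (e 3) (x1, x2, x3) \<le> \<kappa>"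
      using nb xV by (auto simp: Bad_def B2_def not_less)
    have good: "G x1 x2" "G x1 x3" "G x2 x3" "G x1 x4" "G x2 x4" "G x3 x4"
      using nb xV by (auto simp: Bad_def B3_def)
    let ?c = "\<lambda>x. {x'\<in>V. E x x'}"
    have quasi: "\<exists>p\<ge>p0 m. quasirandom (\<eta> m) p (?c x) (?c y) (cell E S x y)" if "G x y" for x y
      using good_pair_quasirandom[OF V that[unfolded G_def]] p0[of m] by (metis less_imp_le)
    obtain p12 where p12: "p0 m \<le> p12" "quasirandom (\<eta> m) p12 (?c x1) (?c x2) (cell E S x1 x2)" using quasi[OF good(1)] by blast
    obtain p13 where p13: "p0 m \<le> p13" "quasirandom (\<eta> m) p13 (?c x1) (?c x3) (cell E S x1 x3)" using quasi[OF good(2)] by blast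
    obtain p23 where p23: "p0 m \<le> p23" "quasirandom (\<eta> m) p23 (?c x2) (?c x3) (cell E S x2 x3)" using quasi[OF good(3)] by blast
    obtain p14 where p14: "p0 m \<le> p14" "quasirandom (\<eta> m) p14 (?c x1) (?c x4) (cell E S x1 x4)" using quasi[OF good(4)] by blast
    obtain p24 where p24: "p0 m \<le> p24" "quasirandom (\<eta> m) p24 (?c x2) (?c x4) (cell E S x2 x4)" using quasi[OF good(5)] by blast
    obtain p34 where p34: "p0 m \<le> p34" "quasirandom (\<eta> m) p34 (?c x3) (?c x4) (cell E S x3 x4)" using quasi[OF good(6)] by blast
    note err = polyad_error[OF V E, where S = S and \<kappa> = \<kappa>]
    let ?n = "real (card (?c x1)) * real (card (?c x2)) * real (card (?c x3)) * real (card (?c x4))"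
    let ?W = "\<lambda>y1 y2 y3 y4. cell E S x1 x2 y1 y2 * cell E S x1 x3 y1 y3 * cell E S x2 x3 y2 y3 *
        (cell E S x1 x4 y1 y4 * cell E S x2 x4 y2 y4 * cell E S x3 x4 y3 y4)"
    let ?Pg = "\<lambda>y1 y2 y3 y4. g 3 (y1, y2, y3) * g 2 (y1, y2, y4) * g 1 (y1, y3, y4) * g 0 (y2, y3, y4)"
    let ?Pf = "\<lambda>y1 y2 y3 y4. f 3 (y1, y2, y3) * f 2 (y1, y2, y4) * f 1 (y1, y3, y4) * f 0 (y2, y3, y4)"
    have "((d ^ 4 - 4 * \<kappa>) * p0 m ^ 6 - 55 * \<eta> m) * ?n
      \<le> (\<Sum>y1\<in>?c x1. \<Sum>y2\<in>?c x2. \<Sum>y3\<in>?c x3. \<Sum>y4\<in>?c x4. ?W y1 y2 y3 y4 * ?Pg y1 y2 y3 y4)"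
    proof (rule simplex_count[OF p12(2) p13(2) p23(2) p14(2) p24(2) p34(2), where d = d and \<kappa> = \<kappa> and ?p0.0 = "p0 m"
         and ?g123.0 = "\<lambda>x y z. g 3 (x, y, z)" and ?g124.0 = "\<lambda>x y z. g 2 (x, y, z)" and ?g134.0 = "\<lambda>x y z. g 1 (x, y, z)" and ?g234.0 = "\<lambda>x y z. g 0 (x, y, z)"
         and ?s123.0 = "s 3 (x1, x2, x3)" and ?s124.0 = "s 2 (x1, x2, x4)" and ?s134.0 = "s 1 (x1, x3, x4)" and ?s234.0 = "s 0 (x2, x3, x4)"])
      show "(\<Sum>x\<in>?c x1. \<Sum>y\<in>?c x2. \<Sum>z\<in>?c x3. cell E S x1 x2 x y * cell E S x1 x3 x z * cell E S x2 x3 y z * \<bar>g 3 (x, y, z) - s 3 (x1, x2, x3)\<bar>)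
         \<le> \<kappa> * (\<Sum>x\<in>?c x1. \<Sum>y\<in>?c x2. \<Sum>z\<in>?c x3. cell E S x1 x2 x y * cell E S x1 x3 x z * cell E S x2 x3 y z)"
        by (rule err) (use xV ek(4) s_inv in \<open>auto simp: e_def[abs_def]\<close>)
      show "(\<Sum>x\<in>?c x1. \<Sum>y\<in>?c x2. \<Sum>z\<in>?c x4. cell E S x1 x2 x y * cell E S x1 x4 x z * cell E S x2 x4 y z * \<bar>g 2 (x, y, z) - s 2 (x1, x2, x4)\<bar>)
         \<le> \<kappa> * (\<Sum>x\<in>?c x1. \<Sum>y\<in>?c x2. \<Sum>z\<in>?c x4. cell E S x1 x2 x y * cell E S x1 x4 x z * cell E S x2 x4 y z)"
        by (rule err) (use xV ek(3) s_inv in \<open>auto simp: e_def[abs_def]\<close>)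
      show "(\<Sum>x\<in>?c x1. \<Sum>y\<in>?c x3. \<Sum>z\<in>?c x4. cell E S x1 x3 x y * cell E S x1 x4 x z * cell E S x3 x4 y z * \<bar>g 1 (x, y, z) - s 1 (x1, x3, x4)\<bar>)
         \<le> \<kappa> * (\<Sum>x\<in>?c x1. \<Sum>y\<in>?c x3. \<Sum>z\<in>?c x4. cell E S x1 x3 x y * cell E S x1 x4 x z * cell E S x3 x4 y z)"
        by (rule err) (use xV ek(2) s_inv in \<open>auto simp: e_def[abs_def]\<close>)
      show "(\<Sum>x\<in>?c x2. \<Sum>y\<in>?c x3. \<Sum>z\<in>?c x4. cell E S x2 x3 x y * cell E S x2 x4 x z * cell E S x3 x4 y z * \<bar>g 0 (x, y, z) - s 0 (x2, x3, x4)\<bar>)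
         \<le> \<kappa> * (\<Sum>x\<in>?c x2. \<Sum>y\<in>?c x3. \<Sum>z\<in>?c x4. cell E S x2 x3 x y * cell E S x2 x4 x z * cell E S x3 x4 y z)"
        by (rule err) (use xV ek(1) s_inv in \<open>auto simp: e_def[abs_def]\<close>)
    qed (use d \<kappa> \<eta>[of m] p0[of m] p12 p13 p23 p14 p24 p34 sd s1 g01 in \<open>auto intro: less_imp_le\<close>)
    \<comment> \<open>The cell indicators vanish outside the classes, so the sums may run over all
      of \<open>V\<close>, where the cut norm bound is available.\<close>
    also have "\<dots> = (\<Sum>y1\<in>V. \<Sum>y2\<in>V. \<Sum>y3\<in>V. \<Sum>y4\<in>V. ?W y1 y2 y3 y4 * ?Pg y1 y2 y3 y4)"
      by (rule sum4_supported[symmetric, OF V]) (auto simp: cell_def)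
    also have "\<dots> \<le> (\<Sum>y1\<in>V. \<Sum>y2\<in>V. \<Sum>y3\<in>V. \<Sum>y4\<in>V. ?W y1 y2 y3 y4 * ?Pf y1 y2 y3 y4) + 4 * (t m * ?N ^ 3) * ?N"
    proof -
      have cut: "cut_small V (t m * ?N ^ 3) (\<lambda>x y z. f j (x, y, z) - g j (x, y, z))" if "j \<in> ?J" for j
        unfolding g_def m_def by (rule cut_small_if_uniform[OF V uni that])
      show ?thesis
        unfolding diff_le_eq[symmetric]
        by (rule replace_faces) (simp_all only: cell_bounds f01 g01 simp_thms, (rule cut, simp)+)
    qed
    finally have lower: "((d ^ 4 - 4 * \<kappa>) * p0 m ^ 6 - 55 * \<eta> m) * ?n - 4 * (t m * ?N ^ 3) * ?N
       \<le> (\<Sum>y1\<in>V. \<Sum>y2\<in>V. \<Sum>y3\<in>V. \<Sum>y4\<in>V. ?W y1 y2 y3 y4 * ?Pf y1 y2 y3 y4)" by linarith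
    have "?N ^ 3 < (\<Sum>y1\<in>V. \<Sum>y2\<in>V. \<Sum>y3\<in>V. \<Sum>y4\<in>V. ?W y1 y2 y3 y4 * ?Pf y1 y2 y3 y4)"
    proof -
      have "\<mu> m * ?N * (\<mu> m * ?N) * (\<mu> m * ?N) * (\<mu> m * ?N) \<le> ?n"
        using good \<mu>[of m] N unfolding G_def good_pair_def by (intro mult_mono) auto
      then have "\<mu> m ^ 4 * ?N ^ 4 \<le> ?n" by (simp add: power4_eq_xxxx ac_simps)
      then have "d ^ 4 * p0 m ^ 6 / 4 * (\<mu> m ^ 4 * ?N ^ 4) \<le> d ^ 4 * p0 m ^ 6 / 4 * ?n"
        using d p0[of m] by (intro mult_left_mono) auto
      moreover have coeff: "(d ^ 4 - 4 * \<kappa>) * p0 m ^ 6 - 55 * \<eta> m = d ^ 4 * p0 m ^ 6 / 4"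
        by (simp add: \<kappa>_def \<eta>_def field_simps)
      moreover have "d ^ 4 * p0 m ^ 6 / 4 * (\<mu> m ^ 4 * ?N ^ 4) - 4 * (t m * ?N ^ 3) * ?N = c m * ?N * ?N ^ 3"
        by (simp add: t_def c_def field_simps eval_nat_numeral)
      moreover have "1 * ?N ^ 3 < c m * ?N * ?N ^ 3"
        using n0[OF mM n] N by (intro mult_strict_right_mono) auto
      ultimately show ?thesis using lower[unfolded coeff] by linarith
    qed
    \<comment> \<open>One face determines the member of \<open>Q\<close>.\<close>
    moreover have "real (card Q) \<le> ?N ^ 3"
    proof -
      have "card Q \<le> card ?\<Omega>" by (rule card_inj_on_le[OF inj(1) _ fin\<Omega>]) (use QV in auto)
      then show ?thesis unfolding c\<Omega>[symmetric] by simp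
    qed
    ultimately have many: "real (card Q) < (\<Sum>y1\<in>V. \<Sum>y2\<in>V. \<Sum>y3\<in>V. \<Sum>y4\<in>V. ?W y1 y2 y3 y4 * ?Pf y1 y2 y3 y4)" by linarith
    show "\<exists>x y z w. (x, y, z, w) \<notin> Q \<and> (y, z, w) \<in> simplex_faces Q 0 \<and> (x, z, w) \<in> simplex_faces Q 1 \<and>
       (x, y, w) \<in> simplex_faces Q 2 \<and> (x, y, z) \<in> simplex_faces Q 3"
    proof (rule ccontr)
      assume "\<not> ?thesis"
      then have no: "(x, y, z, w) \<in> Q" if "(y, z, w) \<in> F 0" "(x, z, w) \<in> F 1" "(x, y, w) \<in> F 2" "(x, y, z) \<in> F 3" for x y z w
        using that unfolding F_def by blast
      have "(\<Sum>y1\<in>V. \<Sum>y2\<in>V. \<Sum>y3\<in>V. \<Sum>y4\<in>V. ?W y1 y2 y3 y4 * ?Pf y1 y2 y3 y4)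
        \<le> (\<Sum>y1\<in>V. \<Sum>y2\<in>V. \<Sum>y3\<in>V. \<Sum>y4\<in>V. of_bool ((y1, y2, y3, y4) \<in> Q))"
      proof (intro sum_mono)
        fix y1 y2 y3 y4
        have "?W y1 y2 y3 y4 \<le> 1" by (simp add: cell_def)
        moreover have "0 \<le> ?Pf y1 y2 y3 y4" using f01 by simp
        ultimately have "?W y1 y2 y3 y4 * ?Pf y1 y2 y3 y4 \<le> 1 * ?Pf y1 y2 y3 y4" by (rule mult_right_mono)
        also have "\<dots> \<le> of_bool ((y1, y2, y3, y4) \<in> Q)"
          using no[of y2 y3 y4 y1] by (auto simp: f_def indicator_def)
        finally show "?W y1 y2 y3 y4 * ?Pf y1 y2 y3 y4 \<le> of_bool ((y1, y2, y3, y4) \<in> Q)" .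
      qed
      also have "\<dots> = real (card (V \<times> V \<times> V \<times> V \<inter> Q))" by (rule sum4_of_bool) (rule V)+
      also have "V \<times> V \<times> V \<times> V \<inter> Q = Q" using QV by auto
      finally show False using many by simp
    qed
  qed
qed

section \<open>Triangles in linear hypergraphs\<close>

definition linear_triples :: "'a set set \<Rightarrow> bool" where
  "linear_triples L \<longleftrightarrow> (\<forall>e\<in>L. card e = 3) \<and>
     (\<forall>e\<in>L. \<forall>e'\<in>L. \<forall>u v. u \<noteq> v \<longrightarrow> {u, v} \<subseteq> e \<longrightarrow> {u, v} \<subseteq> e' \<longrightarrow> e = e')"

text \<open>At most fourteen vertices replaces exactly fourteen: missing ones can be added as
  isolated vertices once there are 14 in total.\<close>

definition config_free :: "'a set set \<Rightarrow> bool" where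
  "config_free E \<longleftrightarrow> (\<forall>F\<subseteq>E. card F = 10 \<longrightarrow> 14 < card (\<Union>F))"

text \<open>The vertex bound is the length of a list that may contain repetitions, so coincidences
  among the named vertices do no harm; only the ten edges have to be distinct.\<close>

lemma config_freeD:
  assumes "config_free E" "F \<subseteq> E" "card F = 10" "\<Union>F \<subseteq> set vs" "length vs \<le> 14"
  shows False
proof -
  have "card (\<Union>F) \<le> card (set vs)" using assms by (intro card_mono) auto
  also have "\<dots> \<le> 14" using card_length[of vs] assms by linarith
  finally have "card (\<Union>F) \<le> 14" .
  moreover have "14 < card (\<Union>F)" using assms(1-3) unfolding config_free_def by blast
  ultimately show False by simp
qed

lemma triple_distinct:
  assumes "card {u, v, w} = 3"
  shows "u \<noteq> v \<and> u \<noteq> w \<and> v \<noteq> w"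
  using assms by (auto simp: card_insert_if split: if_splits)

lemma linear_third:
  assumes "linear_triples L" "{u, v, w} \<in> L" "{u, v, w'} \<in> L"
  shows "w = w'"
proof -
  have d: "u \<noteq> v \<and> u \<noteq> w \<and> v \<noteq> w" "u \<noteq> v \<and> u \<noteq> w' \<and> v \<noteq> w'"
    using assms triple_distinct unfolding linear_triples_def by metis+
  have eq: "{u, v, w} = {u, v, w'}"
    using assms d(1) unfolding linear_triples_def by (meson insert_subset insertI1 insertI2 empty_subsetI)
  have "w \<in> {u, v, w}" by simp
  then show ?thesis unfolding eq using d by auto
qed

lemma linear_second:
  assumes "linear_triples L" "{u, v, w} \<in> L" "{u, v', w} \<in> L"
  shows "v = v'"
  using linear_third[of L u w v v'] assms by (simp add: insert_commute)

lemma linear_first: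
  assumes "linear_triples L" "{u, v, w} \<in> L" "{u', v, w} \<in> L"
  shows "u = u'"
  using linear_third[of L v w u u'] assms by (simp add: insert_commute)

text \<open>Ten edges through a common pair cover at most 2 + 10 vertices.\<close>

lemma pair_degree:
  assumes E: "finite E" "\<And>e. e \<in> E \<Longrightarrow> card e = 3" and free: "config_free E" and p: "card p = 2"
  shows "card {e\<in>E. p \<subseteq> e} \<le> 9"
proof (rule ccontr)
  assume "\<not> ?thesis"
  then have "10 \<le> card {e\<in>E. p \<subseteq> e}" by simp
  then obtain F where F: "F \<subseteq> {e\<in>E. p \<subseteq> e}" "card F = 10" "finite F" by (rule obtain_subset_with_card_n)
  have finp: "finite p" by (rule card_ge_0_finite) (simp add: p)
  have one: "card (e - p) = 1" if "e \<in> F" for e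
  proof -
    have "p \<subseteq> e" "card e = 3" using that F E by auto
    then show ?thesis using p finp by (simp add: card_Diff_subset)
  qed
  have fin: "finite (\<Union>e\<in>F. e - p)" 
  proof (rule finite_UN_I[OF F(3)])
    show "finite (e - p)" if "e \<in> F" for e by (rule card_ge_0_finite) (simp add: one[OF that])
  qed
  have "\<Union>F \<subseteq> p \<union> (\<Union>e\<in>F. e - p)" by auto
  then have "card (\<Union>F) \<le> card (p \<union> (\<Union>e\<in>F. e - p))" using fin finp by (intro card_mono) auto
  also have "\<dots> \<le> card p + card (\<Union>e\<in>F. e - p)" by (rule card_Un_le)
  also have "card (\<Union>e\<in>F. e - p) \<le> (\<Sum>e\<in>F. card (e - p))" by (rule card_UN_le) (rule F)
  also have "(\<Sum>e\<in>F. card (e - p)) = 10" using F one by simp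
  finally have "card (\<Union>F) \<le> 14" using p by simp
  moreover have "F \<subseteq> E" using F by blast
  then have "14 < card (\<Union>F)" using free F(2) unfolding config_free_def by blast
  ultimately show False by simp
qed

text \<open>By maximality of a linear subset \<open>L\<close>, every edge of \<open>E\<close> shares
  a pair with some member of \<open>L\<close>. Each member has three pairs and each pair lies in at
  most nine edges, whence 27 = 3 * 9.\<close>

lemma large_linear_subset:
  assumes E: "finite E" "\<And>e. e \<in> E \<Longrightarrow> card e = 3" and free: "config_free E"
  obtains L where "L \<subseteq> E" "linear_triples L" "card E \<le> 27 * card L"
proof -
  let ?\<L> = "{L. L \<subseteq> E \<and> linear_triples L}"
  have "finite ?\<L>" using E by auto
  moreover have "{} \<in> ?\<L>" by (simp add: linear_triples_def)
  ultimately obtain L where L: "L \<in> ?\<L>" and max: "\<And>L'. L' \<in> ?\<L> \<Longrightarrow> L \<subseteq> L' \<Longrightarrow> L = L'"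
    using finite_has_maximal[of ?\<L>] by auto
  let ?p = "\<lambda>l. {p. p \<subseteq> l \<and> card p = 2}"
  have finL: "finite L" using L E finite_subset by auto
  have finl: "finite l" if "l \<in> E" for l by (rule card_ge_0_finite) (simp add: E(2)[OF that])
  have cover: "\<exists>l\<in>L. \<exists>p\<in>?p l. p \<subseteq> e" if e: "e \<in> E" for e
  proof (cases "e \<in> L")
    case True
    obtain p where "p \<subseteq> e" "card p = 2" using obtain_subset_with_card_n[of 2 e] E(2)[OF e] by auto
    then show ?thesis using True by blast
  next
    case False
    then have "\<not> linear_triples (insert e L)" using max[of "insert e L"] L e by auto
    have "\<exists>l\<in>L. \<exists>u v. u \<noteq> v \<and> {u, v} \<subseteq> e \<and> {u, v} \<subseteq> l"
    proof (rule ccontr)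
      assume no: "\<not> ?thesis"
      have "linear_triples (insert e L)"
        unfolding linear_triples_def
      proof (intro conjI ballI allI impI)
        fix f assume "f \<in> insert e L"
        then show "card f = 3" using L E(2)[OF e] by (auto simp: linear_triples_def)
      next
        fix f f' u v
        assume "f \<in> insert e L" "f' \<in> insert e L" and uv: "u \<noteq> v" "{u, v} \<subseteq> f" "{u, v} \<subseteq> f'"
        then consider "f = e" "f' = e" | "f = e" "f' \<in> L" | "f \<in> L" "f' = e" | "f \<in> L" "f' \<in> L" by blast
        then show "f = f'"
        proof cases
          case 4
          have "linear_triples L" using L by simp
          then show ?thesis using 4 uv unfolding linear_triples_def by blast
        qed (use no uv in blast)+
      qed
      then show False using \<open>\<not> linear_triples (insert e L)\<close> by simp
    qed
    then obtain l u v where "l \<in> L" "u \<noteq> v" "{u, v} \<subseteq> e" "{u, v} \<subseteq> l" by blast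
    then show ?thesis by (intro bexI[of _ l] bexI[of _ "{u, v}"]) auto
  qed
  have "E \<subseteq> (\<Union>l\<in>L. \<Union>p\<in>?p l. {e\<in>E. p \<subseteq> e})"
  proof
    fix e assume "e \<in> E"
    with cover[OF this] show "e \<in> (\<Union>l\<in>L. \<Union>p\<in>?p l. {e\<in>E. p \<subseteq> e})" by blast
  qed
  moreover have finp: "finite (?p l)" if "l \<in> L" for l
    by (rule finite_subset[of _ "Pow l"]) (use finl L that in auto)
  ultimately have "card E \<le> card (\<Union>l\<in>L. \<Union>p\<in>?p l. {e\<in>E. p \<subseteq> e})"
    using finL E by (intro card_mono) auto
  also have "\<dots> \<le> (\<Sum>l\<in>L. card (\<Union>p\<in>?p l. {e\<in>E. p \<subseteq> e}))" by (rule card_UN_le[OF finL])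
  also have "\<dots> \<le> (\<Sum>l\<in>L. 27)"
  proof (rule sum_mono)
    fix l assume l: "l \<in> L"
    have "card (\<Union>p\<in>?p l. {e\<in>E. p \<subseteq> e}) \<le> (\<Sum>p\<in>?p l. card {e\<in>E. p \<subseteq> e})"
      by (rule card_UN_le[OF finp[OF l]])
    also have "\<dots> \<le> (\<Sum>p\<in>?p l. 9)"
      by (intro sum_mono pair_degree E free) auto
    also have "\<dots> = 27"
    proof -
      have "card l = 3" using l L E by auto
      then have "card (?p l) = 3 choose 2" using n_subsets[of l 2] finl l L by auto
      also have "\<dots> = 3" by (simp add: numeral_eq_Suc)
      finally show ?thesis by simp
    qed
    finally show "card (\<Union>p\<in>?p l. {e\<in>E. p \<subseteq> e}) \<le> 27" .
  qed
  finally show thesis using that[of L] L by simp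
qed

text \<open>Loose triangles with labelled vertices: \<open>x\<close>, \<open>y\<close>,
  \<open>z\<close> complete the sides opposite \<open>a\<close>, \<open>b\<close>, \<open>c\<close>.
  Lists keep the labelling, so that a position can later prescribe a colour.\<close>

definition triangles :: "'a set set \<Rightarrow> 'a list set" where
  "triangles L = {[a, b, c, x, y, z] | a b c x y z.
     distinct [a, b, c, x, y, z] \<and> {a, b, z} \<in> L \<and> {a, c, y} \<in> L \<and> {b, c, x} \<in> L}"

lemma trianglesD:
  assumes "xs \<in> triangles L" "\<forall>e\<in>L. e \<subseteq> V"
  shows "distinct xs \<and> length xs = 6 \<and> set xs \<subseteq> V"
proof -
  obtain a b c x y z where xs: "xs = [a, b, c, x, y, z]" "distinct [a, b, c, x, y, z]"
    and e: "{a, b, z} \<in> L" "{a, c, y} \<in> L" "{b, c, x} \<in> L"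
    using assms(1) unfolding triangles_def mem_Collect_eq by (elim exE conjE)
  have "{a, b, z} \<subseteq> V" "{a, c, y} \<subseteq> V" "{b, c, x} \<subseteq> V" by (rule bspec[OF assms(2)], rule e)+
  then show ?thesis using xs by simp
qed

lemma finite_triangles:
  assumes "finite V" "\<forall>e\<in>L. e \<subseteq> V"
  shows "finite (triangles L)"
  by (rule finite_subset[OF _ finite_lists_length_eq[OF assms(1), of 6]]) (use trianglesD assms(2) in blast)

text \<open>Each ordered edge is a triangle of the pair graph, and by linearity two of its vertices
  determine the third, so the ordered edges form the injective family needed for triangle removal.
  The triangles not coming from edges of \<open>L\<close> are the corners of loose
  triangles.\<close>

lemma many_triangles:
  fixes \<delta> :: real
  assumes \<delta>: "\<delta> > 0"
  shows "\<exists>\<epsilon>>0. \<exists>n0. \<forall>(V :: 'a set) L. finite V \<longrightarrow> n0 \<le> card V \<longrightarrow> linear_triples L \<longrightarrow> (\<forall>e\<in>L. e \<subseteq> V) \<longrightarrow>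
     \<delta> * real (card V) ^ 2 \<le> real (card L) \<longrightarrow> \<epsilon> * real (card V) ^ 3 \<le> real (card (triangles L))"
proof -
  obtain \<epsilon> where \<epsilon>: "\<epsilon> > 0" and rem: "\<forall>(V :: 'a set) P Q. finite V \<longrightarrow> V \<noteq> {} \<longrightarrow> Q \<subseteq> V \<times> V \<times> V \<longrightarrow>
    (\<forall>x y z. (x, y, z) \<in> Q \<longrightarrow> (x, y) \<in> P \<and> (x, z) \<in> P \<and> (y, z) \<in> P) \<longrightarrow>
    inj_on (\<lambda>(x, y, z). (x, y)) Q \<longrightarrow> inj_on (\<lambda>(x, y, z). (x, z)) Q \<longrightarrow> inj_on (\<lambda>(x, y, z). (y, z)) Q \<longrightarrow>
    \<delta> * real (card V) ^ 2 \<le> real (card Q) \<longrightarrow>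
    \<epsilon> * real (card V) ^ 3 \<le> real (card {(x, y, z). x \<in> V \<and> y \<in> V \<and> z \<in> V \<and> (x, y) \<in> P \<and> (x, z) \<in> P \<and> (y, z) \<in> P})"
    using triangle_removal[where 'v = 'a, OF \<delta>] by (elim exE conjE)
  show ?thesis
  \<comment> \<open>There are at most \<open>n ^ 2\<close> ordered edges; for
    \<open>n \<ge> 2 / \<epsilon>\<close> this is at most half of
    \<open>\<epsilon> * n ^ 3\<close>.\<close>
  proof (intro exI[of _ "\<epsilon> / 2"] conjI exI[of _ "Suc (nat \<lceil>2 / \<epsilon>\<rceil>)"] allI impI)
    show "0 < \<epsilon> / 2" using \<epsilon> by simp
    fix V :: "'a set" and L
    assume V: "finite V" and n: "Suc (nat \<lceil>2 / \<epsilon>\<rceil>) \<le> card V" and lin: "linear_triples L" and LV: "\<forall>e\<in>L. e \<subseteq> V"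
      and large: "\<delta> * real (card V) ^ 2 \<le> real (card L)"
    let ?N = "real (card V)"
    have "2 / \<epsilon> \<le> ?N" using n by linarith
    then have N: "2 \<le> \<epsilon> * ?N" using \<epsilon> by (simp add: field_simps)
    have V0: "V \<noteq> {}" using n by auto
    have c3: "card e = 3" if "e \<in> L" for e using lin that by (simp add: linear_triples_def)
    have d3: "u \<noteq> v \<and> u \<noteq> w \<and> v \<noteq> w" if "{u, v, w} \<in> L" for u v w using triple_distinct[OF c3[OF that]] .
    define T where "T = {(u, v, w). {u, v, w} \<in> L}"
    define P where "P = {(u, v). \<exists>w. {u, v, w} \<in> L}"
    define R where "R = {(x, y, z). x \<in> V \<and> y \<in> V \<and> z \<in> V \<and> (x, y) \<in> P \<and> (x, z) \<in> P \<and> (y, z) \<in> P}"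
    have TV: "T \<subseteq> V \<times> V \<times> V" using LV by (auto simp: T_def)
    then have finT: "finite T" using V finite_subset by blast
    have finR: "finite R" by (rule finite_subset[of _ "V \<times> V \<times> V"]) (use V in \<open>auto simp: R_def\<close>)
    have inj: "inj_on (\<lambda>(x, y, z). (x, y)) T" "inj_on (\<lambda>(x, y, z). (x, z)) T" "inj_on (\<lambda>(x, y, z). (y, z)) T"
      using linear_third[OF lin] linear_second[OF lin] linear_first[OF lin] by (auto simp: inj_on_def T_def)
    have "L \<subseteq> (\<lambda>(u, v, w). {u, v, w}) ` T"
    proof
      fix e assume "e \<in> L"
      then obtain u v w where "e = {u, v, w}" using c3 card_3_iff by metis
      then show "e \<in> (\<lambda>(u, v, w). {u, v, w}) ` T" using \<open>e \<in> L\<close> by (force simp: T_def)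
    qed
    then have "card L \<le> card T" using finT by (meson card_image_le card_mono finite_imageI order_trans)
    then have "\<delta> * ?N ^ 2 \<le> real (card T)" using large by linarith
    moreover have "(x, y) \<in> P \<and> (x, z) \<in> P \<and> (y, z) \<in> P" if "(x, y, z) \<in> T" for x y z
    proof -
      have "{x, y, z} \<in> L" using that by (simp add: T_def)
      moreover from this have "{x, z, y} \<in> L" "{y, z, x} \<in> L" by (simp_all add: insert_commute)
      ultimately show ?thesis unfolding P_def by blast
    qed
    ultimately have R: "\<epsilon> * ?N ^ 3 \<le> real (card R)"
      unfolding R_def by (intro rem[rule_format, OF V V0 TV _ inj]) auto
    have "card T \<le> card (V \<times> V)" by (rule card_inj_on_le[OF inj(1)]) (use TV V in auto)
    then have "real (card T) \<le> ?N ^ 2" by (simp add: card_cartesian_product power2_eq_square flip: of_nat_mult)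
    also have "2 * ?N ^ 2 \<le> \<epsilon> * ?N * ?N ^ 2" using N by (intro mult_right_mono) auto
    then have "?N ^ 2 \<le> \<epsilon> / 2 * ?N ^ 3" by (simp add: power2_eq_square power3_eq_cube)
    finally have T: "real (card T) \<le> \<epsilon> / 2 * ?N ^ 3" .
    let ?h = "\<lambda>xs. (xs ! 0, xs ! 1, xs ! 2)"
    have finTr: "finite (triangles L)" by (rule finite_triangles[OF V LV])
    have "R - T \<subseteq> ?h ` triangles L"
    proof
      fix t assume t: "t \<in> R - T"
      then obtain a b c where abc: "t = (a, b, c)" "(a, b) \<in> P" "(a, c) \<in> P" "(b, c) \<in> P" "{a, b, c} \<notin> L"
        by (auto simp: R_def T_def)
      then obtain x y z where e: "{a, b, z} \<in> L" "{a, c, y} \<in> L" "{b, c, x} \<in> L" by (auto simp: P_def)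
      have d: "a \<noteq> b" "a \<noteq> c" "b \<noteq> c" "z \<noteq> a" "z \<noteq> b" "y \<noteq> a" "y \<noteq> c" "x \<noteq> b" "x \<noteq> c"
        using d3[OF e(1)] d3[OF e(2)] d3[OF e(3)] by auto
      \<comment> \<open>A coincidence with a corner would make \<open>{a, b, c}\<close> an edge; a
        coincidence among \<open>x\<close>, \<open>y\<close>, \<open>z\<close> would identify two
        corners by linearity.\<close>
      have d': "z \<noteq> c" "y \<noteq> b" "x \<noteq> a" using abc(5) e by (auto simp: insert_commute)
      have "y \<noteq> z" using linear_second[OF lin, of a b z c] e d by (auto simp: insert_commute)
      moreover have "x \<noteq> z" using linear_first[OF lin, of a b z c] e d by (auto simp: insert_commute)
      moreover have "x \<noteq> y" using linear_first[OF lin, of a c y b] e d by auto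
      ultimately have "[a, b, c, x, y, z] \<in> triangles L" using e d d' by (auto simp: triangles_def)
      then show "t \<in> ?h ` triangles L" using abc(1) by (intro image_eqI[of _ _ "[a, b, c, x, y, z]"]) auto
    qed
    then have "card (R - T) \<le> card (triangles L)"
      using finTr by (meson card_image_le card_mono finite_imageI order_trans)
    moreover have "card R - card T \<le> card (R - T)" by (rule diff_card_le_card_Diff[OF finT])
    ultimately have "real (card R) - real (card T) \<le> real (card (triangles L))" by linarith
    then show "\<epsilon> / 2 * ?N ^ 3 \<le> real (card (triangles L))" using R T by linarith
  qed
qed

text \<open>Averaging over all maps from \<open>V\<close> to \<open>{..<k}\<close>: a list of
  \<open>k\<close> distinct vertices has every entry coloured by its position with probability
  \<open>1 / k ^ k\<close>.\<close>

lemma rainbow_colouring: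
  assumes V: "finite V" and k: "0 < k" and R: "finite R" "\<And>xs. xs \<in> R \<Longrightarrow> distinct xs \<and> length xs = k \<and> set xs \<subseteq> V"
  obtains \<chi> :: "'a \<Rightarrow> nat" where "card R \<le> k ^ k * card {xs\<in>R. \<forall>i<k. \<chi> (xs ! i) = i}"
proof (rule ccontr)
  assume "\<not> thesis"
  then have less: "k ^ k * card {xs\<in>R. \<forall>i<k. \<chi> (xs ! i) = i} < card R" for \<chi>
    using that[of \<chi>] by linarith
  define C where "C = PiE V (\<lambda>_. {..<k})"
  have finC: "finite C" using V by (simp add: C_def finite_PiE)
  have cardC: "card C = k ^ card V" using V by (simp add: C_def card_PiE)
  have "(\<Sum>\<chi>\<in>C. k ^ k * card {xs\<in>R. \<forall>i<k. \<chi> (xs ! i) = i}) < (\<Sum>\<chi>\<in>C. card R)"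
    using less finC cardC k by (intro sum_strict_mono) auto
  moreover have "(\<Sum>\<chi>\<in>C. k ^ k * card {xs\<in>R. \<forall>i<k. \<chi> (xs ! i) = i}) = k ^ card V * card R"
  proof -
    have each: "k ^ k * card {\<chi>\<in>C. \<forall>i<k. \<chi> (xs ! i) = i} = k ^ card V" if xs: "xs \<in> R" for xs
    proof -
      have x: "distinct xs" "length xs = k" "set xs \<subseteq> V" using R xs by auto
      \<comment> \<open>Admissible colours at \<open>v\<close>: its position if \<open>v\<close>
        occurs in the list, all \<open>k\<close> colours otherwise. The suitable colourings then
        form a product set.\<close>
      let ?A = "\<lambda>v. {j. j < k \<and> (\<forall>i<k. xs ! i = v \<longrightarrow> j = i)}"
      have "{\<chi>\<in>C. \<forall>i<k. \<chi> (xs ! i) = i} = PiE V ?A"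
      proof (intro equalityI subsetI)
        fix \<chi> assume "\<chi> \<in> {\<chi>\<in>C. \<forall>i<k. \<chi> (xs ! i) = i}"
        then show "\<chi> \<in> PiE V ?A" by (auto simp: C_def PiE_iff)
      next
        fix \<chi> assume \<chi>: "\<chi> \<in> PiE V ?A"
        have "\<chi> (xs ! i) = i" if "i < k" for i
        proof -
          have "xs ! i \<in> V" using x that by (metis nth_mem subsetD)
          then show ?thesis using \<chi> that by (auto simp: PiE_iff)
        qed
        then show "\<chi> \<in> {\<chi>\<in>C. \<forall>i<k. \<chi> (xs ! i) = i}" using \<chi> by (auto simp: C_def PiE_iff)
      qed
      then have "card {\<chi>\<in>C. \<forall>i<k. \<chi> (xs ! i) = i} = (\<Prod>v\<in>V. card (?A v))" using V by (simp add: card_PiE)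
      also have "\<dots> = (\<Prod>v\<in>V - set xs. card (?A v)) * (\<Prod>v\<in>set xs. card (?A v))"
        using V x by (intro prod.subset_diff) auto
      also have "(\<Prod>v\<in>V - set xs. card (?A v)) = (\<Prod>v\<in>V - set xs. k)"
      proof (intro prod.cong refl)
        fix v assume "v \<in> V - set xs"
        then have "?A v = {..<k}" using x by auto
        then show "card (?A v) = k" by simp
      qed
      also have "(\<Prod>v\<in>set xs. card (?A v)) = (\<Prod>v\<in>set xs. 1)"
      proof (intro prod.cong refl)
        fix v assume "v \<in> set xs"
        then obtain i where "i < k" "v = xs ! i" using x by (metis in_set_conv_nth)
        then have "?A v = {i}" using x by (auto simp: nth_eq_iff_index_eq)
        then show "card (?A v) = 1" by simp
      qed
      finally have "card {\<chi>\<in>C. \<forall>i<k. \<chi> (xs ! i) = i} = k ^ (card V - k)"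
        using x V by (simp add: card_Diff_subset distinct_card)
      moreover have "k \<le> card V" using x V by (metis card_mono distinct_card)
      ultimately show ?thesis by (simp flip: power_add)
    qed
    have "(\<Sum>\<chi>\<in>C. card {xs\<in>R. \<forall>i<k. \<chi> (xs ! i) = i}) = (\<Sum>\<chi>\<in>C. \<Sum>xs\<in>R. of_bool (\<forall>i<k. \<chi> (xs ! i) = i))"
      using R(1) by (intro sum.cong refl) (simp add: Collect_conj_eq Int_commute)
    also have "\<dots> = (\<Sum>xs\<in>R. \<Sum>\<chi>\<in>C. of_bool (\<forall>i<k. \<chi> (xs ! i) = i))" by (rule sum.swap)
    also have "\<dots> = (\<Sum>xs\<in>R. card {\<chi>\<in>C. \<forall>i<k. \<chi> (xs ! i) = i})"
      using finC by (intro sum.cong refl) (simp add: Collect_conj_eq Int_commute)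
    finally show ?thesis using each by (simp flip: sum_distrib_left) (simp add: sum_distrib_left mult.commute)
  qed
  ultimately show False using cardC by simp
qed

section \<open>Forbidden configurations among rainbow triangles\<close>

lemma inj_on_coloured_triples:
  fixes i j k :: nat
  assumes "i \<noteq> j" "i \<noteq> k" "j \<noteq> k" and T: "\<And>u v w. (u, v, w) \<in> T \<Longrightarrow> \<chi> u = i \<and> \<chi> v = j \<and> \<chi> w = k"
  shows "inj_on (\<lambda>(u, v, w). {u, v, w}) T"
proof (rule inj_onI)
  fix s t assume s: "s \<in> T" and t: "t \<in> T" and eq: "(\<lambda>(u, v, w). {u, v, w}) s = (\<lambda>(u, v, w). {u, v, w}) t"
  obtain u v w where st: "s = (u, v, w)" by (cases s)
  obtain u' v' w' where tt: "t = (u', v', w')" by (cases t)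
  have c: "\<chi> u = i" "\<chi> v = j" "\<chi> w = k" "\<chi> u' = i" "\<chi> v' = j" "\<chi> w' = k" using T s t st tt by auto
  have "u \<in> {u', v', w'}" "v \<in> {u', v', w'}" "w \<in> {u', v', w'}" using eq st tt by auto
  then show "s = t" using c assms(1-3) st tt by auto
qed

text \<open>Each edge carries one of three colour patterns, one for each side of a rainbow triangle.
  The patterns separate the three families, and within a family the colours recover an ordered
  triple from its set; so distinct triples give distinct edges, 3 + 3 + 4 = 10 in all.\<close>

lemma no_ten_edges:
  fixes \<chi> :: "'a \<Rightarrow> nat"
  assumes free: "config_free E"
    and TA: "card TA = 3" "\<And>u v w. (u, v, w) \<in> TA \<Longrightarrow> {u, v, w} \<in> E \<and> {u, v, w} \<subseteq> set vs \<and> \<chi> u = 0 \<and> \<chi> v = 1 \<and> \<chi> w = 5"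
    and TB: "card TB = 3" "\<And>u v w. (u, v, w) \<in> TB \<Longrightarrow> {u, v, w} \<in> E \<and> {u, v, w} \<subseteq> set vs \<and> \<chi> u = 0 \<and> \<chi> v = 2 \<and> \<chi> w = 4"
    and TC: "card TC = 4" "\<And>u v w. (u, v, w) \<in> TC \<Longrightarrow> {u, v, w} \<in> E \<and> {u, v, w} \<subseteq> set vs \<and> \<chi> u = 1 \<and> \<chi> v = 2 \<and> \<chi> w = 3"
    and len: "length vs \<le> 14"
  shows False
proof -
  let ?e = "\<lambda>(u, v, w). {u, v, w}"
  have fin: "finite TA" "finite TB" "finite TC" by (rule card_ge_0_finite; simp add: TA(1) TB(1) TC(1))+
  have "inj_on ?e TA" by (rule inj_on_coloured_triples[of 0 1 5 _ \<chi>]) (simp_all add: TA(2))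
  then have cA: "card (?e ` TA) = 3" using TA(1) by (simp add: card_image)
  have "inj_on ?e TB" by (rule inj_on_coloured_triples[of 0 2 4 _ \<chi>]) (simp_all add: TB(2))
  then have cB: "card (?e ` TB) = 3" using TB(1) by (simp add: card_image)
  have "inj_on ?e TC" by (rule inj_on_coloured_triples[of 1 2 3 _ \<chi>]) (simp_all add: TC(2))
  then have cC: "card (?e ` TC) = 4" using TC(1) by (simp add: card_image)
  have iA: "\<chi> ` f = {0, 1, 5}" if f: "f \<in> ?e ` TA" for f
  proof -
    obtain u v w where "(u, v, w) \<in> TA" "f = {u, v, w}" using f by auto
    then show ?thesis using TA(2) by simp
  qed
  have iB: "\<chi> ` f = {0, 2, 4}" if f: "f \<in> ?e ` TB" for f
  proof -
    obtain u v w where "(u, v, w) \<in> TB" "f = {u, v, w}" using f by auto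
    then show ?thesis using TB(2) by simp
  qed
  have iC: "\<chi> ` f = {1, 2, 3}" if f: "f \<in> ?e ` TC" for f
  proof -
    obtain u v w where "(u, v, w) \<in> TC" "f = {u, v, w}" using f by auto
    then show ?thesis using TC(2) by simp
  qed
  have separate: "A \<inter> B = {}" if "\<And>f. f \<in> A \<Longrightarrow> i \<in> \<chi> ` f" "\<And>f. f \<in> B \<Longrightarrow> i \<notin> \<chi> ` f" for A B :: "'a set set" and i
    using that by (meson disjoint_iff)
  have AB: "?e ` TA \<inter> ?e ` TB = {}" by (rule separate[of _ 5], simp only: iA, simp, simp only: iB, simp)
  have AC: "?e ` TA \<inter> ?e ` TC = {}" by (rule separate[of _ 5], simp only: iA, simp, simp only: iC, simp)
  have BC: "?e ` TB \<inter> ?e ` TC = {}" by (rule separate[of _ 4], simp only: iB, simp, simp only: iC, simp)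
  have dis: "?e ` TA \<inter> (?e ` TB \<union> ?e ` TC) = {}" by (simp only: Int_Un_distrib AB AC Un_empty_left)
  have "card (?e ` TA \<union> (?e ` TB \<union> ?e ` TC)) = card (?e ` TA) + card (?e ` TB \<union> ?e ` TC)"
    by (rule card_Un_disjoint) (simp_all only: dis fin finite_imageI finite_UnI)
  also have "card (?e ` TB \<union> ?e ` TC) = card (?e ` TB) + card (?e ` TC)"
    by (rule card_Un_disjoint) (simp_all only: BC fin finite_imageI)
  finally have ten: "card (?e ` TA \<union> (?e ` TB \<union> ?e ` TC)) = 10" using cA cB cC by simp
  have edges: "?e ` TA \<union> (?e ` TB \<union> ?e ` TC) \<subseteq> E" using TA(2) TB(2) TC(2) by auto
  have cover: "\<Union>(?e ` TA \<union> (?e ` TB \<union> ?e ` TC)) \<subseteq> set vs" using TA(2) TB(2) TC(2) by fastforce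
  show False by (rule config_freeD[OF free edges ten cover len])
qed

text \<open>The colours are the list positions, and they force the six vertices to be
  distinct.\<close>

definition rainbow_triangle :: "'a set set \<Rightarrow> ('a \<Rightarrow> nat) \<Rightarrow> 'a \<Rightarrow> 'a \<Rightarrow> 'a \<Rightarrow> 'a \<Rightarrow> 'a \<Rightarrow> 'a \<Rightarrow> bool" where
  "rainbow_triangle L \<chi> a b c x y z \<longleftrightarrow> {a, b, z} \<in> L \<and> {a, c, y} \<in> L \<and> {b, c, x} \<in> L \<and>
     \<chi> a = 0 \<and> \<chi> b = 1 \<and> \<chi> c = 2 \<and> \<chi> x = 3 \<and> \<chi> y = 4 \<and> \<chi> z = 5"

text \<open>With \<open>x\<close>, \<open>y\<close>, \<open>z\<close> fixed, a common corner
  propagates: \<open>a\<close> and \<open>z\<close> determine \<open>b\<close>, \<open>a\<close> and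
  \<open>y\<close> determine \<open>c\<close>, and conversely.\<close>

lemma rainbow_triangle_unique:
  assumes lin: "linear_triples L" and t: "rainbow_triangle L \<chi> a b c x y z" "rainbow_triangle L \<chi> a' b' c' x y z"
    and "a = a' \<or> b = b' \<or> c = c'"
  shows "a = a' \<and> b = b' \<and> c = c'"
proof -
  note e = t[unfolded rainbow_triangle_def]
  have "a = a' \<longleftrightarrow> b = b'" using linear_second[OF lin, of a b z b'] linear_first[OF lin, of a b z a'] e by auto
  moreover have "a = a' \<longleftrightarrow> c = c'" using linear_second[OF lin, of a c y c'] linear_first[OF lin, of a c y a'] e by auto
  ultimately show ?thesis using assms(4) by blast
qed

lemma few_triangles:
  assumes free: "config_free E" and L: "L \<subseteq> E" "linear_triples L"
  shows "card {(a, b, c). rainbow_triangle L \<chi> a b c x y z} \<le> 3"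
proof (rule ccontr)
  define M where "M = {(a, b, c). rainbow_triangle L \<chi> a b c x y z}"
  assume "\<not> ?thesis"
  then have "4 \<le> card M" by (simp add: M_def)
  from obtain_subset_with_card_n[OF this] obtain T where T: "T \<subseteq> M" "card T = 4" by auto
  have "card T = Suc 3" using T(2) by simp
  from card_eq_SucD[OF this] obtain t1 T1 where T1: "T = insert t1 T1" "t1 \<notin> T1" "card T1 = 3" by blast
  from T1(3) obtain t2 t3 t4 where "T1 = {t2, t3, t4}" "t2 \<noteq> t3" "t2 \<noteq> t4" "t3 \<noteq> t4"
    unfolding card_3_iff by blast
  with T1(1,2) have t: "T = {t1, t2, t3, t4}" "t1 \<noteq> t2" "t1 \<noteq> t3" "t1 \<noteq> t4" "t2 \<noteq> t3" "t2 \<noteq> t4" "t3 \<noteq> t4"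
    by simp_all
  obtain a1 b1 c1 where t1: "t1 = (a1, b1, c1)" by (cases t1)
  obtain a2 b2 c2 where t2: "t2 = (a2, b2, c2)" by (cases t2)
  obtain a3 b3 c3 where t3: "t3 = (a3, b3, c3)" by (cases t3)
  obtain a4 b4 c4 where t4: "t4 = (a4, b4, c4)" by (cases t4)
  have r: "rainbow_triangle L \<chi> a1 b1 c1 x y z" "rainbow_triangle L \<chi> a2 b2 c2 x y z"
    "rainbow_triangle L \<chi> a3 b3 c3 x y z" "rainbow_triangle L \<chi> a4 b4 c4 x y z"
    using T(1) t(1) unfolding t1 t2 t3 t4 M_def by auto
  have neq: "a \<noteq> a' \<and> b \<noteq> b'"
    if "rainbow_triangle L \<chi> a b c x y z" "rainbow_triangle L \<chi> a' b' c' x y z" "(a, b, c) \<noteq> (a', b', c')" for a b c a' b' c'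
    using rainbow_triangle_unique[OF L(2) that(1,2)] that(3) by fast
  note t' = t(2-)[unfolded t1 t2 t3 t4]
  have d: "a1 \<noteq> a2 \<and> b1 \<noteq> b2" "a1 \<noteq> a3 \<and> b1 \<noteq> b3" "a2 \<noteq> a3 \<and> b2 \<noteq> b3"
      "a1 \<noteq> a4 \<and> b1 \<noteq> b4" "a2 \<noteq> a4 \<and> b2 \<noteq> b4" "a3 \<noteq> a4 \<and> b3 \<noteq> b4"
    by (rule neq[OF r(1,2) t'(1)], rule neq[OF r(1,3) t'(2)], rule neq[OF r(2,3) t'(4)],
      rule neq[OF r(1,4) t'(3)], rule neq[OF r(2,4) t'(5)], rule neq[OF r(3,4) t'(6)])
  note r' = r[unfolded rainbow_triangle_def]
  \<comment> \<open>Four triangles with disjoint corners have 15 vertices and 12 edges; leaving out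
    \<open>a4\<close> with its two edges gives 14 and 10.\<close>
  show False
  proof (rule no_ten_edges[OF free, of "{(a1, b1, z), (a2, b2, z), (a3, b3, z)}" "[x, y, z, a1, a2, a3, b1, b2, b3, b4, c1, c2, c3, c4]" \<chi>
      "{(a1, c1, y), (a2, c2, y), (a3, c3, y)}" "{(b1, c1, x), (b2, c2, x), (b3, c3, x), (b4, c4, x)}"])
    show "card {(a1, b1, z), (a2, b2, z), (a3, b3, z)} = 3" using d by simp
    show "card {(a1, c1, y), (a2, c2, y), (a3, c3, y)} = 3" using d by simp
    show "card {(b1, c1, x), (b2, c2, x), (b3, c3, x), (b4, c4, x)} = 4" using d by simp
  qed (use r' L(1) in auto)
qed

text \<open>By linearity \<open>a\<close> and \<open>z\<close> determine \<open>b\<close>, and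
  \<open>a\<close> and \<open>y\<close> determine \<open>c\<close>. So the triangle with
  \<open>x'\<close> shares \<open>{a, b, z}\<close> with that of \<open>y'\<close> and
  \<open>{a, c, y}\<close> with that of \<open>z'\<close>: twelve edges become ten. The vertices are
  \<open>a\<close>, \<open>b\<close>, \<open>c\<close>, \<open>x\<close>, \<open>y\<close>,
  \<open>z\<close>, the corners \<open>a'\<close>, \<open>b'\<close>, \<open>c'\<close>, and
  \<open>x'\<close>, \<open>y'\<close>, \<open>c2\<close>, \<open>z'\<close>,
  \<open>b1\<close>.\<close>

lemma no_simplex:
  assumes free: "config_free E" and L: "L \<subseteq> E" "linear_triples L"
    and r: "rainbow_triangle L \<chi> a' b' c' x y z" "rainbow_triangle L \<chi> a b c x' y z"
      "rainbow_triangle L \<chi> a b2 c2 x y' z" "rainbow_triangle L \<chi> a b1 c1 x y z'"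
    and d: "a' \<noteq> a" "x' \<noteq> x" "y' \<noteq> y" "z' \<noteq> z"
  shows False
proof -
  note e = r[unfolded rainbow_triangle_def]
  note third = linear_third[OF L(2)] and second = linear_second[OF L(2)] and first = linear_first[OF L(2)]
  have b2: "b2 = b" using second[of a b z b2] e by simp
  have c1: "c1 = c" using second[of a c y c1] e by simp
  \<comment> \<open>If \<open>b1 = b\<close>, the vertices \<open>a\<close> and \<open>b\<close>
    would have the two third vertices \<open>z\<close> and \<open>z'\<close>; if
    \<open>b' = b\<close> or \<open>c' = c\<close>, linearity would give
    \<open>a' = a\<close>.\<close>
  have "b1 \<noteq> b" using third[of a b z z'] e d by auto
  moreover have "c' \<noteq> c" using first[of a c y a'] e d by auto
  moreover have "b' \<noteq> b" using first[of a b z a'] e d by auto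
  ultimately have n: "b1 \<noteq> b" "c' \<noteq> c" "b' \<noteq> b" by auto
  show False
  proof (rule no_ten_edges[OF free, of "{(a, b, z), (a, b1, z'), (a', b', z)}" "[a, x, y, z, b, c, b1, z', c2, y', x', a', b', c']" \<chi>
      "{(a, c, y), (a, c2, y'), (a', c', y)}" "{(b1, c, x), (b, c2, x), (b, c, x'), (b', c', x)}"])
    show "card {(a, b, z), (a, b1, z'), (a', b', z)} = 3" using d by simp
    show "card {(a, c, y), (a, c2, y'), (a', c', y)} = 3" using d by simp
    show "card {(b1, c, x), (b, c2, x), (b, c, x'), (b', c', x)} = 4" using d n by auto
  qed (use e L(1) b2 c1 in auto)
qed

text \<open>Linearity is followed around the triangle: for instance \<open>a\<close> and
  \<open>y\<close> give \<open>c\<close>, then \<open>c\<close> and \<open>x\<close> give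
  \<open>b\<close>, then \<open>a\<close> and \<open>b\<close> give \<open>z\<close>.\<close>

lemma rainbow_triangle_faces:
  assumes lin: "linear_triples L"
  shows "rainbow_triangle L \<chi> a b c x y z \<Longrightarrow> rainbow_triangle L \<chi> a b' c' x y z' \<Longrightarrow> z = z'"
    and "rainbow_triangle L \<chi> a b c x y z \<Longrightarrow> rainbow_triangle L \<chi> a b' c' x y' z \<Longrightarrow> y = y'"
    and "rainbow_triangle L \<chi> a b c x y z \<Longrightarrow> rainbow_triangle L \<chi> a b' c' x' y z \<Longrightarrow> x = x'"
proof -
  note third = linear_third[OF lin] and second = linear_second[OF lin] and first = linear_first[OF lin]
  show "z = z'" if "rainbow_triangle L \<chi> a b c x y z" "rainbow_triangle L \<chi> a b' c' x y z'"
  proof -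
    note e = that[unfolded rainbow_triangle_def]
    have "c = c'" using second[of a c y c'] e by simp
    then have "b = b'" using first[of b c x b'] e by simp
    then show ?thesis using third[of a b z z'] e by simp
  qed
  show "y = y'" if "rainbow_triangle L \<chi> a b c x y z" "rainbow_triangle L \<chi> a b' c' x y' z"
  proof -
    note e = that[unfolded rainbow_triangle_def]
    have "b = b'" using second[of a b z b'] e by simp
    then have "c = c'" using second[of b c x c'] e by simp
    then show ?thesis using third[of a c y y'] e by simp
  qed
  show "x = x'" if "rainbow_triangle L \<chi> a b c x y z" "rainbow_triangle L \<chi> a b' c' x' y z"
  proof -
    note e = that[unfolded rainbow_triangle_def]
    have "b = b'" using second[of a b z b'] e by simp
    moreover have "c = c'" using second[of a c y c'] e by simp
    ultimately show ?thesis using third[of b c x x'] e by simp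
  qed
qed

text \<open>Keeping one corner \<open>a\<close> for each attained \<open>(x, y, z)\<close> makes the
  projection to \<open>(x, y, z)\<close> injective by construction, at the price of the factor 3
  from \<open>few_triangles\<close>.\<close>

lemma triangle_transversal:
  assumes free: "config_free E" and L: "L \<subseteq> E" "linear_triples L" and V: "finite V" "\<forall>e\<in>L. e \<subseteq> V"
  shows "\<exists>Q \<subseteq> V \<times> V \<times> V \<times> V. card {xs\<in>triangles L. \<forall>i<6. \<chi> (xs ! i) = i} \<le> 3 * card Q \<and>
    (\<forall>a x y z. (a, x, y, z) \<in> Q \<longrightarrow> (\<exists>b c. rainbow_triangle L \<chi> a b c x y z)) \<and>
    inj_on (\<lambda>(a, x, y, z). (x, y, z)) Q"
proof -
  let ?R = "{xs\<in>triangles L. \<forall>i<6. \<chi> (xs ! i) = i}"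
  define K where "K = {(x, y, z). \<exists>a b c. rainbow_triangle L \<chi> a b c x y z}"
  define M where "M k = {(a, b, c). case k of (x, y, z) \<Rightarrow> rainbow_triangle L \<chi> a b c x y z}" for k
  have inV: "a \<in> V \<and> b \<in> V \<and> c \<in> V \<and> x \<in> V \<and> y \<in> V \<and> z \<in> V" if "rainbow_triangle L \<chi> a b c x y z" for a b c x y z
  proof -
    have e: "{a, b, z} \<in> L" "{a, c, y} \<in> L" "{b, c, x} \<in> L" using that by (simp_all add: rainbow_triangle_def)
    have "{a, b, z} \<subseteq> V" "{a, c, y} \<subseteq> V" "{b, c, x} \<subseteq> V" by (rule bspec[OF V(2)], rule e)+
    then show ?thesis by simp
  qed
  have finK: "finite K" by (rule finite_subset[of _ "V \<times> V \<times> V"]) (use V inV in \<open>auto simp: K_def\<close>)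
  have finM: "finite (M k)" for k
  proof (cases k)
    case (fields x y z)
    show ?thesis
      by (rule finite_subset[of _ "V \<times> V \<times> V"]) (use V inV in \<open>auto simp: M_def fields\<close>)
  qed
  have cardM: "card (M k) \<le> 3" for k
    unfolding M_def using few_triangles[OF free L, of \<chi>] by (cases k) simp
  let ?f = "\<lambda>(k, t). case k of (x, y, z) \<Rightarrow> case t of (a, b, c) \<Rightarrow> [a, b, c, x, y, z]"
  have "?R \<subseteq> ?f ` (SIGMA k:K. M k)"
  proof
    fix xs assume xs: "xs \<in> ?R"
    then have "xs \<in> triangles L" by simp
    then obtain a b c x y z where e: "xs = [a, b, c, x, y, z]" "{a, b, z} \<in> L" "{a, c, y} \<in> L" "{b, c, x} \<in> L"
      unfolding triangles_def mem_Collect_eq by (elim exE conjE)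
    have "\<chi> (xs ! 0) = 0" "\<chi> (xs ! 1) = 1" "\<chi> (xs ! 2) = 2" "\<chi> (xs ! 3) = 3" "\<chi> (xs ! 4) = 4" "\<chi> (xs ! 5) = 5"
      using xs by simp_all
    then have "rainbow_triangle L \<chi> a b c x y z" using e by (simp add: rainbow_triangle_def)
    then have "((x, y, z), (a, b, c)) \<in> (SIGMA k:K. M k)" by (auto simp: K_def M_def)
    then show "xs \<in> ?f ` (SIGMA k:K. M k)" using e(1) by (intro image_eqI[of _ _ "((x, y, z), (a, b, c))"]) auto
  qed
  then have "card ?R \<le> card (SIGMA k:K. M k)"
    using finK finM by (meson card_image_le card_mono finite_SigmaI finite_imageI order_trans)
  also have "\<dots> = (\<Sum>k\<in>K. card (M k))" using finK finM by (simp add: card_SigmaI)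
  also have "\<dots> \<le> (\<Sum>k\<in>K. 3)" by (intro sum_mono cardM)
  finally have cardR: "card ?R \<le> 3 * card K" by simp
  have "\<forall>k\<in>K. \<exists>a. \<exists>b c. (a, b, c) \<in> M k" by (auto simp: K_def M_def)
  from bchoice[OF this] obtain \<phi> where \<phi>: "\<forall>k\<in>K. \<exists>b c. (\<phi> k, b, c) \<in> M k" by (elim exE)
  let ?Q = "(\<lambda>k. (\<phi> k, k)) ` K"
  have cardQ: "card ?Q = card K" by (intro card_image inj_onI) auto
  have tri: "\<exists>b c. rainbow_triangle L \<chi> a b c x y z" if "(a, x, y, z) \<in> ?Q" for a x y z
    using that \<phi> by (auto simp: M_def)
  have QV: "?Q \<subseteq> V \<times> V \<times> V \<times> V"
  proof
    fix q assume "q \<in> ?Q"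
    moreover obtain a x y z where "q = (a, x, y, z)" by (cases q)
    ultimately show "q \<in> V \<times> V \<times> V \<times> V" using tri[of a x y z] inV by blast
  qed
  have "inj_on (\<lambda>(a, x, y, z). (x, y, z)) ?Q" by (auto simp: inj_on_def)
  then show ?thesis
    using cardR unfolding cardQ[symmetric] by (intro exI[of _ ?Q] conjI QV allI impI tri)
qed

section \<open>Assembly of the bound on the number of edges\<close>

lemma config_free_edges:
  assumes H: "three_uniform H" and n: "14 \<le> card (verts H)"
    and no: "\<not> (\<exists>S. subhypergraph S H \<and> card (verts S) = 14 \<and> card (edges S) = 10)"
  shows "config_free (edges H)"
  unfolding config_free_def
proof (intro allI impI, rule ccontr)
  fix F assume F: "F \<subseteq> edges H" "card F = 10" and "\<not> 14 < card (\<Union>F)"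
  then have small: "card (\<Union>F) \<le> 14" by simp
  have FV: "\<Union>F \<subseteq> verts H" using F(1) H unfolding three_uniform_def by blast
  have fin: "finite (verts H)" using H by (simp add: three_uniform_def)
  obtain W where W: "\<Union>F \<subseteq> W" "W \<subseteq> verts H" "card W = 14"
    using exists_subset_between[OF small n FV fin] by blast
  have "subhypergraph (W, F) H" using W F(1) by (auto simp: subhypergraph_def)
  then show False using no W(3) F(2) by (metis fst_conv snd_conv)
qed

theorem theorem3p4:
  fixes c :: real
  assumes "c > 0"
  shows "\<exists>n0::nat. \<forall>n\<ge>n0. \<forall>H :: 'a hypergraph.
           three_uniform H \<and> card (verts H) = n \<and>
           \<not> (\<exists>S. subhypergraph S H \<and> card (verts S) = 14 \<and> card (edges S) = 10)
           \<longrightarrow> real (card (edges H)) < c * (real n)\<^sup>2"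
proof -
  have c27: "c / 27 > 0" using assms by simp
  obtain \<epsilon> n1 where \<epsilon>: "0 < \<epsilon>" and tri: "\<forall>(V :: 'a set) L. finite V \<longrightarrow> n1 \<le> card V \<longrightarrow> linear_triples L \<longrightarrow> (\<forall>e\<in>L. e \<subseteq> V) \<longrightarrow>
     c / 27 * real (card V) ^ 2 \<le> real (card L) \<longrightarrow> \<epsilon> * real (card V) ^ 3 \<le> real (card (triangles L))"
    using many_triangles[where 'a = 'a, OF c27] by (elim exE conjE)
  \<comment> \<open>The factor \<open>6 ^ 6\<close> pays for the rainbow colouring, 3 for keeping
    one triangle per \<open>(x, y, z)\<close>.\<close>
  define \<delta> where "\<delta> = \<epsilon> / (3 * 6 ^ 6)"
  have \<delta>: "0 < \<delta>" using \<epsilon> by (simp add: \<delta>_def)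
  obtain n2 where simplex: "\<forall>(V :: 'a set) Q. finite V \<longrightarrow> n2 \<le> card V \<longrightarrow> Q \<subseteq> V \<times> V \<times> V \<times> V \<longrightarrow>
    inj_on (\<lambda>(x, y, z, w). (x, y, z)) Q \<longrightarrow> inj_on (\<lambda>(x, y, z, w). (x, y, w)) Q \<longrightarrow>
    inj_on (\<lambda>(x, y, z, w). (x, z, w)) Q \<longrightarrow> inj_on (\<lambda>(x, y, z, w). (y, z, w)) Q \<longrightarrow>
    \<delta> * real (card V) ^ 3 \<le> real (card Q) \<longrightarrow>
    (\<exists>x y z w. (x, y, z, w) \<notin> Q \<and> (y, z, w) \<in> simplex_faces Q 0 \<and> (x, z, w) \<in> simplex_faces Q 1 \<and>
       (x, y, w) \<in> simplex_faces Q 2 \<and> (x, y, z) \<in> simplex_faces Q 3)"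
    using simplex_removal[where 'v = 'a, OF \<delta>] by (elim exE)
  show ?thesis
  \<comment> \<open>The 14 guarantees enough vertices to pad ten edges to a subgraph with exactly 14
    vertices.\<close>
  proof (intro exI[of _ "max 14 (max n1 n2)"] allI impI, elim conjE, rule ccontr)
    fix n and H :: "'a hypergraph"
    assume n: "max 14 (max n1 n2) \<le> n" and H: "three_uniform H" and card: "card (verts H) = n"
      and no: "\<not> (\<exists>S. subhypergraph S H \<and> card (verts S) = 14 \<and> card (edges S) = 10)"
      and "\<not> real (card (edges H)) < c * (real n)\<^sup>2"
    then have many: "c * (real n)\<^sup>2 \<le> real (card (edges H))" by simp
    let ?V = "verts H" and ?E = "edges H"
    have V: "finite ?V" and EV: "\<And>e. e \<in> ?E \<Longrightarrow> e \<subseteq> ?V" and E3: "\<And>e. e \<in> ?E \<Longrightarrow> card e = 3"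
      using H by (auto simp: three_uniform_def)
    have E: "finite ?E" by (rule finite_subset[of _ "Pow ?V"]) (use V EV in auto)
    have n14: "14 \<le> card ?V" and n1: "n1 \<le> card ?V" and n2: "n2 \<le> card ?V" using n card by simp_all
    have free: "config_free ?E" by (rule config_free_edges[OF H n14 no])
    obtain L where L: "L \<subseteq> ?E" "linear_triples L" "card ?E \<le> 27 * card L"
      using large_linear_subset[OF E E3 free] .
    have LV: "\<forall>e\<in>L. e \<subseteq> ?V" using L(1) EV by auto
    have "real (card ?E) \<le> real (27 * card L)" using L(3) by (rule of_nat_mono)
    then have "c / 27 * real (card ?V) ^ 2 \<le> real (card L)" using many card by simp
    with tri V n1 L(2) LV have "\<epsilon> * real (card ?V) ^ 3 \<le> real (card (triangles L))" by blast
    moreover obtain \<chi> :: "'a \<Rightarrow> nat" where \<chi>: "card (triangles L) \<le> 6 ^ 6 * card {xs\<in>triangles L. \<forall>i<6. \<chi> (xs ! i) = i}"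
      by (rule rainbow_colouring[OF V _ finite_triangles[OF V LV] trianglesD[OF _ LV]]) simp_all
    from triangle_transversal[OF free L(1,2) V LV, of \<chi>]
    obtain Q where Q: "Q \<subseteq> ?V \<times> ?V \<times> ?V \<times> ?V" "card {xs\<in>triangles L. \<forall>i<6. \<chi> (xs ! i) = i} \<le> 3 * card Q"
      and rt': "\<forall>a x y z. (a, x, y, z) \<in> Q \<longrightarrow> (\<exists>b c. rainbow_triangle L \<chi> a b c x y z)"
      and inj: "inj_on (\<lambda>(a, x, y, z). (x, y, z)) Q"
      by (elim exE conjE)
    note rt = rt'[rule_format]
    have "card (triangles L) \<le> 6 ^ 6 * (3 * card Q)"
      using \<chi> mult_le_mono2[OF Q(2), of "6 ^ 6"] by (rule order_trans)
    then have "real (card (triangles L)) \<le> real (6 ^ 6 * (3 * card Q))" by (rule of_nat_mono)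
    ultimately have large: "\<delta> * real (card ?V) ^ 3 \<le> real (card Q)" by (simp add: \<delta>_def)
    note faces = rainbow_triangle_faces[OF L(2)]
    have "z = z'" if q: "(a, x, y, z) \<in> Q" "(a, x, y, z') \<in> Q" for a x y z z'
    proof -
      obtain b c where r: "rainbow_triangle L \<chi> a b c x y z" using rt[OF q(1)] by (elim exE)
      obtain b' c' where r': "rainbow_triangle L \<chi> a b' c' x y z'" using rt[OF q(2)] by (elim exE)
      show ?thesis by (rule faces(1)[OF r r'])
    qed
    then have i1: "inj_on (\<lambda>(a, x, y, z). (a, x, y)) Q" by (auto simp: inj_on_def)
    have "y = y'" if q: "(a, x, y, z) \<in> Q" "(a, x, y', z) \<in> Q" for a x y y' z
    proof -
      obtain b c where r: "rainbow_triangle L \<chi> a b c x y z" using rt[OF q(1)] by (elim exE)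
      obtain b' c' where r': "rainbow_triangle L \<chi> a b' c' x y' z" using rt[OF q(2)] by (elim exE)
      show ?thesis by (rule faces(2)[OF r r'])
    qed
    then have i2: "inj_on (\<lambda>(a, x, y, z). (a, x, z)) Q" by (auto simp: inj_on_def)
    have "x = x'" if q: "(a, x, y, z) \<in> Q" "(a, x', y, z) \<in> Q" for a x x' y z
    proof -
      obtain b c where r: "rainbow_triangle L \<chi> a b c x y z" using rt[OF q(1)] by (elim exE)
      obtain b' c' where r': "rainbow_triangle L \<chi> a b' c' x' y z" using rt[OF q(2)] by (elim exE)
      show ?thesis by (rule faces(3)[OF r r'])
    qed
    then have i3: "inj_on (\<lambda>(a, x, y, z). (a, y, z)) Q" by (auto simp: inj_on_def)
    \<comment> \<open>Each face of the new simplex extends to a member of \<open>Q\<close>. As the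
      simplex itself is not in \<open>Q\<close>, that member differs from it in the coordinate
      outside the face, which gives the four inequalities required by
      \<open>no_simplex\<close>.\<close>
    obtain a x y z where new: "(a, x, y, z) \<notin> Q" and f: "(x, y, z) \<in> simplex_faces Q 0" "(a, y, z) \<in> simplex_faces Q 1"
      "(a, x, z) \<in> simplex_faces Q 2" "(a, x, y) \<in> simplex_faces Q 3"
      using simplex[rule_format, OF V n2 Q(1) i1 i2 i3 inj large] by (elim exE conjE)
    obtain a' where a': "(a', x, y, z) \<in> Q" using f(1) by (auto simp: simplex_faces_def)
    obtain x' where x': "(a, x', y, z) \<in> Q" using f(2) by (auto simp: simplex_faces_def)
    obtain y' where y': "(a, x, y', z) \<in> Q" using f(3) by (auto simp: simplex_faces_def)
    obtain z' where z': "(a, x, y, z') \<in> Q" using f(4) by (auto simp: simplex_faces_def)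
    obtain b1 c1 where r1: "rainbow_triangle L \<chi> a' b1 c1 x y z" using rt[OF a'] by (elim exE)
    obtain b2 c2 where r2: "rainbow_triangle L \<chi> a b2 c2 x' y z" using rt[OF x'] by (elim exE)
    obtain b3 c3 where r3: "rainbow_triangle L \<chi> a b3 c3 x y' z" using rt[OF y'] by (elim exE)
    obtain b4 c4 where r4: "rainbow_triangle L \<chi> a b4 c4 x y z'" using rt[OF z'] by (elim exE)
    show False
      by (rule no_simplex[OF free L(1,2) r1 r2 r3 r4]) (use new a' x' y' z' in auto)
  qed
qed

end
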